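(* For $q\in L^2(Q)$ let $p=p(q)$ be the solution of $$\frac{\partial p}{\partial t}+\nu\Delta p-a_0p=-q\ \text{ in }\Omega\times(0,T),\qquad p=0\ \text{ on }\Gamma\times(0,T),\qquad p(T)=0,$$ and set $$J(q)=\langle p,\operatorname{Pr}_{\mathcal{C}}(\tfrac{p}{\gamma})\rangle_{L^2(\mathcal{O})}-\frac{\gamma}{2}\|\operatorname{Pr}_{\mathcal{C}}(\tfrac{p}{\gamma})\|^2_{L^2(\mathcal{O})}-\langle q,y_d\rangle_{L^2(Q)}+\frac12\|q\|^2_{L^2(Q)}.$$ Let $\bar q$ be the unique minimizer of $J$ over $L^2(Q)$. Then $\bar q$ is characterized by the optimality condition $$DJ(\bar q)=\bar z-y_d+\bar q=0,$$ where $\bar z$ is obtained from the successive solution of the state equation $$\frac{\partial\bar p}{\partial t}+\nu\Delta\bar p-a_0\bar p=-\bar q\ \text{ in }\Omega\times(0,T),\qquad \bar p=0\ \text{ on }\Gamma\times(0,T),\qquad \bar p(T)=0,$$ and the adjoint equation $$\frac{\partial\bar z}{\partial t}-\nu\Delta\bar z+a_0\bar z=\operatorname{Pr}_{\mathcal{C}}\Big(\frac{\bar p}{\gamma}\Big)\chi_{\mathcal{O}}\ \text{ in }\Omega\times(0,T),\qquad \bar z=0\ \text{ on }\Gamma\times(0,T),\qquad \bar z(0)=0.$$ That is, an element $\bar q\in L^2(Q)$ is the minimizer of $J$ if and only if, with $\bar p$ and $\bar z$ so defined from $\bar q$, $DJ(\bar q)=\bar z-y_d+\bar q=0$.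
   Context: $\Omega\subset\mathbb{R}^n$ is a domain with piecewise continuous boundary $\Gamma=\partial\Omega$, $0<T<\infty$, $Q=\Omega\times(0,T)$, $O\subset\Omega$ is open and $\mathcal{O}=O\times(0,T)$ with characteristic function $\chi_{\mathcal{O}}$. $\nu>0$ and $\gamma>0$ are constants, $a_0\in L^\infty(Q)$ with $a_0\ge 0$, $y_d\in L^2(Q)$, and $a\le 0\le b$ are real constants. The set $\mathcal{C}=\{u\in L^2(\mathcal{O}) : a\le u(x,t)\le b \text{ a.e. in } \mathcal{O}\}$, and $\operatorname{Pr}_{\mathcal{C}}(v)(x,t)=\min\{b,\max\{a,v(x,t)\}\}$ is the projection onto $\mathcal{C}$. Terms on $\mathcal{O}$ involving $p$ use the restriction of $p$ to $\mathcal{O}$. $DJ(q)\in L^2(Q)$ denotes the first-order differential (gradient) of $J$ at $q$, represented through the $L^2(Q)$ inner product. Solutions of the parabolic equations are understood in the usual weak sense with homogeneous Dirichlet boundary condition. *)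

theory Defs
  imports "HOL-Analysis.Analysis"
begin

section \<open>Square-integrable functions\<close>

text \<open>
  Elements of \<open>L\<^sup>2(A)\<close> are represented by functions on the whole type, of which only the values
  on \<open>A\<close>, up to null sets, matter; equality in \<open>L\<^sup>2(A)\<close> is equality almost everywhere on \<open>A\<close>.
  In particular restriction to a smaller set needs no notation.
\<close>

definition L2 :: "'c::euclidean_space set \<Rightarrow> ('c \<Rightarrow> 'b::euclidean_space) set" where
  "L2 A = {f. f \<in> borel_measurable (lebesgue_on A) \<and>
              integrable (lebesgue_on A) (\<lambda>x. (norm (f x))\<^sup>2)}"

definition L2_inner ::
  "'c::euclidean_space set \<Rightarrow> ('c \<Rightarrow> 'b::euclidean_space) \<Rightarrow> ('c \<Rightarrow> 'b) \<Rightarrow> real" where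
  "L2_inner A f g = (LINT x | lebesgue_on A. f x \<bullet> g x)"

definition L2_norm :: "'c::euclidean_space set \<Rightarrow> ('c \<Rightarrow> 'b::euclidean_space) \<Rightarrow> real" where
  "L2_norm A f = sqrt (L2_inner A f f)"

text \<open>\<open>g\<close> represents the Frechet differential of \<open>J\<close> at \<open>q\<close> through the \<open>L\<^sup>2(A)\<close> inner product.\<close>

definition has_L2_gradient ::
  "'c::euclidean_space set \<Rightarrow> (('c \<Rightarrow> real) \<Rightarrow> real) \<Rightarrow> ('c \<Rightarrow> real) \<Rightarrow> ('c \<Rightarrow> real) \<Rightarrow> bool" where
  "has_L2_gradient A J q g \<longleftrightarrow> g \<in> L2 A \<and>
     (\<forall>\<epsilon>>0. \<exists>\<delta>>0. \<forall>h \<in> L2 A. L2_norm A h \<le> \<delta> \<longrightarrow>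
        \<bar>J (\<lambda>x. q x + h x) - J q - L2_inner A g h\<bar> \<le> \<epsilon> * L2_norm A h)"

definition L2_minimizer ::
  "'c::euclidean_space set \<Rightarrow> (('c \<Rightarrow> real) \<Rightarrow> real) \<Rightarrow> ('c \<Rightarrow> real) \<Rightarrow> bool" where
  "L2_minimizer A J q \<longleftrightarrow> q \<in> L2 A \<and> (\<forall>r \<in> L2 A. J q \<le> J r)"

definition unique_L2_minimizer ::
  "'c::euclidean_space set \<Rightarrow> (('c \<Rightarrow> real) \<Rightarrow> real) \<Rightarrow> ('c \<Rightarrow> real) \<Rightarrow> bool" where
  "unique_L2_minimizer A J q \<longleftrightarrow> L2_minimizer A J q \<and>
     (\<forall>r. L2_minimizer A J r \<longrightarrow> (AE x in lebesgue_on A. r x = q x))"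


section \<open>Domains with piecewise continuous boundary\<close>

text \<open>
  The boundary is a locally finite (hence, for bounded domains, finite) union of continuous
  hypersurface patches, i.e. homeomorphic images of the closed \<open>(n - 1)\<close>-dimensional unit ball.
\<close>

definition piecewise_continuous_boundary :: "'a::euclidean_space set \<Rightarrow> bool" where
  "piecewise_continuous_boundary \<Omega> \<longleftrightarrow>
     (\<exists>\<S>. frontier \<Omega> = \<Union>\<S> \<and>
          (\<forall>R. finite {S \<in> \<S>. S \<inter> cball 0 R \<noteq> {}}) \<and>
          (\<forall>S \<in> \<S>. \<exists>e::'a. e \<noteq> 0 \<and> S homeomorphic {y. e \<bullet> y = 0 \<and> norm y \<le> 1}))"


section \<open>Weak solutions of the parabolic equations\<close>

text \<open>Points of the space-time cylinder \<open>Q\<close> are pairs \<open>(x, t)\<close>.\<close>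

abbreviation cylinder :: "'a::euclidean_space set \<Rightarrow> real \<Rightarrow> ('a \<times> real) set" where
  "cylinder \<Omega> T \<equiv> \<Omega> \<times> {0<..<T}"

definition C1_compact :: "'c::euclidean_space set \<Rightarrow> ('c \<Rightarrow> real) set" where
  "C1_compact U = {\<phi>. (\<forall>z. \<phi> differentiable (at z)) \<and>
      (\<forall>h. continuous_on UNIV (\<lambda>z. frechet_derivative \<phi> (at z) h)) \<and>
      (\<exists>K. compact K \<and> K \<subseteq> U \<and> (\<forall>z. z \<notin> K \<longrightarrow> \<phi> z = 0))}"

definition space_grad :: "('a::euclidean_space \<times> real \<Rightarrow> real) \<Rightarrow> 'a \<times> real \<Rightarrow> 'a" where
  "space_grad \<phi> z = (\<Sum>e\<in>Basis. frechet_derivative \<phi> (at z) (e, 0) *\<^sub>R e)"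

definition time_deriv :: "('a::euclidean_space \<times> real \<Rightarrow> real) \<Rightarrow> 'a \<times> real \<Rightarrow> real" where
  "time_deriv \<phi> z = frechet_derivative \<phi> (at z) (0, 1)"

text \<open>
  The space \<open>L\<^sup>2(0,T; H\<^sup>1\<^sub>0(\<Omega>))\<close>, as the closure, in the norm
  \<open>u \<mapsto> sqrt (\<parallel>u\<parallel>\<^sup>2 + \<parallel>\<nabla>\<^sub>x u\<parallel>\<^sup>2)\<close> with \<open>L\<^sup>2(Q)\<close> norms, of the \<open>C\<^sup>1\<close> functions vanishing near
  the lateral boundary (Ladyzhenskaya, Solonnikov, Ural'ceva); \<open>C\<^sup>\<infinity>\<close> functions give the same closure. Its elements \<open>u\<close> are paired with their weak spatial
  gradient \<open>g\<close>, which is determined by \<open>u\<close> up to null sets. This encodes \<open>u = 0\<close> on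
  \<open>\<Gamma> \<times> (0,T)\<close>.
\<close>

definition energy_space ::
  "'a::euclidean_space set \<Rightarrow> real \<Rightarrow> (('a \<times> real \<Rightarrow> real) \<times> ('a \<times> real \<Rightarrow> 'a)) set" where
  "energy_space \<Omega> T = {(u, g). u \<in> L2 (cylinder \<Omega> T) \<and> g \<in> L2 (cylinder \<Omega> T) \<and>
     (\<exists>\<phi> :: nat \<Rightarrow> 'a \<times> real \<Rightarrow> real.
        (\<forall>k. \<phi> k \<in> C1_compact (\<Omega> \<times> UNIV)) \<and>
        (\<lambda>k. L2_norm (cylinder \<Omega> T) (\<lambda>z. \<phi> k z - u z)) \<longlonglongrightarrow> 0 \<and>
        (\<lambda>k. L2_norm (cylinder \<Omega> T) (\<lambda>z. space_grad (\<phi> k) z - g z)) \<longlonglongrightarrow> 0)}"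

text \<open>
  Weak solution of \<open>p\<^sub>t + \<nu>\<Delta>p - a\<^sub>0p = -q\<close>, \<open>p = 0\<close> on \<open>\<Gamma> \<times> (0,T)\<close>, \<open>p(T) = 0\<close>.
  The test functions vanish near \<open>t = 0\<close> but are unrestricted at \<open>t = T\<close>, so that the identity
  contains the terminal condition.
\<close>

definition weak_state_solution ::
  "'a::euclidean_space set \<Rightarrow> real \<Rightarrow> real \<Rightarrow> ('a \<times> real \<Rightarrow> real) \<Rightarrow>
   ('a \<times> real \<Rightarrow> real) \<Rightarrow> ('a \<times> real \<Rightarrow> real) \<Rightarrow> bool" where
  "weak_state_solution \<Omega> T \<nu> a0 q p \<longleftrightarrow>
     (\<exists>g. (p, g) \<in> energy_space \<Omega> T \<and>
        (\<forall>\<phi> \<in> C1_compact (\<Omega> \<times> {0<..}).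
           (LINT z | lebesgue_on (cylinder \<Omega> T).
              - p z * time_deriv \<phi> z - \<nu> * (g z \<bullet> space_grad \<phi> z) - a0 z * p z * \<phi> z)
           = (LINT z | lebesgue_on (cylinder \<Omega> T). - q z * \<phi> z)))"

text \<open>
  Weak solution of \<open>z\<^sub>t - \<nu>\<Delta>z + a\<^sub>0z = f\<close>, \<open>z = 0\<close> on \<open>\<Gamma> \<times> (0,T)\<close>, \<open>z(0) = 0\<close>.
  Here the test functions vanish near \<open>t = T\<close> but are unrestricted at \<open>t = 0\<close>.
\<close>

definition weak_adjoint_solution ::
  "'a::euclidean_space set \<Rightarrow> real \<Rightarrow> real \<Rightarrow> ('a \<times> real \<Rightarrow> real) \<Rightarrow>
   ('a \<times> real \<Rightarrow> real) \<Rightarrow> ('a \<times> real \<Rightarrow> real) \<Rightarrow> bool" where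
  "weak_adjoint_solution \<Omega> T \<nu> a0 f z \<longleftrightarrow>
     (\<exists>g. (z, g) \<in> energy_space \<Omega> T \<and>
        (\<forall>\<phi> \<in> C1_compact (\<Omega> \<times> {..<T}).
           (LINT y | lebesgue_on (cylinder \<Omega> T).
              - z y * time_deriv \<phi> y + \<nu> * (g y \<bullet> space_grad \<phi> y) + a0 y * z y * \<phi> y)
           = (LINT y | lebesgue_on (cylinder \<Omega> T). f y * \<phi> y)))"


section \<open>The functional\<close>

definition Pr :: "real \<Rightarrow> real \<Rightarrow> ('c \<Rightarrow> real) \<Rightarrow> 'c \<Rightarrow> real" where
  "Pr a b v = (\<lambda>z. min b (max a (v z)))"

text \<open>
  Weak solutions exist and are unique only up to null sets, hence the choice operator rather than
  a definite description; the value of \<open>J\<close> below does not depend on the representative.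
\<close>

definition state ::
  "'a::euclidean_space set \<Rightarrow> real \<Rightarrow> real \<Rightarrow> ('a \<times> real \<Rightarrow> real) \<Rightarrow>
   ('a \<times> real \<Rightarrow> real) \<Rightarrow> 'a \<times> real \<Rightarrow> real" where
  "state \<Omega> T \<nu> a0 q = (SOME p. weak_state_solution \<Omega> T \<nu> a0 q p)"

definition J ::
  "'a::euclidean_space set \<Rightarrow> 'a set \<Rightarrow> real \<Rightarrow> real \<Rightarrow> real \<Rightarrow> real \<Rightarrow> real \<Rightarrow>
   ('a \<times> real \<Rightarrow> real) \<Rightarrow> ('a \<times> real \<Rightarrow> real) \<Rightarrow> ('a \<times> real \<Rightarrow> real) \<Rightarrow> real" where
  "J \<Omega> O' T \<nu> \<gamma> a b a0 yd q =
     (let p = state \<Omega> T \<nu> a0 q; v = Pr a b (\<lambda>z. p z / \<gamma>) in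
        L2_inner (cylinder O' T) p v
        - \<gamma> / 2 * (L2_norm (cylinder O' T) v)\<^sup>2
        - L2_inner (cylinder \<Omega> T) q yd
        + 1 / 2 * (L2_norm (cylinder \<Omega> T) q)\<^sup>2)"

end

theory Submission
  imports Defs
begin

text \<open>
  Weak solutions exist by Lions' projection lemma in the Hilbert space of pairs \<open>(u, \<nabla>u)\<close>. The
  state \<open>p\<close> of \<open>q\<close> and the solution \<open>z\<close> of the adjoint equation with right-hand side \<open>f\<close> satisfy
  \<open>\<langle>p, f\<rangle> = \<langle>z, q\<rangle>\<close>; together with the solvability of the adjoint equation this also gives
  uniqueness of the state, hence linearity and boundedness of \<open>q \<mapsto> p\<close>.

  The first two terms of \<open>J\<close> are the integral over \<open>\<O>\<close> of
  \<open>\<Gamma>(p)\<close>, where \<open>\<Gamma>(s) = max {s v - \<gamma> v\<^sup>2 / 2 | a \<le> v \<le> b}\<close> is convex with the Lipschitz derivative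
  \<open>\<Gamma>'(s) = Pr (s / \<gamma>)\<close>. With duality this gives
  \<open>\<parallel>h\<parallel>\<^sup>2 / 2 \<le> J(q + h) - J(q) - \<langle>z - y\<^sub>d + q, h\<rangle> \<le> K \<parallel>h\<parallel>\<^sup>2\<close>, and both claims follow from
  these two bounds.
\<close>

section \<open>Hilbert spaces\<close>

text \<open>In the weak equations the time derivative falls on the test, so the bilinear form pairs
  an energy element with a smooth function and is not defined on the energy space squared. This
  rules out Lax-Milgram and explains why Lions' lemma asks for an inf-sup bound on tests only. The
  same lack of regularity is the obstacle in the duality: state and adjoint are not admissible tests
  for each other. The way out is that the energy norm contains no time derivative. Cutting off in
  time is therefore harmless, the energy space is already generated by tests supported inside
  \<open>Q\<close>, and such tests may be shifted in time: one direction yields tests for the state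
  equation, the other for the adjoint equation.

  The two bounds on the expansion of \<open>J\<close> come from comparing maximizers in the
  definition of \<Gamma>. The factor 1/2 on the left is that of the quadratic term of
  \<open>J\<close>; \<open>K\<close> is \<open>stability_const\<^sup>2 / \<gamma> + 1/2\<close>,
  where 1/\<gamma> is the Lipschitz constant of \<Gamma>' and \<open>stability_const\<close> bounds
  the solution operator.\<close>

lemma parallelogram_law:
  fixes x y :: "'h::real_inner"
  shows "(norm (x - y))\<^sup>2 = 2 * (norm x)\<^sup>2 + 2 * (norm y)\<^sup>2 - (norm (x + y))\<^sup>2"
  by (simp add: power2_norm_eq_inner inner_add_left inner_add_right inner_diff_left inner_diff_right inner_commute)

lemma subspace_closure:
  fixes S :: "'h::real_normed_vector set"
  assumes S: "subspace S"
  shows "subspace (closure S)"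
  unfolding subspace_def
proof (intro conjI ballI allI)
  show "0 \<in> closure S" using subspace_0[OF S] closure_subset by blast
  show "x + y \<in> closure S" if xy: "x \<in> closure S" "y \<in> closure S" for x y
  proof -
    obtain f g where "\<forall>n. f n \<in> S" "f \<longlonglongrightarrow> x" "\<forall>n. g n \<in> S" "g \<longlonglongrightarrow> y"
      using xy unfolding closure_sequential by blast
    then show ?thesis
      unfolding closure_sequential
      by (intro exI[of _ "\<lambda>n. f n + g n"] conjI tendsto_add allI subspace_add[OF S]) auto
  qed
  show "c *\<^sub>R x \<in> closure S" if x: "x \<in> closure S" for c x
  proof -
    obtain f where "\<forall>n. f n \<in> S" "f \<longlonglongrightarrow> x"
      using x unfolding closure_sequential by blast
    then show ?thesis
      unfolding closure_sequential
      by (intro exI[of _ "\<lambda>n. c *\<^sub>R f n"] conjI tendsto_scaleR tendsto_const allI subspace_scale[OF S]) auto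
  qed
qed

text \<open>For small t the linear term dominates, so a nonzero \<alpha> would give a negative value
  for one sign of t. This turns minimality along a line into a vanishing first variation, both in
  the Riesz lemma and for minimizers of a functional with a quadratic upper bound.\<close>

lemma quadratic_nonneg_imp_linear_zero:
  fixes \<alpha> \<beta> :: real
  assumes "\<And>t. 0 \<le> t * \<alpha> + t\<^sup>2 * \<beta>"
  shows "\<alpha> = 0"
proof (rule ccontr)
  assume "\<alpha> \<noteq> 0"
  define B where "B = \<bar>\<beta>\<bar> + 1"
  have B: "B > 0" "\<beta> < B" by (auto simp: B_def)
  have "0 \<le> (- \<alpha> / B) * \<alpha> + (- \<alpha> / B)\<^sup>2 * \<beta>" by (rule assms)
  also have "\<dots> = (\<alpha> / B)\<^sup>2 * (\<beta> - B)"
    using B by (simp add: field_simps power2_eq_square)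
  also have "\<dots> < 0" using B \<open>\<alpha> \<noteq> 0\<close> by (intro mult_pos_neg) auto
  finally show False by simp
qed

text \<open>
  Linear functionals are given by their graphs, so that single-valuedness never has to be checked
  separately: it is part of the bound \<open>\<bar>r\<bar> \<le> C * norm s\<close>.
\<close>

lemma riesz_graph:
  fixes R :: "('h::{real_inner,complete_space} \<times> real) set"
  assumes R: "subspace R" and bd: "\<And>s r. (s, r) \<in> R \<Longrightarrow> \<bar>r\<bar> \<le> C * norm s" and "0 \<le> C"
  obtains u where "u \<in> closure (fst ` R)" "norm u \<le> C" "\<And>s r. (s, r) \<in> R \<Longrightarrow> u \<bullet> s = r"
proof -
  \<comment> \<open>\<open>I\<close> is the quadratic functional minimized by the Riesz
    representative. The domain of the linear functional need not be closed, so the infimum is only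
    approached by a sequence; its limit \<open>u\<close> lies in the closure.\<close>
  define I where "I = (\<lambda>x::'h \<times> real. (norm (fst x))\<^sup>2 - 2 * snd x)"
  have lower: "- C\<^sup>2 \<le> I x" if "x \<in> R" for x
  proof -
    obtain s r where x: "x = (s, r)" by force
    have "\<bar>r\<bar> \<le> C * norm s" using bd that x by auto
    moreover have "0 \<le> (norm s - C)\<^sup>2" by simp
    ultimately have "- C\<^sup>2 \<le> (norm s)\<^sup>2 - 2 * r" by (simp add: power2_diff mult_ac)
    then show ?thesis by (simp add: I_def x)
  qed
  define m where "m = Inf (I ` R)"
  have ne: "R \<noteq> {}" using R subspace_0 by auto
  have bb: "bdd_below (I ` R)" by (rule bdd_belowI2[of R "- C\<^sup>2" I]) (rule lower)
  have mle: "m \<le> I x" if "x \<in> R" for x unfolding m_def by (rule cINF_lower[OF bb that])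
  have "\<exists>x\<in>R. I x < m + inverse (Suc n)" for n
  proof -
    have "m < m + inverse (Suc n)" by simp
    then show ?thesis unfolding m_def using cInf_lessD[of "I ` R"] ne by auto
  qed
  then obtain X where X: "\<And>n. X n \<in> R" "\<And>n. I (X n) < m + inverse (Suc n)" by metis
  \<comment> \<open>The midpoint of two near-minimizers stays in the graph and cannot go below
    \<open>m\<close>; the parallelogram law then forces them to be close.\<close>
  have diff: "(norm (fst (X i) - fst (X j)))\<^sup>2 \<le> 2 * inverse (Suc i) + 2 * inverse (Suc j)" for i j
  proof -
    have "(1/2) *\<^sub>R (X i + X j) \<in> R" using X R by (intro subspace_scale subspace_add)
    then have "m \<le> I ((1/2) *\<^sub>R (X i + X j))" by (rule mle)
    moreover have "norm (fst ((1/2) *\<^sub>R (X i + X j))) = norm (fst (X i) + fst (X j)) / 2" by simp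
    ultimately have "m \<le> (norm (fst (X i) + fst (X j)) / 2)\<^sup>2 - (snd (X i) + snd (X j))"
      unfolding I_def by (simp add: add_divide_distrib)
    then have "4 * m \<le> (norm (fst (X i) + fst (X j)))\<^sup>2 - 4 * (snd (X i) + snd (X j))"
      by (simp add: power_divide)
    moreover have "2 * I (X i) + 2 * I (X j) \<le> 4 * m + 2 * inverse (Suc i) + 2 * inverse (Suc j)"
      using X(2)[of i] X(2)[of j] by linarith
    ultimately show ?thesis
      unfolding parallelogram_law[of "fst (X i)" "fst (X j)"] I_def by (simp add: algebra_simps)
  qed
  have "Cauchy (\<lambda>n. fst (X n))"
  proof (rule metric_CauchyI)
    fix e :: real assume "0 < e"
    then have "0 < e\<^sup>2 / 4" by simp
    then obtain N where N: "inverse (Suc N) < e\<^sup>2 / 4" using reals_Archimedean by blast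
    have "dist (fst (X i)) (fst (X j)) < e" if "i \<ge> N" "j \<ge> N" for i j
    proof -
      have "inverse (Suc i) \<le> inverse (real (Suc N))" "inverse (Suc j) \<le> inverse (real (Suc N))"
        using that by (auto intro!: le_imp_inverse_le)
      then have "(norm (fst (X i) - fst (X j)))\<^sup>2 < e\<^sup>2" using diff[of i j] N by linarith
      then show ?thesis using \<open>0 < e\<close> by (simp add: dist_norm power_less_imp_less_base)
    qed
    then show "\<exists>M. \<forall>i\<ge>M. \<forall>j\<ge>M. dist (fst (X i)) (fst (X j)) < e" by blast
  qed
  then obtain u where u: "(\<lambda>n. fst (X n)) \<longlonglongrightarrow> u" using Cauchy_convergent_iff convergent_def by blast
  have cl: "u \<in> closure (fst ` R)" unfolding closure_sequential using u X(1) by (intro exI[of _ "\<lambda>n. fst (X n)"]) auto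
  have eq: "u \<bullet> s = r" if sr: "(s, r) \<in> R" for s r
  proof -
    \<comment> \<open>Moving \<open>X n\<close> by \<open>t\<close> in the direction (s, r) lowers
      \<open>I\<close> by at most the defect \<open>inverse (Suc n)\<close>; the limit in
      \<open>n\<close> is the first variation at \<open>u\<close>.\<close>
    have "0 \<le> t * (2 * (u \<bullet> s - r)) + t\<^sup>2 * (norm s)\<^sup>2" for t
    proof -
      have ge: "0 \<le> inverse (Suc n) + (t * (2 * (fst (X n) \<bullet> s - r)) + t\<^sup>2 * (norm s)\<^sup>2)" for n
      proof -
        have "X n + t *\<^sub>R (s, r) \<in> R" using X R sr by (intro subspace_scale subspace_add)
        then have "m \<le> I (X n + t *\<^sub>R (s, r))" by (rule mle)
        also have "\<dots> = (norm (fst (X n) + t *\<^sub>R s))\<^sup>2 - 2 * (snd (X n) + t * r)"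
          by (simp add: I_def)
        also have "(norm (fst (X n) + t *\<^sub>R s))\<^sup>2
            = (norm (fst (X n)))\<^sup>2 + 2 * t * (fst (X n) \<bullet> s) + t\<^sup>2 * (norm s)\<^sup>2"
          unfolding power2_norm_eq_inner
          by (simp add: inner_add_left inner_add_right inner_commute power2_eq_square algebra_simps)
        finally have "m \<le> I (X n) + t * (2 * (fst (X n) \<bullet> s - r)) + t\<^sup>2 * (norm s)\<^sup>2"
          by (simp add: I_def algebra_simps)
        then show ?thesis using X(2)[of n] by linarith
      qed
      have "(\<lambda>n. inverse (Suc n) + (t * (2 * (fst (X n) \<bullet> s - r)) + t\<^sup>2 * (norm s)\<^sup>2))
         \<longlonglongrightarrow> 0 + (t * (2 * (u \<bullet> s - r)) + t\<^sup>2 * (norm s)\<^sup>2)"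
        by (intro tendsto_intros u LIMSEQ_inverse_real_of_nat)
      from LIMSEQ_le_const[OF this] ge show ?thesis by auto
    qed
    from quadratic_nonneg_imp_linear_zero[OF this] show ?thesis by simp
  qed
  \<comment> \<open>The norm bound comes from representing the functional at \<open>X n\<close> and
    letting \<open>n\<close> grow, which gives
    \<open>norm u * norm u \<le> C * norm u\<close>.\<close>
  have "(\<lambda>n. norm (u \<bullet> fst (X n))) \<longlonglongrightarrow> norm (u \<bullet> u)" by (intro tendsto_intros u)
  moreover have "(\<lambda>n. C * norm (fst (X n))) \<longlonglongrightarrow> C * norm u" by (intro tendsto_intros u)
  moreover have "norm (u \<bullet> fst (X n)) \<le> C * norm (fst (X n))" for n
    using eq[of "fst (X n)" "snd (X n)"] bd[of "fst (X n)" "snd (X n)"] X by simp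
  ultimately have "norm (u \<bullet> u) \<le> C * norm u" by (auto intro: LIMSEQ_le)
  then have "norm u * norm u \<le> C * norm u" by (simp add: dot_square_norm power2_eq_square)
  then have "norm u \<le> C" using \<open>0 \<le> C\<close> by (cases "norm u = 0") auto
  then show thesis using that cl eq by blast
qed

text \<open>The orthogonal projection of \<open>x\<close> is the Riesz representative of the
  functional given by \<open>x\<close> on \<open>V\<close>, bounded by \<open>norm x\<close> through
  Cauchy-Schwarz; closedness of \<open>V\<close> keeps the representative inside.\<close>

lemma closed_subspace_projection:
  fixes V :: "'h::{real_inner,complete_space} set"
  assumes V: "subspace V" "closed V"
  obtains p where "p \<in> V" "\<And>v. v \<in> V \<Longrightarrow> v \<bullet> p = v \<bullet> x"
proof -
  let ?R = "(\<lambda>v. (v, v \<bullet> x)) ` V"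
  have "linear (\<lambda>v. (v, v \<bullet> x))"
    by (auto intro!: linearI simp: inner_add_left)
  then have "subspace ?R" using V(1) by (rule linear_subspace_image)
  then obtain u where "u \<in> closure (fst ` ?R)" "\<And>s r. (s, r) \<in> ?R \<Longrightarrow> u \<bullet> s = r"
    by (rule riesz_graph[where C = "norm x"]) (auto simp: Cauchy_Schwarz_ineq2 mult.commute)
  moreover have "fst ` ?R = V" by force
  ultimately show thesis using V that[of u] by (force simp: inner_commute closure_closed)
qed

text \<open>J.-L. Lions' generalisation of the Lax--Milgram lemma.\<close>

lemma lions_projection:
  fixes V :: "'h::{real_inner,complete_space} set" and G :: "('h \<times> 'h) set"
  assumes V: "subspace V" "closed V" and G: "subspace G" and "0 < c" "0 \<le> M"
    and inf_sup: "\<And>j b. (j, b) \<in> G \<Longrightarrow> \<exists>v\<in>V. norm v \<le> M * norm j \<and> c * (norm j)\<^sup>2 \<le> v \<bullet> b"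
  obtains u where "u \<in> V" "norm u \<le> M / c * norm f" "\<And>j b. (j, b) \<in> G \<Longrightarrow> u \<bullet> b = f \<bullet> j"
proof -
  \<comment> \<open>The graph of the functional that sends the projection \<open>s\<close> of
    \<open>b\<close> onto \<open>V\<close> to \<open>f \<bullet> j\<close>. All its arguments lie in
    the closed set \<open>V\<close>, hence so does its representative, and against an element of
    \<open>V\<close> the vector \<open>b\<close> may be replaced by \<open>s\<close>.\<close>
  define R where "R = {(s, f \<bullet> j) | s j. s \<in> V \<and> (\<exists>b. (j, b) \<in> G \<and> (\<forall>v\<in>V. v \<bullet> s = v \<bullet> b))}" (is "R = ?R")
  have sub: "subspace R"
    unfolding subspace_def R_def
  proof (intro conjI ballI allI)
    have "(0, 0) \<in> G" using subspace_0[OF G] by (simp add: zero_prod_def)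
    then show "0 \<in> ?R" using subspace_0[OF V(1)] by (force simp: zero_prod_def)
  next
    fix x y assume "x \<in> ?R" "y \<in> ?R"
    then obtain s j b s' j' b' where *: "x = (s, f \<bullet> j)" "y = (s', f \<bullet> j')" "s \<in> V" "s' \<in> V"
      "(j, b) \<in> G" "(j', b') \<in> G" "\<forall>v\<in>V. v \<bullet> s = v \<bullet> b" "\<forall>v\<in>V. v \<bullet> s' = v \<bullet> b'" by auto
    have "(j + j', b + b') \<in> G" using subspace_add[OF G *(5,6)] by simp
    with * V show "x + y \<in> ?R"
      by (intro CollectI exI[of _ "s + s'"] exI[of _ "j + j'"]) (auto simp: inner_add_right subspace_add intro!: exI[of _ "b + b'"])
  next
    fix t x assume "x \<in> ?R"
    then obtain s j b where *: "x = (s, f \<bullet> j)" "s \<in> V" "(j, b) \<in> G" "\<forall>v\<in>V. v \<bullet> s = v \<bullet> b" by auto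
    have "(t *\<^sub>R j, t *\<^sub>R b) \<in> G" using subspace_scale[OF G *(3), of t] by simp
    with * V show "t *\<^sub>R x \<in> ?R"
      by (intro CollectI exI[of _ "t *\<^sub>R s"] exI[of _ "t *\<^sub>R j"]) (auto simp: subspace_scale intro!: exI[of _ "t *\<^sub>R b"])
  qed
  \<comment> \<open>The inf-sup hypothesis yields \<open>c * norm j \<le> M * norm s\<close>, which
    makes the functional single-valued and gives its bound.\<close>
  have bd: "\<bar>r\<bar> \<le> M / c * norm f * norm s" if sr: "(s, r) \<in> R" for s r
  proof -
    from sr obtain j b where *: "r = f \<bullet> j" "(j, b) \<in> G" "\<forall>v\<in>V. v \<bullet> s = v \<bullet> b"
      by (auto simp: R_def)
    from inf_sup[OF *(2)] obtain v where v: "v \<in> V" "norm v \<le> M * norm j" "c * (norm j)\<^sup>2 \<le> v \<bullet> b" by blast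
    have "c * (norm j)\<^sup>2 \<le> v \<bullet> s" using v * by auto
    also have "\<dots> \<le> norm v * norm s" by (rule norm_cauchy_schwarz)
    also have "\<dots> \<le> M * norm j * norm s" using v by (intro mult_right_mono) auto
    finally have "(c * norm j) * norm j \<le> (M * norm s) * norm j" by (simp add: power2_eq_square mult_ac)
    then have "c * norm j \<le> M * norm s" using \<open>0 \<le> M\<close>
      by (cases "norm j = 0") (auto intro: mult_right_le_imp_le)
    then have "norm j \<le> M / c * norm s" using \<open>0 < c\<close> by (simp add: field_simps)
    moreover have "\<bar>r\<bar> \<le> norm f * norm j" using * by (simp add: Cauchy_Schwarz_ineq2)
    ultimately show ?thesis
      by (smt (verit) mult.assoc mult.left_commute mult_left_mono norm_ge_zero)
  qed
  have nonneg: "0 \<le> M / c * norm f" using \<open>0 < c\<close> \<open>0 \<le> M\<close> by simp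
  obtain u where u: "u \<in> closure (fst ` R)" "norm u \<le> M / c * norm f"
    "\<And>s r. (s, r) \<in> R \<Longrightarrow> u \<bullet> s = r"
    using riesz_graph[OF sub bd nonneg] by blast
  have "fst ` R \<subseteq> V" by (auto simp: R_def)
  then have "u \<in> V" using u V by (meson closure_minimal subsetD)
  moreover have "u \<bullet> b = f \<bullet> j" if jb: "(j, b) \<in> G" for j b
  proof -
    obtain p where p: "p \<in> V" "\<And>v. v \<in> V \<Longrightarrow> v \<bullet> p = v \<bullet> b" by (rule closed_subspace_projection[OF V, of b]) blast
    have "u \<bullet> p = f \<bullet> j" using p jb by (intro u(3)) (auto simp: R_def)
    with p \<open>u \<in> V\<close> show ?thesis by auto
  qed
  ultimately show thesis using that u by blast
qed

section \<open>The Hilbert space of square-integrable functions\<close>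

lemma L2_UNIV_iff:
  "f \<in> L2 UNIV \<longleftrightarrow> f \<in> borel_measurable lebesgue \<and> integrable lebesgue (\<lambda>x. (norm (f x))\<^sup>2)"
  by (simp add: L2_def lebesgue_on_UNIV_eq)

lemma L2_measurable: "f \<in> L2 A \<Longrightarrow> f \<in> borel_measurable (lebesgue_on A)"
  by (simp add: L2_def)

lemma L2_inner_integrable:
  assumes "f \<in> L2 A" "g \<in> L2 A"
  shows "integrable (lebesgue_on A) (\<lambda>x. f x \<bullet> g x)"
proof (rule Bochner_Integration.integrable_bound)
  show "integrable (lebesgue_on A) (\<lambda>x. (norm (f x))\<^sup>2 + (norm (g x))\<^sup>2)"
    using assms by (auto simp: L2_def)
  show "(\<lambda>x. f x \<bullet> g x) \<in> borel_measurable (lebesgue_on A)"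
    using assms by (auto simp: L2_def)
  have "\<bar>f x \<bullet> g x\<bar> \<le> (norm (f x))\<^sup>2 + (norm (g x))\<^sup>2" for x
  proof -
    have "\<bar>f x \<bullet> g x\<bar> \<le> norm (f x) * norm (g x)" by (rule Cauchy_Schwarz_ineq2)
    also have "2 * \<dots> \<le> (norm (f x))\<^sup>2 + (norm (g x))\<^sup>2"
      using sum_squares_bound[of "norm (f x)" "norm (g x)"] by (simp add: mult.assoc)
    finally show ?thesis using norm_ge_zero[of "f x"] norm_ge_zero[of "g x"]
      by (smt (verit) mult_nonneg_nonneg)
  qed
  then show "AE x in lebesgue_on A. norm (f x \<bullet> g x) \<le> norm ((norm (f x))\<^sup>2 + (norm (g x))\<^sup>2)"
    by (auto intro!: AE_I2)
qed

lemma L2_add: assumes "f \<in> L2 A" "g \<in> L2 A" shows "(\<lambda>x. f x + g x) \<in> L2 A"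
proof -
  have "(norm (f x + g x))\<^sup>2 = (norm (f x))\<^sup>2 + (norm (g x))\<^sup>2 + 2 * (f x \<bullet> g x)" for x
    by (simp add: power2_norm_eq_inner inner_add_left inner_add_right inner_commute)
  then show ?thesis
    using assms L2_inner_integrable[OF assms] by (auto simp: L2_def)
qed

lemma L2_scaleR: assumes "f \<in> L2 A" shows "(\<lambda>x. c *\<^sub>R f x) \<in> L2 A"
  using assms by (auto simp: L2_def power_mult_distrib)

lemma L2_zero: "(\<lambda>x. 0) \<in> L2 A"
  by (simp add: L2_def)

lemma L2_uminus: assumes "f \<in> L2 A" shows "(\<lambda>x. - f x) \<in> L2 A"
  using assms by (auto simp: L2_def)

lemma L2_diff: assumes "f \<in> L2 A" "g \<in> L2 A" shows "(\<lambda>x. f x - g x) \<in> L2 A"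
  using L2_add[OF assms(1) L2_uminus[OF assms(2)]] by simp

\<comment> \<open>A type is needed so that closures, completeness and Lions' lemma are available
  through type classes. It carries no domain: functions on a set enter through extension by zero,
  see \<open>cls\<close>. The relation is partial because only square-integrable functions represent
  an element.\<close>
quotient_type (overloaded) ('c, 'b) l2 = "'c::euclidean_space \<Rightarrow> 'b::euclidean_space" /
  partial: "\<lambda>f g. f \<in> L2 UNIV \<and> g \<in> L2 UNIV \<and> (AE x in lebesgue. f x = g x)"
proof (rule part_equivpI)
  show "\<exists>f::'c \<Rightarrow> 'b. f \<in> L2 UNIV \<and> f \<in> L2 UNIV \<and> (AE x in lebesgue. f x = f x)"
    using L2_zero by auto
  show "symp (\<lambda>f g. f \<in> L2 UNIV \<and> g \<in> L2 UNIV \<and> (AE x in lebesgue. (f::'c \<Rightarrow> 'b) x = g x))"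
    by (auto intro!: sympI)
  show "transp (\<lambda>f g. f \<in> L2 UNIV \<and> g \<in> L2 UNIV \<and> (AE x in lebesgue. (f::'c \<Rightarrow> 'b) x = g x))"
  proof (rule transpI)
    fix f g h :: "'c \<Rightarrow> 'b"
    assume *: "f \<in> L2 UNIV \<and> g \<in> L2 UNIV \<and> (AE x in lebesgue. f x = g x)"
      "g \<in> L2 UNIV \<and> h \<in> L2 UNIV \<and> (AE x in lebesgue. g x = h x)"
    then have "AE x in lebesgue. f x = g x" "AE x in lebesgue. g x = h x" by auto
    then have "AE x in lebesgue. f x = h x" by eventually_elim simp
    with * show "f \<in> L2 UNIV \<and> h \<in> L2 UNIV \<and> (AE x in lebesgue. f x = h x)" by auto
  qed
qed

lemma L2_inner_cong_AE:
  assumes "f \<in> L2 A" "f' \<in> L2 A" "g \<in> L2 A" "g' \<in> L2 A"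
    and "AE x in lebesgue_on A. f x = f' x" "AE x in lebesgue_on A. g x = g' x"
  shows "L2_inner A f g = L2_inner A f' g'"
  unfolding L2_inner_def
proof (rule integral_cong_AE)
  show "AE x in lebesgue_on A. f x \<bullet> g x = f' x \<bullet> g' x"
    using assms(5,6) by eventually_elim simp
qed (use assms(1-4) in \<open>auto simp: L2_def\<close>)

instantiation l2 :: (euclidean_space, euclidean_space) real_inner
begin

lift_definition zero_l2 :: "('a, 'b) l2" is "\<lambda>x. 0" by (simp add: L2_zero)

lift_definition plus_l2 :: "('a, 'b) l2 \<Rightarrow> ('a, 'b) l2 \<Rightarrow> ('a, 'b) l2" is "\<lambda>f g x. f x + g x"
  by (auto simp: L2_add)

lift_definition minus_l2 :: "('a, 'b) l2 \<Rightarrow> ('a, 'b) l2 \<Rightarrow> ('a, 'b) l2" is "\<lambda>f g x. f x - g x"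
  by (auto simp: L2_diff)

lift_definition uminus_l2 :: "('a, 'b) l2 \<Rightarrow> ('a, 'b) l2" is "\<lambda>f x. - f x"
  by (auto simp: L2_uminus)

lift_definition scaleR_l2 :: "real \<Rightarrow> ('a, 'b) l2 \<Rightarrow> ('a, 'b) l2" is "\<lambda>c f x. c *\<^sub>R f x"
  by (auto simp: L2_scaleR)

lift_definition inner_l2 :: "('a, 'b) l2 \<Rightarrow> ('a, 'b) l2 \<Rightarrow> real" is "L2_inner UNIV"
  by (intro L2_inner_cong_AE, unfold lebesgue_on_UNIV_eq) auto

definition norm_l2 :: "('a, 'b) l2 \<Rightarrow> real" where "norm_l2 x = sqrt (x \<bullet> x)"
definition sgn_l2 :: "('a, 'b) l2 \<Rightarrow> ('a, 'b) l2" where "sgn_l2 x = scaleR (inverse (norm x)) x"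
definition dist_l2 :: "('a, 'b) l2 \<Rightarrow> ('a, 'b) l2 \<Rightarrow> real" where "dist_l2 x y = norm (x - y)"
definition uniformity_l2 :: "(('a, 'b) l2 \<times> ('a, 'b) l2) filter"
  where "uniformity_l2 = (INF e\<in>{0<..}. principal {(x, y). dist x y < e})"
definition open_l2 :: "('a, 'b) l2 set \<Rightarrow> bool"
  where "open_l2 U = (\<forall>x\<in>U. \<forall>\<^sub>F (x', y) in uniformity. x' = x \<longrightarrow> y \<in> U)"

instance
proof
  fix x y z :: "('a, 'b) l2" and r s :: real
  show "x + y + z = x + (y + z)" by transfer (auto simp: L2_add algebra_simps)
  show "x + y = y + x" by transfer (auto simp: L2_add algebra_simps)
  show "0 + x = x" by transfer auto
  show "- x + x = 0" by transfer (auto simp: L2_zero)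
  show "x - y = x + - y" by transfer (auto simp: L2_add L2_diff L2_uminus)
  show "r *\<^sub>R (x + y) = r *\<^sub>R x + r *\<^sub>R y" by transfer (auto simp: L2_add L2_scaleR algebra_simps)
  show "(r + s) *\<^sub>R x = r *\<^sub>R x + s *\<^sub>R x" by transfer (auto simp: L2_add L2_scaleR algebra_simps)
  show "r *\<^sub>R s *\<^sub>R x = (r * s) *\<^sub>R x" by transfer (auto simp: L2_scaleR)
  show "1 *\<^sub>R x = x" by transfer auto
  show "x \<bullet> y = y \<bullet> x" by transfer (simp add: L2_inner_def inner_commute)
  show "(x + y) \<bullet> z = x \<bullet> z + y \<bullet> z"
    by transfer (auto simp: L2_inner_def inner_add_left L2_inner_integrable intro!: Bochner_Integration.integral_add)
  show "(r *\<^sub>R x) \<bullet> y = r * (x \<bullet> y)"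
    by transfer (auto simp: L2_inner_def)
  show "0 \<le> x \<bullet> x" by transfer (simp add: L2_inner_def)
  show "(x \<bullet> x = 0) \<longleftrightarrow> (x = 0)"
    by transfer (auto simp: L2_inner_def L2_zero L2_UNIV_iff lebesgue_on_UNIV_eq integral_nonneg_eq_0_iff_AE
        simp flip: power2_norm_eq_inner)
qed (auto simp: norm_l2_def sgn_l2_def dist_l2_def uniformity_l2_def open_l2_def)

end

section \<open>Classes of functions on a measurable set\<close>

lemma L2_power2_norm: "(L2_norm A f)\<^sup>2 = L2_inner A f f"
  by (simp add: L2_norm_def L2_inner_def)

lemma L2_norm_nonneg: "0 \<le> L2_norm A f"
  by (simp add: L2_norm_def L2_inner_def)

definition cls :: "'c::euclidean_space set \<Rightarrow> ('c \<Rightarrow> 'b::euclidean_space) \<Rightarrow> ('c, 'b) l2" where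
  "cls A f = abs_l2 (\<lambda>x. indicator A x *\<^sub>R f x)"

lemma power2_norm_indicator:
  "(norm (indicator A x *\<^sub>R f x :: 'b::real_normed_vector))\<^sup>2 = indicator A x *\<^sub>R (norm (f x))\<^sup>2"
  by (auto simp: indicator_def)

lemma L2_indicator_iff:
  assumes "A \<in> sets lebesgue"
  shows "(\<lambda>x. indicator A x *\<^sub>R f x) \<in> L2 UNIV \<longleftrightarrow> f \<in> L2 A"
  using assms unfolding L2_UNIV_iff power2_norm_indicator
  by (simp add: L2_def borel_measurable_restrict_space_iff integrable_restrict_space)

lemma inner_cls:
  assumes "A \<in> sets lebesgue" "f \<in> L2 A" "g \<in> L2 A"
  shows "cls A f \<bullet> cls A g = L2_inner A f g"
proof -
  have "(\<lambda>x. indicator A x *\<^sub>R f x) \<in> L2 UNIV" "(\<lambda>x. indicator A x *\<^sub>R g x) \<in> L2 UNIV"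
    using assms by (auto simp: L2_indicator_iff)
  then have "cls A f \<bullet> cls A g = L2_inner UNIV (\<lambda>x. indicator A x *\<^sub>R f x) (\<lambda>x. indicator A x *\<^sub>R g x)"
    unfolding cls_def by (intro inner_l2.abs_eq) auto
  also have "\<dots> = L2_inner A f g"
    using assms(1) unfolding L2_inner_def
    by (auto simp: lebesgue_on_UNIV_eq integral_restrict_space indicator_def intro!: Bochner_Integration.integral_cong)
  finally show ?thesis .
qed

lemma norm_cls:
  assumes "A \<in> sets lebesgue" "f \<in> L2 A"
  shows "norm (cls A f) = L2_norm A f"
  using assms by (simp add: norm_eq_sqrt_inner inner_cls L2_norm_def)

lemma cls_add:
  assumes "A \<in> sets lebesgue" "f \<in> L2 A" "g \<in> L2 A"
  shows "cls A (\<lambda>x. f x + g x) = cls A f + cls A g"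
  using assms unfolding cls_def
  by (subst plus_l2.abs_eq) (auto simp: L2_indicator_iff scaleR_add_right)

lemma cls_diff:
  assumes "A \<in> sets lebesgue" "f \<in> L2 A" "g \<in> L2 A"
  shows "cls A (\<lambda>x. f x - g x) = cls A f - cls A g"
  using assms unfolding cls_def
  by (subst minus_l2.abs_eq) (auto simp: L2_indicator_iff scaleR_diff_right)

lemma cls_scaleR:
  assumes "A \<in> sets lebesgue" "f \<in> L2 A"
  shows "cls A (\<lambda>x. c *\<^sub>R f x) = c *\<^sub>R cls A f"
  using assms unfolding cls_def
  by (subst scaleR_l2.abs_eq) (auto simp: L2_indicator_iff mult.commute)

lemma cls_eq_iff:
  assumes "A \<in> sets lebesgue" "f \<in> L2 A" "g \<in> L2 A"
  shows "cls A f = cls A g \<longleftrightarrow> (AE x in lebesgue_on A. f x = g x)"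
proof -
  have "cls A f = cls A g \<longleftrightarrow> (AE x in lebesgue. indicator A x *\<^sub>R f x = indicator A x *\<^sub>R g x)"
  proof -
    have "(\<lambda>x. indicator A x *\<^sub>R f x) \<in> L2 UNIV" "(\<lambda>x. indicator A x *\<^sub>R g x) \<in> L2 UNIV"
      using assms by (auto simp: L2_indicator_iff)
    then show ?thesis
      unfolding cls_def
      using Quotient_rel[OF Quotient_l2, of "\<lambda>x. indicator A x *\<^sub>R f x" "\<lambda>x. indicator A x *\<^sub>R g x"] by blast
  qed
  also have "\<dots> \<longleftrightarrow> (AE x in lebesgue_on A. f x = g x)"
    using assms(1) by (subst AE_restrict_space_iff) (auto intro!: AE_cong simp: indicator_def)
  finally show ?thesis .
qed

lemma cls_zero: "cls A (\<lambda>x. 0) = 0"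
  by (simp add: cls_def zero_l2_def)

lemma ex_cls_UNIV: obtains f where "f \<in> L2 UNIV" "x = cls UNIV f"
proof -
  obtain f where "f \<in> L2 UNIV" "abs_l2 f = x"
    using Quotient_l2 by (metis (no_types, lifting) Quotient_abs_rep Quotient_rep_reflp)
  then show thesis using that by (auto simp: cls_def)
qed

section \<open>Riesz-Fischer completeness\<close>

lemma young_inequality:
  fixes a d :: real
  assumes "0 < a"
  shows "2 * d \<le> 1 / a + a * d\<^sup>2"
proof -
  have "0 \<le> (1 / a - d)\<^sup>2 * a" using assms by simp
  also have "\<dots> = 1 / a - 2 * d + a * d\<^sup>2"
    using assms by (simp add: power2_eq_square field_simps)
  finally show ?thesis by simp
qed

text \<open>For a rapidly Cauchy sequence the weighted increments are summable almost everywhere, so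
  the sequence converges pointwise, and Fatou's lemma carries each bound on \<open>f l - f k\<close>
  to the limit in \<open>l\<close>.\<close>

lemma L2_complete:
  fixes f :: "nat \<Rightarrow> 'c::euclidean_space \<Rightarrow> 'b::euclidean_space"
  assumes f: "\<And>k. f k \<in> L2 UNIV"
    and step: "\<And>k l. k \<le> l \<Longrightarrow> L2_inner UNIV (\<lambda>x. f l x - f k x) (\<lambda>x. f l x - f k x) \<le> (1/4) ^ k"
  shows "\<exists>g\<in>L2 UNIV. \<forall>k. L2_inner UNIV (\<lambda>x. g x - f k x) (\<lambda>x. g x - f k x) \<le> (1/4) ^ k"
proof -
  have [measurable]: "f k \<in> borel_measurable lebesgue" for k using f by (simp add: L2_UNIV_iff)
  have nn: "(\<integral>\<^sup>+x. ennreal ((norm (f l x - f k x))\<^sup>2) \<partial>lebesgue) \<le> ennreal ((1/4) ^ k)" if "k \<le> l" for k l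
  proof -
    have "integrable lebesgue (\<lambda>x. (norm (f l x - f k x))\<^sup>2)"
      using L2_diff[OF f f, of l k] by (simp add: L2_UNIV_iff)
    then show ?thesis
      using step[OF that]
      by (subst nn_integral_eq_integral)
        (auto simp: L2_inner_def lebesgue_on_UNIV_eq power2_norm_eq_inner ennreal_leI)
  qed
  \<comment> \<open>The weight lies between 1 and the decay \<open>4 ^ k\<close>: the integrals
    still sum like \<open>(1/2) ^ k\<close>, yet the weight grows enough to pass from squares to
    norms below.\<close>
  let ?h = "\<lambda>k x. 2 ^ k * (norm (f (Suc k) x - f k x))\<^sup>2"
  have "(\<integral>\<^sup>+x. (\<Sum>k. ennreal (?h k x)) \<partial>lebesgue) = (\<Sum>k. \<integral>\<^sup>+x. ennreal (?h k x) \<partial>lebesgue)"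
    by (rule nn_integral_suminf) measurable
  also have "\<dots> \<le> (\<Sum>k. ennreal ((1/2) ^ k))"
  proof (intro suminf_le summableI)
    fix k
    have "(\<integral>\<^sup>+x. ennreal (?h k x) \<partial>lebesgue)
        = ennreal (2 ^ k) * (\<integral>\<^sup>+x. ennreal ((norm (f (Suc k) x - f k x))\<^sup>2) \<partial>lebesgue)"
      by (subst nn_integral_cmult[symmetric]) (auto simp: ennreal_mult)
    also have "\<dots> \<le> ennreal (2 ^ k) * ennreal ((1/4) ^ k)"
      by (intro mult_left_mono nn) auto
    also have "\<dots> = ennreal ((1/2) ^ k)"
      by (subst ennreal_mult[symmetric]) (auto simp flip: power_mult_distrib)
    finally show "(\<integral>\<^sup>+x. ennreal (?h k x) \<partial>lebesgue) \<le> ennreal ((1/2) ^ k)" .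
  qed
  also have "\<dots> = ennreal (\<Sum>k. (1/2) ^ k)"
    by (intro suminf_ennreal2 summable_geometric) auto
  finally have "(\<integral>\<^sup>+x. (\<Sum>k. ennreal (?h k x)) \<partial>lebesgue) \<le> ennreal (\<Sum>k. (1/2) ^ k)" .
  then have "(\<integral>\<^sup>+x. (\<Sum>k. ennreal (?h k x)) \<partial>lebesgue) \<noteq> \<infinity>"
    by (metis ennreal_neq_top infinity_ennreal_def neq_top_trans)
  moreover have "(\<lambda>x. \<Sum>k. ennreal (?h k x)) \<in> borel_measurable lebesgue" by measurable
  ultimately have "AE x in lebesgue. (\<Sum>k. ennreal (?h k x)) \<noteq> \<infinity>"
    by (intro nn_integral_PInf_AE)
  then have conv: "AE x in lebesgue. convergent (\<lambda>k. f k x)"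
  proof eventually_elim
    fix x assume "(\<Sum>k. ennreal (?h k x)) \<noteq> \<infinity>"
    then have "summable (\<lambda>k. ?h k x)" by (intro summable_suminf_not_top) simp_all
    moreover have "summable (\<lambda>k. (1/2::real) ^ k)" by (intro summable_geometric) simp
    ultimately have "summable (\<lambda>k. (1/2) ^ k + ?h k x)" by (intro summable_add)
    moreover have "norm (f (Suc k) x - f k x) \<le> (1/2) ^ k + ?h k x" for k
    proof -
      let ?d = "norm (f (Suc k) x - f k x)"
      \<comment> \<open>With weight \<open>2 ^ k\<close> the Young inequality bounds an increment by
        its weighted square plus a term of a geometric series.\<close>
      have "2 * ?d \<le> 1 / 2 ^ k + 2 ^ k * ?d\<^sup>2" by (rule young_inequality) simp
      moreover have "1 / 2 ^ k = (1 / 2 :: real) ^ k" by (simp add: power_divide)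
      ultimately show ?thesis using norm_ge_zero[of "f (Suc k) x - f k x"] by linarith
    qed
    ultimately have "summable (\<lambda>k. f (Suc k) x - f k x)"
      by (rule summable_comparison_test'[where N = 0])
    then have "(\<lambda>n. (\<Sum>k<n. f (Suc k) x - f k x) + f 0 x) \<longlonglongrightarrow> (\<Sum>k. f (Suc k) x - f k x) + f 0 x"
      by (intro tendsto_add summable_LIMSEQ tendsto_const)
    then show "convergent (\<lambda>k. f k x)"
      using sum_lessThan_telescope[of "\<lambda>k. f k x"] by (auto simp: convergent_def)
  qed
  define g where "g = (\<lambda>x. lim (\<lambda>k. f k x))"
  have g[measurable]: "g \<in> borel_measurable lebesgue"
    unfolding g_def by (rule borel_measurable_lim_metric) measurable
  have bound: "(\<integral>\<^sup>+x. ennreal ((norm (g x - f k x))\<^sup>2) \<partial>lebesgue) \<le> ennreal ((1/4) ^ k)" for k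
  proof -
    have "(\<integral>\<^sup>+x. ennreal ((norm (g x - f k x))\<^sup>2) \<partial>lebesgue)
        = (\<integral>\<^sup>+x. liminf (\<lambda>l. ennreal ((norm (f l x - f k x))\<^sup>2)) \<partial>lebesgue)"
    proof (rule nn_integral_cong_AE)
      show "AE x in lebesgue. ennreal ((norm (g x - f k x))\<^sup>2) = liminf (\<lambda>l. ennreal ((norm (f l x - f k x))\<^sup>2))"
        using conv
      proof eventually_elim
        fix x assume "convergent (\<lambda>k. f k x)"
        then have "(\<lambda>k. f k x) \<longlonglongrightarrow> g x" by (simp add: g_def convergent_LIMSEQ_iff)
        then have "(\<lambda>l. ennreal ((norm (f l x - f k x))\<^sup>2)) \<longlonglongrightarrow> ennreal ((norm (g x - f k x))\<^sup>2)"
          by (intro tendsto_intros)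
        then show "ennreal ((norm (g x - f k x))\<^sup>2) = liminf (\<lambda>l. ennreal ((norm (f l x - f k x))\<^sup>2))"
          by (rule lim_imp_Liminf[OF sequentially_bot, symmetric])
      qed
    qed
    also have "\<dots> \<le> liminf (\<lambda>l. \<integral>\<^sup>+x. ennreal ((norm (f l x - f k x))\<^sup>2) \<partial>lebesgue)"
      by (rule nn_integral_liminf) measurable
    also have "\<dots> \<le> ennreal ((1/4) ^ k)"
      by (intro Liminf_le eventually_sequentiallyI[of k] nn sequentially_bot)
    finally show ?thesis .
  qed
  have gf: "(\<lambda>x. g x - f k x) \<in> L2 UNIV" for k
    unfolding L2_UNIV_iff using bound[of k]
    by (auto intro!: integrableI_nonneg simp: order_le_less_trans)
  from L2_add[OF gf f, of 0 0] have "g \<in> L2 UNIV" by simp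
  moreover have "L2_inner UNIV (\<lambda>x. g x - f k x) (\<lambda>x. g x - f k x) \<le> (1/4) ^ k" for k
  proof -
    have "integrable lebesgue (\<lambda>x. (norm (g x - f k x))\<^sup>2)" using gf[of k] by (simp add: L2_UNIV_iff)
    from nn_integral_eq_integral[OF this] bound[of k] show ?thesis
      by (auto simp: L2_inner_def lebesgue_on_UNIV_eq power2_norm_eq_inner)
  qed
  ultimately show ?thesis by blast
qed

instance l2 :: (euclidean_space, euclidean_space) complete_space
proof
  fix X :: "nat \<Rightarrow> ('a, 'b) l2" assume "Cauchy X"
  then have "\<forall>k. \<exists>M. \<forall>m\<ge>M. \<forall>n\<ge>M. dist (X m) (X n) < (1/2) ^ k"
    by (auto simp: Cauchy_def)
  then obtain M where M: "\<And>k m n. m \<ge> M k \<Longrightarrow> n \<ge> M k \<Longrightarrow> dist (X m) (X n) < (1/2) ^ k" by metis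
  \<comment> \<open>Strictly increasing indices with \<open>M k \<le> s k\<close>: from
    \<open>s k\<close> on, the subsequence stays within \<open>(1/2) ^ k\<close>, and squaring gives
    the rate \<open>(1/4) ^ k\<close> required by \<open>L2_complete\<close>.\<close>
  define s where "s = rec_nat (M 0) (\<lambda>k r. max (Suc r) (M (Suc k)))"
  have s: "strict_mono s" by (rule strict_monoI_Suc) (auto simp: s_def)
  have Ms: "M k \<le> s k" for k by (cases k) (auto simp: s_def)
  have "\<forall>k. \<exists>f. f \<in> L2 UNIV \<and> X (s k) = cls UNIV f" by (meson ex_cls_UNIV)
  then obtain f where f: "\<And>k. f k \<in> L2 UNIV" "\<And>k. X (s k) = cls UNIV (f k)" by metis
  have ip: "L2_inner UNIV (\<lambda>x. p x - q x) (\<lambda>x. p x - q x) = (dist (cls UNIV p) (cls UNIV q))\<^sup>2"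
    if "p \<in> L2 UNIV" "q \<in> L2 UNIV" for p q :: "'a \<Rightarrow> 'b"
    using that by (simp add: dist_norm L2_diff L2_power2_norm norm_cls flip: cls_diff)
  have "L2_inner UNIV (\<lambda>x. f l x - f k x) (\<lambda>x. f l x - f k x) \<le> (1/4) ^ k" if "k \<le> l" for k l
  proof -
    have "M k \<le> s l" using that Ms[of k] strict_mono_less_eq[OF s, of k l] by auto
    then have "dist (X (s l)) (X (s k)) < (1/2) ^ k" using M Ms by auto
    then have "(dist (X (s l)) (X (s k)))\<^sup>2 \<le> ((1/2) ^ k)\<^sup>2" by (intro power_mono) auto
    also have "((1/2::real) ^ k)\<^sup>2 = (1/4) ^ k" by (simp add: power2_eq_square flip: power_mult_distrib)
    finally show ?thesis by (simp add: ip f)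
  qed
  from L2_complete[OF f(1) this] obtain g where
    g: "g \<in> L2 UNIV" "\<And>k. L2_inner UNIV (\<lambda>x. g x - f k x) (\<lambda>x. g x - f k x) \<le> (1/4) ^ k" by blast
  have le: "dist (X (s k)) (cls UNIV g) \<le> (1/2) ^ k" for k
  proof -
    have "(dist (X (s k)) (cls UNIV g))\<^sup>2 \<le> (1/4) ^ k"
      using g(2)[of k] by (simp add: ip f g dist_commute)
    also have "(1/4) ^ k = ((1/2::real) ^ k)\<^sup>2" by (simp add: power2_eq_square flip: power_mult_distrib)
    finally show ?thesis by (rule power2_le_imp_le) simp
  qed
  have "(\<lambda>k. dist (X (s k)) (cls UNIV g)) \<longlonglongrightarrow> 0"
  proof (rule tendsto_sandwich[OF _ _ tendsto_const])
    show "(\<lambda>k. (1/2::real) ^ k) \<longlonglongrightarrow> 0" by (intro LIMSEQ_power_zero) simp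
  qed (use le in auto)
  then have "(X \<circ> s) \<longlonglongrightarrow> cls UNIV g" by (subst tendsto_dist_iff) (simp add: o_def)
  with s \<open>Cauchy X\<close> show "convergent X"
    using Cauchy_converges_subseq convergent_def by blast
qed

section \<open>Square-integrability of concrete functions\<close>

lemma L2_bounded_scaleR:
  fixes g :: "'c::euclidean_space \<Rightarrow> real" and f :: "'c \<Rightarrow> 'b::euclidean_space"
  assumes "g \<in> borel_measurable (lebesgue_on A)" "AE x in lebesgue_on A. \<bar>g x\<bar> \<le> M" "f \<in> L2 A"
  shows "(\<lambda>x. g x *\<^sub>R f x) \<in> L2 A"
proof -
  have f: "f \<in> borel_measurable (lebesgue_on A)" "integrable (lebesgue_on A) (\<lambda>x. (norm (f x))\<^sup>2)"
    using assms(3) by (auto simp: L2_def)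
  have "integrable (lebesgue_on A) (\<lambda>x. (norm (g x *\<^sub>R f x))\<^sup>2)"
  proof (rule Bochner_Integration.integrable_bound)
    show "integrable (lebesgue_on A) (\<lambda>x. M\<^sup>2 * (norm (f x))\<^sup>2)" using f by simp
    show "(\<lambda>x. (norm (g x *\<^sub>R f x))\<^sup>2) \<in> borel_measurable (lebesgue_on A)"
      using f assms(1) by measurable
    show "AE x in lebesgue_on A. norm ((norm (g x *\<^sub>R f x))\<^sup>2) \<le> norm (M\<^sup>2 * (norm (f x))\<^sup>2)"
      using assms(2)
    proof eventually_elim
      fix x assume "\<bar>g x\<bar> \<le> M"
      then have "(g x)\<^sup>2 \<le> M\<^sup>2" by (rule abs_le_square_iff[THEN iffD1, OF order_trans]) auto
      then show "norm ((norm (g x *\<^sub>R f x))\<^sup>2) \<le> norm (M\<^sup>2 * (norm (f x))\<^sup>2)"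
        by (auto simp: power_mult_distrib intro!: mult_right_mono)
    qed
  qed
  then show ?thesis using f assms(1) by (auto simp: L2_def)
qed

lemma L2_norm_AE_bound:
  assumes "g \<in> borel_measurable (lebesgue_on A)" "AE x in lebesgue_on A. norm (g x) \<le> norm (f x)" "f \<in> L2 A"
  shows "g \<in> L2 A"
proof -
  have "integrable (lebesgue_on A) (\<lambda>x. (norm (g x))\<^sup>2)"
  proof (rule Bochner_Integration.integrable_bound)
    show "integrable (lebesgue_on A) (\<lambda>x. (norm (f x))\<^sup>2)" using assms(3) by (simp add: L2_def)
    show "(\<lambda>x. (norm (g x))\<^sup>2) \<in> borel_measurable (lebesgue_on A)" using assms(1) by measurable
    show "AE x in lebesgue_on A. norm ((norm (g x))\<^sup>2) \<le> norm ((norm (f x))\<^sup>2)"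
      using assms(2) by eventually_elim (auto intro: power_mono)
  qed
  then show ?thesis using assms(1) by (simp add: L2_def)
qed

lemma L2_inner_commute: "L2_inner A f g = L2_inner A g f"
  unfolding L2_inner_def by (intro Bochner_Integration.integral_cong) (auto simp: inner_commute)

lemma L2_subset:
  assumes "A \<in> sets lebesgue" "B \<in> sets lebesgue" "A \<subseteq> B" "f \<in> L2 B"
  shows "f \<in> L2 A"
proof -
  have *: "(\<lambda>x. indicator B x *\<^sub>R f x) \<in> L2 UNIV" using assms L2_indicator_iff by blast
  have "(\<lambda>x. indicator A x *\<^sub>R (indicator B x *\<^sub>R f x)) \<in> L2 UNIV"
    using assms(1) by (intro L2_bounded_scaleR[where M = 1] *) (auto simp: lebesgue_on_UNIV_eq indicator_def)
  moreover have "(\<lambda>x. indicator A x *\<^sub>R (indicator B x *\<^sub>R f x)) = (\<lambda>x. indicator A x *\<^sub>R f x)"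
    using assms(3) by (auto simp: indicator_def fun_eq_iff)
  ultimately show ?thesis using assms(1) L2_indicator_iff by metis
qed

lemma L2_norm_mono:
  assumes "f \<in> L2 A" "g \<in> L2 A" "AE x in lebesgue_on A. norm (f x) \<le> norm (g x)"
  shows "L2_norm A f \<le> L2_norm A g"
  unfolding L2_norm_def L2_inner_def power2_norm_eq_inner[symmetric]
proof (intro real_sqrt_le_mono integral_mono_AE)
  show "AE x in lebesgue_on A. (norm (f x))\<^sup>2 \<le> (norm (g x))\<^sup>2"
    using assms(3) by eventually_elim (auto intro: power_mono)
qed (use assms in \<open>auto simp: L2_def\<close>)

lemma L2_inner_indicator:
  assumes "A \<in> sets lebesgue"
  shows "L2_inner A f g = (LINT x|lebesgue. indicator A x *\<^sub>R (f x \<bullet> g x))"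
  using assms by (simp add: L2_inner_def integral_restrict_space)

lemma L2_inner_vanishing:
  assumes "A \<in> sets lebesgue" "\<And>x. x \<notin> A \<Longrightarrow> f x = 0"
  shows "L2_inner A f g = L2_inner UNIV f g"
proof -
  have "(\<lambda>x. indicator A x *\<^sub>R (f x \<bullet> g x)) = (\<lambda>x. f x \<bullet> g x)"
    using assms(2) by (auto simp: indicator_def fun_eq_iff)
  then show ?thesis using assms(1) by (simp add: L2_inner_indicator)
qed

lemma L2_norm_subset:
  assumes "A \<in> sets lebesgue" "f \<in> L2 UNIV"
  shows "L2_norm A f \<le> L2_norm UNIV f"
proof -
  have i: "integrable lebesgue (\<lambda>x. (norm (f x))\<^sup>2)" using assms by (simp add: L2_UNIV_iff)
  have "(LINT x|lebesgue. indicator A x *\<^sub>R (f x \<bullet> f x)) \<le> (LINT x|lebesgue. f x \<bullet> f x)"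
    using i integrable_mult_indicator[OF assms(1) i]
    by (intro integral_mono) (auto simp: power2_norm_eq_inner indicator_def)
  then show ?thesis
    using assms(1) by (simp add: L2_norm_def L2_inner_indicator)
qed

section \<open>Continuous functions of compact support\<close>

lemma continuous_measurable_lebesgue_on:
  fixes f :: "'c::euclidean_space \<Rightarrow> 'b::euclidean_space"
  assumes "continuous_on UNIV f"
  shows "f \<in> borel_measurable (lebesgue_on A)"
proof -
  have "f \<in> borel_measurable borel" using assms by (rule borel_measurable_continuous_onI)
  then have "f \<in> borel_measurable lebesgue" by (simp add: measurable_completion)
  then show ?thesis by (rule measurable_restrict_space1)
qed

text \<open>Values may be vectors, so the same estimates serve a test, its derivatives, and the pair
  of a test and its spatial gradient.\<close>

definition compactly_supported :: "('c::euclidean_space \<Rightarrow> 'b::euclidean_space) \<Rightarrow> bool" where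
  "compactly_supported f \<longleftrightarrow> continuous_on UNIV f \<and> (\<exists>K. compact K \<and> (\<forall>z. z \<notin> K \<longrightarrow> f z = 0))"

lemma compactly_supported_bound:
  assumes "compactly_supported f"
  obtains M R where "0 \<le> M" "0 \<le> R" "\<And>z. norm (f z) \<le> M * indicator (cball 0 R) z"
proof -
  obtain K where K: "compact K" "\<And>z. z \<notin> K \<Longrightarrow> f z = 0" and f: "continuous_on UNIV f"
    using assms by (auto simp: compactly_supported_def)
  have "compact (f ` K)" using f K(1) by (intro compact_continuous_image) (auto intro: continuous_on_subset)
  then obtain M where M: "\<And>z. z \<in> K \<Longrightarrow> norm (f z) \<le> M" by (meson bounded_iff compact_imp_bounded imageI)
  obtain R where R: "\<And>z. z \<in> K \<Longrightarrow> norm z \<le> R" using compact_imp_bounded[OF K(1)] bounded_iff by metis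
  show thesis
  proof (rule that[of "\<bar>M\<bar>" "\<bar>R\<bar>"])
    fix z show "norm (f z) \<le> \<bar>M\<bar> * indicator (cball 0 \<bar>R\<bar>) z"
      using K(2)[of z] M[of z] R[of z] by (cases "z \<in> K") (auto simp: indicator_def)
  qed auto
qed

lemma L2_indicator_cball: "(\<lambda>z. indicator (cball 0 R) z :: real) \<in> L2 UNIV"
proof -
  have "(\<lambda>z. (norm (indicator (cball 0 R) z :: real))\<^sup>2) = indicator (cball 0 R :: 'a set)"
    by (auto simp: indicator_def fun_eq_iff)
  moreover have "integrable lebesgue (indicator (cball 0 R :: 'a set) :: 'a \<Rightarrow> real)"
    by (intro integrable_real_indicator) (use emeasure_lborel_cball_finite in auto)
  ultimately show ?thesis by (auto simp: L2_UNIV_iff)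
qed

lemma compactly_supported_L2:
  assumes "compactly_supported f" "A \<in> sets lebesgue"
  shows "f \<in> L2 A"
proof -
  obtain M R where "\<And>z. norm (f z) \<le> M * indicator (cball 0 R) z" "0 \<le> M"
    using compactly_supported_bound[OF assms(1)] by metis
  moreover have "(\<lambda>z. M *\<^sub>R indicator (cball 0 R) z :: real) \<in> L2 UNIV"
    by (intro L2_scaleR L2_indicator_cball)
  ultimately have "f \<in> L2 UNIV"
    using assms(1) continuous_measurable_lebesgue_on[of f UNIV]
    by (intro L2_norm_AE_bound[of f UNIV "\<lambda>z. M *\<^sub>R indicator (cball 0 R) z :: real"] AE_I2)
      (auto simp: compactly_supported_def abs_mult)
  then show ?thesis using L2_subset[of A UNIV f] assms(2) by auto
qed

text \<open>On a ball carrying the support, \<open>f\<close> is the product of itself and the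
  indicator, and a product of two square-integrable functions is integrable.\<close>

lemma compactly_supported_integrable:
  fixes f :: "'c::euclidean_space \<Rightarrow> real"
  assumes "compactly_supported f" "A \<in> sets lebesgue"
  shows "integrable (lebesgue_on A) f"
proof -
  obtain M R where MR: "\<And>z. \<bar>f z\<bar> \<le> M * indicator (cball 0 R) z"
    using compactly_supported_bound[OF assms(1)] by (metis real_norm_def)
  have "f z \<bullet> indicator (cball 0 R) z = f z" for z
    using MR[of z] by (cases "z \<in> cball 0 R") auto
  moreover have "integrable (lebesgue_on A) (\<lambda>z. f z \<bullet> indicator (cball 0 R) z)"
    using assms L2_subset[OF assms(2) _ _ L2_indicator_cball, of R]
    by (intro L2_inner_integrable compactly_supported_L2[OF assms(1)]) auto
  ultimately show ?thesis by (simp only:)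
qed

lemma compactly_supported_Pair:
  "compactly_supported f \<Longrightarrow> compactly_supported g \<Longrightarrow> compactly_supported (\<lambda>x. (f x, g x))"
proof -
  assume "compactly_supported f" "compactly_supported g"
  then obtain K L where "compact K" "compact L" "\<And>z. z \<notin> K \<Longrightarrow> f z = 0" "\<And>z. z \<notin> L \<Longrightarrow> g z = 0"
    "continuous_on UNIV f" "continuous_on UNIV g" unfolding compactly_supported_def by blast
  then show "compactly_supported (\<lambda>x. (f x, g x))"
    unfolding compactly_supported_def
    by (intro conjI exI[of _ "K \<union> L"]) (auto intro!: continuous_intros simp: zero_prod_def)
qed

lemma compactly_supported_translate:
  assumes "compactly_supported f" shows "compactly_supported (\<lambda>x. f (x + v))"
proof -
  obtain K where K: "compact K" "\<And>z. z \<notin> K \<Longrightarrow> f z = 0" and f: "continuous_on UNIV f"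
    using assms by (auto simp: compactly_supported_def)
  have "compact ((\<lambda>x. x - v) ` K)" using K by (intro compact_continuous_image continuous_intros)
  moreover have "f (z + v) = 0" if "z \<notin> (\<lambda>x. x - v) ` K" for z
    using that by (intro K(2)) (auto simp: image_iff dest!: bspec[of _ _ "z + v"])
  moreover have "continuous_on UNIV (\<lambda>x. f (x + v))"
    by (rule continuous_on_compose2[OF f]) (auto intro!: continuous_intros)
  ultimately show ?thesis unfolding compactly_supported_def by blast
qed

section \<open>Translations\<close>

lemma lebesgue_integral_translate:
  fixes f :: "'c::euclidean_space \<Rightarrow> real"
  assumes [measurable]: "f \<in> borel_measurable borel"
  shows "(LINT z|lebesgue. f (z + v)) = (LINT z|lebesgue. f z)"
proof -
  have "(LINT z|lebesgue. f z) = (LINT z|lborel. f z)" by (rule integral_completion) simp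
  also have "\<dots> = (LINT z|distr lborel borel ((+) v). f z)" by (simp add: lborel_distr_plus)
  also have "\<dots> = (LINT z|lborel. f (v + z))" by (rule integral_distr) auto
  also have "\<dots> = (LINT z|lebesgue. f (z + v))" by (subst integral_completion) (auto simp: add.commute)
  finally show ?thesis by simp
qed

lemma L2_inner_translate:
  assumes "continuous_on UNIV f" "continuous_on UNIV g"
  shows "L2_inner UNIV (\<lambda>z. f (z + v)) (\<lambda>z. g (z + v)) = L2_inner UNIV f g"
proof -
  have "(\<lambda>z. f z \<bullet> g z) \<in> borel_measurable borel"
    using assms by (intro borel_measurable_continuous_onI continuous_intros)
  from lebesgue_integral_translate[OF this] show ?thesis by (simp add: L2_inner_def lebesgue_on_UNIV_eq)
qed

lemma L2_norm_translate:
  "continuous_on UNIV f \<Longrightarrow> L2_norm UNIV (\<lambda>z. f (z + v)) = L2_norm UNIV f"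
  by (simp add: L2_norm_def L2_inner_translate)

text \<open>Translation is continuous in the L2 norm: the differences tend to 0 pointwise by
  continuity, and along a bounded sequence of shifts all supports lie in one ball, which supplies
  the dominating function.\<close>

lemma L2_norm_translate_diff_tendsto:
  assumes f: "compactly_supported f" and A: "A \<in> sets lebesgue"
  shows "((\<lambda>s. L2_norm A (\<lambda>z. f (z + s *\<^sub>R e) - f z)) \<longlongrightarrow> 0) (at 0)"
  unfolding tendsto_at_iff_sequentially
proof (intro allI impI)
  fix X :: "nat \<Rightarrow> real" assume "\<forall>i. X i \<in> UNIV - {0}" and X: "X \<longlonglongrightarrow> 0"
  obtain B where B: "\<And>n. \<bar>X n\<bar> \<le> B" using X convergent_imp_Bseq[of X] by (auto simp: convergent_def Bseq_def)
  have "0 \<le> B" using B[of 0] by auto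
  obtain M R where MR: "0 \<le> M" "\<And>z. norm (f z) \<le> M * indicator (cball 0 R) z"
    using compactly_supported_bound[OF f] by metis
  let ?R = "R + B * norm e"
  have cf: "continuous_on UNIV f" using f by (simp add: compactly_supported_def)
  have bd: "norm (f (z + X n *\<^sub>R e) - f z) \<le> 2 * M * indicator (cball 0 ?R) z" for n z
  proof (cases "z \<in> cball 0 ?R")
    case True
    have "norm (f w) \<le> M" for w using MR(1) MR(2)[of w] by (cases "w \<in> cball 0 R") auto
    from this[of "z + X n *\<^sub>R e"] this[of z] show ?thesis
      using True norm_triangle_ineq4[of "f (z + X n *\<^sub>R e)" "f z"] by simp
  next
    case False
    have "norm (X n *\<^sub>R e) \<le> B * norm e" using B by (auto intro: mult_right_mono)
    then have "norm z - B * norm e \<le> norm (z + X n *\<^sub>R e)"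
      using norm_triangle_ineq4[of "z + X n *\<^sub>R e" "X n *\<^sub>R e"] by simp
    then have "z + X n *\<^sub>R e \<notin> cball 0 R" using False by simp
    moreover have "0 \<le> B * norm e" using \<open>0 \<le> B\<close> by simp
    then have "z \<notin> cball 0 R" using False by simp
    ultimately show ?thesis using MR(2)[of z] MR(2)[of "z + X n *\<^sub>R e"] False by simp
  qed
  have "(\<lambda>n. LINT z|lebesgue_on A. (norm (f (z + X n *\<^sub>R e) - f z))\<^sup>2) \<longlonglongrightarrow> (LINT z|lebesgue_on A. 0)"
  proof (rule integral_dominated_convergence[where w = "\<lambda>z. (2 * M * indicator (cball 0 ?R) z)\<^sup>2"])
    have "(\<lambda>z. (2 * M) *\<^sub>R indicator (cball 0 ?R) z :: real) \<in> L2 A"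
      using L2_subset[OF A _ _ L2_indicator_cball] by (intro L2_scaleR) auto
    then show "integrable (lebesgue_on A) (\<lambda>z. (2 * M * indicator (cball 0 ?R) z)\<^sup>2)"
      by (simp add: L2_def)
    show "(\<lambda>z. (norm (f (z + X n *\<^sub>R e) - f z))\<^sup>2) \<in> borel_measurable (lebesgue_on A)" for n
      by (intro continuous_measurable_lebesgue_on continuous_intros continuous_on_compose2[OF cf]) auto
    show "AE z in lebesgue_on A. norm ((norm (f (z + X n *\<^sub>R e) - f z))\<^sup>2) \<le> (2 * M * indicator (cball 0 ?R) z)\<^sup>2" for n
      using bd[of _ n] by (intro AE_I2) (simp add: power_mono)
    show "AE z in lebesgue_on A. (\<lambda>n. (norm (f (z + X n *\<^sub>R e) - f z))\<^sup>2) \<longlonglongrightarrow> 0"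
    proof (intro AE_I2)
      fix z
      have "(\<lambda>n. z + X n *\<^sub>R e) \<longlonglongrightarrow> z + 0 *\<^sub>R e" by (intro tendsto_intros X)
      then have "(\<lambda>n. f (z + X n *\<^sub>R e)) \<longlonglongrightarrow> f z"
        using cf by (auto simp: continuous_on_eq_continuous_at intro: isCont_tendsto_compose)
      then have "(\<lambda>n. (norm (f (z + X n *\<^sub>R e) - f z))\<^sup>2) \<longlonglongrightarrow> (norm (f z - f z))\<^sup>2" by (intro tendsto_intros)
      then show "(\<lambda>n. (norm (f (z + X n *\<^sub>R e) - f z))\<^sup>2) \<longlonglongrightarrow> 0" by simp
    qed
  qed simp
  then have "(\<lambda>n. sqrt (LINT z|lebesgue_on A. (norm (f (z + X n *\<^sub>R e) - f z))\<^sup>2)) \<longlonglongrightarrow> sqrt 0"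
    by (intro tendsto_real_sqrt) simp
  then show "((\<lambda>s. L2_norm A (\<lambda>z. f (z + s *\<^sub>R e) - f z)) \<circ> X) \<longlonglongrightarrow> 0"
    by (simp add: L2_norm_def L2_inner_def power2_norm_eq_inner o_def)
qed

section \<open>Continuously differentiable functions of compact support\<close>

lemma C1_compact_has_derivative:
  "\<phi> \<in> C1_compact U \<Longrightarrow> (\<phi> has_derivative frechet_derivative \<phi> (at z)) (at z)"
  unfolding C1_compact_def using frechet_derivative_works by blast

lemma C1_compact_linear: "\<phi> \<in> C1_compact U \<Longrightarrow> linear (frechet_derivative \<phi> (at z))"
  using C1_compact_has_derivative has_derivative_linear by blast

lemma C1_compactI:
  assumes "\<And>z. (\<phi> has_derivative \<phi>' z) (at z)" "\<And>h. continuous_on UNIV (\<lambda>z. \<phi>' z h)"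
    and "compact K" "K \<subseteq> U" "\<And>z. z \<notin> K \<Longrightarrow> \<phi> z = 0"
  shows "\<phi> \<in> C1_compact U"
proof -
  have "frechet_derivative \<phi> (at z) = \<phi>' z" for z using frechet_derivative_at[OF assms(1)] by simp
  then show ?thesis unfolding C1_compact_def using assms by (auto simp: differentiable_def)
qed

text \<open>The complement of \<open>K\<close> is open, so \<phi> vanishes near each of its points
  and \<open>K\<close> also carries the derivative.\<close>

lemma C1_compact_support:
  assumes "\<phi> \<in> C1_compact U"
  obtains K where "compact K" "K \<subseteq> U" "\<And>z. z \<notin> K \<Longrightarrow> \<phi> z = 0"
    "\<And>z h. z \<notin> K \<Longrightarrow> frechet_derivative \<phi> (at z) h = 0"
proof -
  obtain K where K: "compact K" "K \<subseteq> U" "\<And>z. z \<notin> K \<Longrightarrow> \<phi> z = 0"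
    using assms by (auto simp: C1_compact_def)
  have "frechet_derivative \<phi> (at z) h = 0" if "z \<notin> K" for z h
  proof -
    have "(\<phi> has_derivative (\<lambda>h. 0)) (at z)"
    proof (rule has_derivative_transform_within_open[where f = "\<lambda>_. 0" and s = "- K"])
      show "open (- K)" using K(1) by (simp add: compact_imp_closed open_Compl)
    qed (use K(3) that in auto)
    from frechet_derivative_at[OF this] show ?thesis by metis
  qed
  with K that show thesis by blast
qed

lemma C1_compact_mono: "U \<subseteq> U' \<Longrightarrow> C1_compact U \<subseteq> C1_compact U'"
  unfolding C1_compact_def by blast

lemma C1_compact_continuous: "\<phi> \<in> C1_compact U \<Longrightarrow> continuous_on UNIV \<phi>"
  unfolding C1_compact_def by (auto simp: continuous_on_eq_continuous_at differentiable_imp_continuous_within)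

lemma C1_compact_derivative_continuous:
  "\<phi> \<in> C1_compact U \<Longrightarrow> continuous_on UNIV (\<lambda>z. frechet_derivative \<phi> (at z) h)"
  by (simp only: C1_compact_def mem_Collect_eq)

lemma C1_compact_compactly_supported: "\<phi> \<in> C1_compact U \<Longrightarrow> compactly_supported \<phi>"
  unfolding compactly_supported_def using C1_compact_continuous C1_compact_support by metis

lemma C1_compact_derivative_compactly_supported:
  assumes "\<phi> \<in> C1_compact U" shows "compactly_supported (\<lambda>z. frechet_derivative \<phi> (at z) h)"
proof -
  have "continuous_on UNIV (\<lambda>z. frechet_derivative \<phi> (at z) h)" using assms by (simp add: C1_compact_def)
  then show ?thesis unfolding compactly_supported_def using C1_compact_support[OF assms] by metis
qed

lemma C1_compact_add:
  assumes "\<phi> \<in> C1_compact U" "\<psi> \<in> C1_compact U"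
  shows "(\<lambda>z. \<phi> z + \<psi> z) \<in> C1_compact U"
    and "frechet_derivative (\<lambda>z. \<phi> z + \<psi> z) (at z) h = frechet_derivative \<phi> (at z) h + frechet_derivative \<psi> (at z) h"
proof -
  have d: "((\<lambda>z. \<phi> z + \<psi> z) has_derivative
     (\<lambda>h. frechet_derivative \<phi> (at z) h + frechet_derivative \<psi> (at z) h)) (at z)" for z
    using assms by (intro has_derivative_add C1_compact_has_derivative)
  then show "frechet_derivative (\<lambda>z. \<phi> z + \<psi> z) (at z) h = frechet_derivative \<phi> (at z) h + frechet_derivative \<psi> (at z) h"
    using frechet_derivative_at[OF d] by metis
  obtain K L where "compact K" "K \<subseteq> U" "\<And>z. z \<notin> K \<Longrightarrow> \<phi> z = 0" "compact L" "L \<subseteq> U" "\<And>z. z \<notin> L \<Longrightarrow> \<psi> z = 0"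
    using C1_compact_support assms by metis
  then show "(\<lambda>z. \<phi> z + \<psi> z) \<in> C1_compact U"
    using assms by (intro C1_compactI[OF d, of "K \<union> L"]) (auto simp: C1_compact_def intro!: continuous_intros)
qed

lemma C1_compact_mult:
  assumes "\<phi> \<in> C1_compact U" "\<And>z. (f has_derivative f' z) (at z)" "\<And>h. continuous_on UNIV (\<lambda>z. f' z h)"
  shows "(\<lambda>z. f z * \<phi> z) \<in> C1_compact U"
    and "frechet_derivative (\<lambda>z. f z * \<phi> z) (at z) h = f z * frechet_derivative \<phi> (at z) h + f' z h * \<phi> z"
proof -
  have d: "((\<lambda>z. f z * \<phi> z) has_derivative
     (\<lambda>h. f z * frechet_derivative \<phi> (at z) h + f' z h * \<phi> z)) (at z)" for z
    using assms by (intro has_derivative_mult C1_compact_has_derivative)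
  then show "frechet_derivative (\<lambda>z. f z * \<phi> z) (at z) h = f z * frechet_derivative \<phi> (at z) h + f' z h * \<phi> z"
    using frechet_derivative_at[OF d] by metis
  have cf: "continuous_on UNIV f"
    by (meson assms(2) continuous_at_imp_continuous_on has_derivative_continuous)
  obtain K where "compact K" "K \<subseteq> U" "\<And>z. z \<notin> K \<Longrightarrow> \<phi> z = 0"
    using C1_compact_support assms(1) by metis
  then show "(\<lambda>z. f z * \<phi> z) \<in> C1_compact U"
    using assms C1_compact_continuous[OF assms(1)] cf
    by (intro C1_compactI[OF d, of K]) (auto simp: C1_compact_def intro!: continuous_intros)
qed

lemma C1_compact_scaleR:
  assumes "\<phi> \<in> C1_compact U"
  shows "(\<lambda>z. c * \<phi> z) \<in> C1_compact U"
    and "frechet_derivative (\<lambda>z. c * \<phi> z) (at z) h = c * frechet_derivative \<phi> (at z) h"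
  using C1_compact_mult[OF assms, of "\<lambda>_. c" "\<lambda>_ _. 0"] by auto

lemma C1_compact_zero: "(\<lambda>z. 0) \<in> C1_compact U"
  by (rule C1_compactI[of _ "\<lambda>_ _. 0" "{}"]) auto

lemma C1_compact_diff:
  assumes "\<phi> \<in> C1_compact U" "\<psi> \<in> C1_compact U"
  shows "(\<lambda>z. \<phi> z - \<psi> z) \<in> C1_compact U"
    and "frechet_derivative (\<lambda>z. \<phi> z - \<psi> z) (at z) h = frechet_derivative \<phi> (at z) h - frechet_derivative \<psi> (at z) h"
  using C1_compact_add[OF assms(1) C1_compact_scaleR(1)[OF assms(2), of "-1"]]
    C1_compact_scaleR(2)[OF assms(2), of "-1"] by auto

lemma C1_compact_translate:
  assumes "\<phi> \<in> C1_compact U"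
  shows "(\<lambda>z. \<phi> (z + v)) \<in> C1_compact {z. z + v \<in> U}"
    and "frechet_derivative (\<lambda>z. \<phi> (z + v)) (at z) h = frechet_derivative \<phi> (at (z + v)) h"
proof -
  have d: "((\<lambda>z. \<phi> (z + v)) has_derivative (\<lambda>h. frechet_derivative \<phi> (at (z + v)) h)) (at z)" for z
  proof -
    have "((\<lambda>z. z + v) has_derivative (\<lambda>h. h)) (at z)" by (auto intro!: derivative_eq_intros)
    from has_derivative_compose[OF this, of \<phi>] C1_compact_has_derivative[OF assms] show ?thesis by simp
  qed
  then show "frechet_derivative (\<lambda>z. \<phi> (z + v)) (at z) h = frechet_derivative \<phi> (at (z + v)) h"
    using frechet_derivative_at[OF d] by metis
  obtain K where K: "compact K" "K \<subseteq> U" "\<And>z. z \<notin> K \<Longrightarrow> \<phi> z = 0"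
    using C1_compact_support assms by metis
  have "compact ((\<lambda>x. x - v) ` K)" using K by (intro compact_continuous_image continuous_intros)
  moreover have "\<phi> (z + v) = 0" if "z \<notin> (\<lambda>x. x - v) ` K" for z
    using that by (intro K(3)) (auto simp: image_iff dest!: bspec[of _ _ "z + v"])
  moreover have "continuous_on UNIV (\<lambda>z. frechet_derivative \<phi> (at (z + v)) h)" for h
    by (rule continuous_on_compose2[of UNIV "\<lambda>z. frechet_derivative \<phi> (at z) h"])
      (use assms in \<open>auto simp: C1_compact_def intro!: continuous_intros\<close>)
  ultimately show "(\<lambda>z. \<phi> (z + v)) \<in> C1_compact {z. z + v \<in> U}"
    using K by (intro C1_compactI[OF d, of "(\<lambda>x. x - v) ` K"]) auto
qed

lemma C1_compact_translate_subset:
  assumes "\<phi> \<in> C1_compact U" "\<And>z. z + v \<in> U \<Longrightarrow> z \<in> U'"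
  shows "(\<lambda>z. \<phi> (z + v)) \<in> C1_compact U'"
  using C1_compact_translate(1)[OF assms(1), of v] C1_compact_mono[of "{z. z + v \<in> U}" U'] assms(2) by auto

section \<open>Differentiating integrals along translations\<close>

lemma C1_compact_translate_lipschitz:
  assumes \<phi>: "\<phi> \<in> C1_compact U" and M: "\<And>z. \<bar>frechet_derivative \<phi> (at z) e\<bar> \<le> M"
  shows "\<bar>\<phi> (z + s *\<^sub>R e) - \<phi> (z + r *\<^sub>R e)\<bar> \<le> M * \<bar>s - r\<bar>"
proof -
  have "((\<lambda>s. \<phi> (z + s *\<^sub>R e)) has_field_derivative frechet_derivative \<phi> (at (z + s *\<^sub>R e)) e) (at s within UNIV)" for s
  proof -
    have "((\<lambda>s. z + s *\<^sub>R e) has_derivative (\<lambda>h. h *\<^sub>R e)) (at s)" by (auto intro!: derivative_eq_intros)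
    from has_derivative_compose[OF this C1_compact_has_derivative[OF \<phi>]]
    have "((\<lambda>s. \<phi> (z + s *\<^sub>R e)) has_derivative (\<lambda>h. h * frechet_derivative \<phi> (at (z + s *\<^sub>R e)) e)) (at s)"
      using C1_compact_linear[OF \<phi>] by (simp add: linear_scale)
    then show ?thesis by (auto intro: has_derivative_imp_has_field_derivative)
  qed
  from field_differentiable_bound[OF convex_UNIV this, of M] M show ?thesis by simp
qed

text \<open>As \<open>u\<close> is merely square-integrable, the derivative must fall on \<phi>. The
  difference quotients are bounded by the supremum of the directional derivative on a fixed ball, so
  dominated convergence applies.\<close>

lemma L2_inner_translate_has_derivative:
  fixes u \<phi> :: "'c::euclidean_space \<Rightarrow> real"
  assumes u: "u \<in> L2 A" and \<phi>: "\<phi> \<in> C1_compact U" and A: "A \<in> sets lebesgue"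
  shows "((\<lambda>s. L2_inner A u (\<lambda>z. \<phi> (z + s *\<^sub>R e))) has_real_derivative
     L2_inner A u (\<lambda>z. frechet_derivative \<phi> (at (z + s *\<^sub>R e)) e)) (at s)"
  unfolding DERIV_def tendsto_at_iff_sequentially
proof (intro allI impI)
  fix X :: "nat \<Rightarrow> real" assume X0: "\<forall>i. X i \<in> UNIV - {0}" and X: "X \<longlonglongrightarrow> 0"
  obtain B where B: "\<And>n. \<bar>X n\<bar> \<le> B" using X convergent_imp_Bseq[of X] by (auto simp: convergent_def Bseq_def)
  have "0 \<le> B" using B[of 0] by auto
  let ?d = "\<lambda>z. frechet_derivative \<phi> (at z) e"
  have c\<phi>: "compactly_supported (\<lambda>z. \<phi> (z + s *\<^sub>R e))" for s
    by (intro compactly_supported_translate C1_compact_compactly_supported[OF \<phi>])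
  obtain M R where MR: "0 \<le> M" "0 \<le> R" "\<And>z. \<bar>?d z\<bar> \<le> M * indicator (cball 0 R) z"
    using compactly_supported_bound[OF C1_compact_derivative_compactly_supported[OF \<phi>, of e]]
    by (metis real_norm_def)
  have M: "\<bar>?d z\<bar> \<le> M" for z using MR(1) MR(3)[of z] by (cases "z \<in> cball 0 R") auto
  obtain N S where NS: "0 \<le> N" "0 \<le> S" "\<And>z. \<bar>\<phi> z\<bar> \<le> N * indicator (cball 0 S) z"
    using compactly_supported_bound[OF C1_compact_compactly_supported[OF \<phi>]] by (metis real_norm_def)
  \<comment> \<open>A radius that contains the supports of all translates by
    \<open>r *\<^sub>R e\<close> with \<open>\<bar>r\<bar> \<le> \<bar>s\<bar> + B\<close>, hence of
    every difference quotient in the sequence.\<close>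
  let ?S = "S + (\<bar>s\<bar> + B) * norm e"
  let ?q = "\<lambda>n z. (\<phi> (z + (s + X n) *\<^sub>R e) - \<phi> (z + s *\<^sub>R e)) / X n"
  have vanish: "\<phi> (z + r *\<^sub>R e) = 0" if "z \<notin> cball 0 ?S" "\<bar>r\<bar> \<le> \<bar>s\<bar> + B" for z r
  proof -
    have "norm (r *\<^sub>R e) \<le> (\<bar>s\<bar> + B) * norm e" using that by (auto intro: mult_right_mono)
    then have "norm z - (\<bar>s\<bar> + B) * norm e \<le> norm (z + r *\<^sub>R e)"
      using norm_triangle_ineq4[of "z + r *\<^sub>R e" "r *\<^sub>R e"] by simp
    then have "z + r *\<^sub>R e \<notin> cball 0 S" using that by simp
    then show ?thesis using NS(3)[of "z + r *\<^sub>R e"] by simp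
  qed
  have bd: "\<bar>?q n z\<bar> \<le> M * indicator (cball 0 ?S) z" for n z
  proof (cases "z \<in> cball 0 ?S")
    case True
    have "X n \<noteq> 0" using X0 by auto
    moreover have "\<bar>\<phi> (z + (s + X n) *\<^sub>R e) - \<phi> (z + s *\<^sub>R e)\<bar> \<le> M * \<bar>(s + X n) - s\<bar>"
      by (rule C1_compact_translate_lipschitz[OF \<phi> M])
    ultimately show ?thesis using True by (simp add: field_simps)
  next
    case False
    have "\<bar>s + X n\<bar> \<le> \<bar>s\<bar> + B" using B[of n] by linarith
    from vanish[OF False this] vanish[OF False, of s] \<open>0 \<le> B\<close> show ?thesis using False by simp
  qed
  have ind: "(\<lambda>z. M *\<^sub>R indicator (cball 0 ?S) z :: real) \<in> L2 A"
    using L2_subset[OF A _ _ L2_indicator_cball] by (intro L2_scaleR) auto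
  have lim: "(\<lambda>n. LINT z|lebesgue_on A. u z \<bullet> ?q n z) \<longlonglongrightarrow> (LINT z|lebesgue_on A. u z \<bullet> ?d (z + s *\<^sub>R e))"
  proof (rule integral_dominated_convergence[where w = "\<lambda>z. \<bar>u z \<bullet> (M *\<^sub>R indicator (cball 0 ?S) z)\<bar>"])
    show "integrable (lebesgue_on A) (\<lambda>z. \<bar>u z \<bullet> (M *\<^sub>R indicator (cball 0 ?S) z)\<bar>)"
      by (intro integrable_abs L2_inner_integrable u ind)
    have [measurable]: "u \<in> borel_measurable (lebesgue_on A)" using u by (rule L2_measurable)
    have [measurable]: "(\<lambda>z. \<phi> (z + r *\<^sub>R e)) \<in> borel_measurable (lebesgue_on A)" for r
      using c\<phi>[of r] by (intro continuous_measurable_lebesgue_on) (simp add: compactly_supported_def)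
    show "(\<lambda>z. u z \<bullet> ?q n z) \<in> borel_measurable (lebesgue_on A)" for n by measurable
    have [measurable]: "(\<lambda>z. ?d (z + s *\<^sub>R e)) \<in> borel_measurable (lebesgue_on A)"
      using compactly_supported_translate[OF C1_compact_derivative_compactly_supported[OF \<phi>, of e], of "s *\<^sub>R e"]
      by (intro continuous_measurable_lebesgue_on) (simp add: compactly_supported_def)
    show "(\<lambda>z. u z \<bullet> ?d (z + s *\<^sub>R e)) \<in> borel_measurable (lebesgue_on A)" by measurable
    show "AE z in lebesgue_on A. norm (u z \<bullet> ?q n z) \<le> \<bar>u z \<bullet> (M *\<^sub>R indicator (cball 0 ?S) z)\<bar>" for n
    proof (intro AE_I2)
      fix z
      have "\<bar>?q n z\<bar> \<le> \<bar>M * indicator (cball 0 ?S) z\<bar>" using bd[of z n] by linarith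
      then have "\<bar>u z\<bar> * \<bar>?q n z\<bar> \<le> \<bar>u z\<bar> * \<bar>M * indicator (cball 0 ?S) z\<bar>" by (intro mult_left_mono) auto
      then show "norm (u z \<bullet> ?q n z) \<le> \<bar>u z \<bullet> (M *\<^sub>R indicator (cball 0 ?S) z)\<bar>"
        by (simp only: abs_mult inner_real_def real_norm_def scaleR_conv_of_real of_real_eq_id id_apply)
    qed
    show "AE z in lebesgue_on A. (\<lambda>n. u z \<bullet> ?q n z) \<longlonglongrightarrow> u z \<bullet> ?d (z + s *\<^sub>R e)"
    proof (intro AE_I2 tendsto_inner tendsto_const)
      fix z
      have "((\<lambda>s. z + s *\<^sub>R e) has_derivative (\<lambda>h. h *\<^sub>R e)) (at s)" by (auto intro!: derivative_eq_intros)
      from has_derivative_compose[OF this C1_compact_has_derivative[OF \<phi>]]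
      have "((\<lambda>s. \<phi> (z + s *\<^sub>R e)) has_derivative (\<lambda>h. h * ?d (z + s *\<^sub>R e))) (at s)"
        using C1_compact_linear[OF \<phi>] by (simp add: linear_scale)
      then have "((\<lambda>s. \<phi> (z + s *\<^sub>R e)) has_real_derivative ?d (z + s *\<^sub>R e)) (at s)"
        by (auto intro: has_derivative_imp_has_field_derivative)
      then show "(\<lambda>n. ?q n z) \<longlonglongrightarrow> ?d (z + s *\<^sub>R e)"
        unfolding DERIV_def tendsto_at_iff_sequentially using X X0 by (auto simp: o_def)
    qed
  qed
  have eq: "(LINT z|lebesgue_on A. u z \<bullet> ?q n z)
      = (L2_inner A u (\<lambda>z. \<phi> (z + (s + X n) *\<^sub>R e)) - L2_inner A u (\<lambda>z. \<phi> (z + s *\<^sub>R e))) / X n" for n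
  proof -
    have i: "integrable (lebesgue_on A) (\<lambda>z. u z \<bullet> \<phi> (z + r *\<^sub>R e))" for r
      by (intro L2_inner_integrable u compactly_supported_L2 c\<phi> A)
    have "(LINT z|lebesgue_on A. u z \<bullet> ?q n z)
        = (LINT z|lebesgue_on A. (u z \<bullet> \<phi> (z + (s + X n) *\<^sub>R e) - u z \<bullet> \<phi> (z + s *\<^sub>R e)) / X n)"
      by (simp add: right_diff_distrib diff_divide_distrib)
    also have "\<dots> = (L2_inner A u (\<lambda>z. \<phi> (z + (s + X n) *\<^sub>R e)) - L2_inner A u (\<lambda>z. \<phi> (z + s *\<^sub>R e))) / X n"
      unfolding L2_inner_def by (subst Bochner_Integration.integral_diff[OF i i, symmetric]) simp
    finally show ?thesis .
  qed
  show "((\<lambda>h. (L2_inner A u (\<lambda>z. \<phi> (z + (s + h) *\<^sub>R e)) - L2_inner A u (\<lambda>z. \<phi> (z + s *\<^sub>R e))) / h) \<circ> X)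
      \<longlonglongrightarrow> L2_inner A u (\<lambda>z. ?d (z + s *\<^sub>R e))"
    using lim[unfolded eq] by (simp only: o_def L2_inner_def[of A u "\<lambda>z. ?d (z + s *\<^sub>R e)"])
qed

text \<open>
  The boundary terms of an integration by parts along \<open>e\<close> have a sign; this is read off from the
  monotonicity of \<open>s \<mapsto> \<integral>\<^sub>Q \<psi> (z + s e) dz\<close> for \<open>s \<le> 0\<close>.
\<close>

lemma integral_derivative_nonneg:
  fixes \<psi> :: "'c::euclidean_space \<Rightarrow> real"
  assumes \<psi>: "\<psi> \<in> C1_compact U" and nonneg: "\<And>z. 0 \<le> \<psi> z" and Q: "open Q"
    and shift: "\<And>z s. z \<in> U \<Longrightarrow> s \<le> 0 \<Longrightarrow> z - s *\<^sub>R e \<in> Q \<Longrightarrow> z \<in> Q"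
  shows "0 \<le> (LINT z|lebesgue_on Q. frechet_derivative \<psi> (at z) e)"
proof -
  have QL: "Q \<in> sets lebesgue" using Q by auto
  obtain M R where MR: "0 \<le> M" "0 \<le> R" "\<And>z. \<bar>\<psi> z\<bar> \<le> M * indicator (cball 0 R) z"
    using compactly_supported_bound[OF C1_compact_compactly_supported[OF \<psi>]] by (metis real_norm_def)
  obtain M' R' where MR': "0 \<le> R'" "\<And>z. \<bar>frechet_derivative \<psi> (at z) e\<bar> \<le> M' * indicator (cball 0 R') z"
    using compactly_supported_bound[OF C1_compact_derivative_compactly_supported[OF \<psi>]] by (metis real_norm_def)
  \<comment> \<open>The indicator of this ball stands in for the constant 1, which is not
    square-integrable when \<open>Q\<close> has infinite measure. The radius is so large that the
    indicator is invisible for shifts up to length 1 and in the derivative at 0.\<close>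
  define S where "S = R + R' + norm e"
  let ?u = "indicator (cball 0 S) :: 'c \<Rightarrow> real"
  define m where "m = (\<lambda>s. L2_inner Q ?u (\<lambda>z. \<psi> (z + s *\<^sub>R e)))"
  have uQ: "?u \<in> L2 Q" using L2_subset[OF QL _ _ L2_indicator_cball, of S] by auto
  have cut: "?u z \<bullet> \<psi> (z + s *\<^sub>R e) = \<psi> (z + s *\<^sub>R e)" if "\<bar>s\<bar> \<le> 1" for z s
  proof (cases "z \<in> cball 0 S")
    case False
    have "norm (s *\<^sub>R e) \<le> norm e" using that by (auto intro: mult_left_le_one_le)
    then have "norm z - norm e \<le> norm (z + s *\<^sub>R e)"
      using norm_triangle_ineq4[of "z + s *\<^sub>R e" "s *\<^sub>R e"] by simp
    then have "z + s *\<^sub>R e \<notin> cball 0 R" using False MR' by (simp add: S_def)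
    then show ?thesis using MR(3)[of "z + s *\<^sub>R e"] by simp
  qed simp
  have meq: "m s = (LINT z|lebesgue. indicator Q z * \<psi> (z + s *\<^sub>R e))" if "\<bar>s\<bar> \<le> 1" for s
    unfolding m_def L2_inner_indicator[OF QL] cut[OF that] by simp
  \<comment> \<open>After the substitution the domain of integration is \<open>Q\<close> translated
    by \<open>s *\<^sub>R e\<close>. By the hypothesis \<open>shift\<close>, its points outside
    \<open>Q\<close> lie outside \<open>U\<close>, where \<psi> vanishes.\<close>
  have le: "m s \<le> m 0" if s: "- 1 \<le> s" "s \<le> 0" for s
  proof -
    have [measurable]: "Q \<in> sets borel" using Q by auto
    have [measurable]: "\<psi> \<in> borel_measurable borel"
      using C1_compact_continuous[OF \<psi>] by (rule borel_measurable_continuous_onI)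
    have i: "integrable lebesgue \<psi>"
      using compactly_supported_integrable[OF C1_compact_compactly_supported[OF \<psi>], of UNIV]
      by (simp add: lebesgue_on_UNIV_eq)
    have "(LINT z|lebesgue. indicator Q z * \<psi> (z + s *\<^sub>R e))
        = (LINT z|lebesgue. (\<lambda>z. indicator Q (z - s *\<^sub>R e) * \<psi> z) (z + s *\<^sub>R e))" by simp
    also have "\<dots> = (LINT z|lebesgue. indicator Q (z - s *\<^sub>R e) * \<psi> z)"
      by (rule lebesgue_integral_translate) measurable
    also have "\<dots> \<le> (LINT z|lebesgue. indicator Q z * \<psi> z)"
    proof (rule integral_mono)
      have b: "(\<lambda>z. indicator Q (z - s *\<^sub>R e) * \<psi> z) \<in> borel_measurable borel" by measurable
      show "integrable lebesgue (\<lambda>z. indicator Q (z - s *\<^sub>R e) * \<psi> z)"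
      proof (rule Bochner_Integration.integrable_bound[OF i])
        show "(\<lambda>z. indicator Q (z - s *\<^sub>R e) * \<psi> z) \<in> borel_measurable lebesgue"
          using b by (simp add: measurable_completion)
      qed (auto simp: indicator_def)
      show "integrable lebesgue (\<lambda>z. indicator Q z * \<psi> z)"
        using integrable_mult_indicator[OF QL i] by simp
      fix z
      show "indicator Q (z - s *\<^sub>R e) * \<psi> z \<le> indicator Q z * \<psi> z"
      proof (cases "z - s *\<^sub>R e \<in> Q \<and> z \<notin> Q")
        case True
        then have "z \<notin> U" using shift s by blast
        then have "\<psi> z = 0" using C1_compact_support[OF \<psi>] by (metis subsetD)
        then show ?thesis by simp
      qed (use nonneg[of z] in \<open>auto simp: indicator_def\<close>)
    qed
    finally show ?thesis using meq[of s] meq[of 0] s by simp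
  qed
  have "(m has_real_derivative L2_inner Q ?u (\<lambda>z. frechet_derivative \<psi> (at (z + 0 *\<^sub>R e)) e)) (at 0)"
    unfolding m_def by (rule L2_inner_translate_has_derivative[OF uQ \<psi> QL])
  moreover have "?u z \<bullet> frechet_derivative \<psi> (at z) e = frechet_derivative \<psi> (at z) e" for z
  proof (cases "z \<in> cball 0 S")
    case False
    then have "z \<notin> cball 0 R'" using MR by (simp add: S_def) (smt (verit) norm_ge_zero)
    then show ?thesis using MR'(2)[of z] by simp
  qed simp
  ultimately have d: "(m has_real_derivative (LINT z|lebesgue_on Q. frechet_derivative \<psi> (at z) e)) (at 0)"
    by (simp only: L2_inner_def scaleR_zero_left add_0_right)
  show ?thesis
  proof (rule ccontr)
    \<comment> \<open>A negative derivative at 0 would make \<open>m\<close> larger than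
      \<open>m 0\<close> slightly to the left, against the monotonicity just shown.\<close>
    assume "\<not> ?thesis"
    then obtain r where r: "0 < r" "\<And>h. 0 < h \<Longrightarrow> h < r \<Longrightarrow> m 0 < m (0 - h)"
      using DERIV_neg_dec_left[OF d] by (metis not_le)
    have "0 < min (r/2) 1" "min (r/2) 1 < r" using r(1) by auto
    from r(2)[OF this] le[of "- min (r/2) 1"] r(1) show False by auto
  qed
qed

section \<open>Space-time functions\<close>

lemma space_grad_add:
  assumes "\<phi> \<in> C1_compact U" "\<psi> \<in> C1_compact U"
  shows "space_grad (\<lambda>z. \<phi> z + \<psi> z) z = space_grad \<phi> z + space_grad \<psi> z"
  by (simp add: space_grad_def C1_compact_add(2)[OF assms] scaleR_add_left sum.distrib)

lemma time_deriv_add: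
  assumes "\<phi> \<in> C1_compact U" "\<psi> \<in> C1_compact U"
  shows "time_deriv (\<lambda>z. \<phi> z + \<psi> z) z = time_deriv \<phi> z + time_deriv \<psi> z"
  by (simp add: time_deriv_def C1_compact_add(2)[OF assms])

lemma space_grad_diff:
  assumes "\<phi> \<in> C1_compact U" "\<psi> \<in> C1_compact U"
  shows "space_grad (\<lambda>z. \<phi> z - \<psi> z) z = space_grad \<phi> z - space_grad \<psi> z"
  by (simp add: space_grad_def C1_compact_diff(2)[OF assms] scaleR_diff_left sum_subtractf)

lemma space_grad_scale:
  assumes "\<phi> \<in> C1_compact U"
  shows "space_grad (\<lambda>z. c * \<phi> z) z = c *\<^sub>R space_grad \<phi> z"
  by (simp add: space_grad_def C1_compact_scaleR(2)[OF assms] scaleR_sum_right)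

lemma time_deriv_scale:
  assumes "\<phi> \<in> C1_compact U"
  shows "time_deriv (\<lambda>z. c * \<phi> z) z = c * time_deriv \<phi> z"
  by (simp add: time_deriv_def C1_compact_scaleR(2)[OF assms])

lemma space_grad_translate:
  assumes "\<phi> \<in> C1_compact U"
  shows "space_grad (\<lambda>z. \<phi> (z + v)) z = space_grad \<phi> (z + v)"
  by (simp add: space_grad_def C1_compact_translate(2)[OF assms])

lemma compactly_supported_space_grad:
  assumes "\<phi> \<in> C1_compact U" shows "compactly_supported (space_grad \<phi>)"
proof -
  obtain K where K: "compact K" "\<And>z h. z \<notin> K \<Longrightarrow> frechet_derivative \<phi> (at z) h = 0"
    using C1_compact_support[OF assms] by metis
  have "continuous_on UNIV (space_grad \<phi>)"
    unfolding space_grad_def using assms by (intro continuous_intros) (auto simp: C1_compact_def)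
  then show ?thesis unfolding compactly_supported_def using K by (auto simp: space_grad_def intro!: exI[of _ K])
qed

lemma compactly_supported_time_deriv:
  assumes "\<phi> \<in> C1_compact U" shows "compactly_supported (time_deriv \<phi>)"
  unfolding time_deriv_def by (rule C1_compact_derivative_compactly_supported[OF assms])

text \<open>A factor depending on time alone commutes with the spatial gradient. This serves both
  the exponential weight in \<open>inf_sup\<close> and the cutoff in time.\<close>

lemma time_multiplier:
  fixes \<phi> :: "'a::euclidean_space \<times> real \<Rightarrow> real"
  assumes \<phi>: "\<phi> \<in> C1_compact U" and f: "\<And>t. (f has_real_derivative f' t) (at t)" and f': "continuous_on UNIV f'"
  shows "(\<lambda>z. f (snd z) * \<phi> z) \<in> C1_compact U"
    and "time_deriv (\<lambda>z. f (snd z) * \<phi> z) z = f (snd z) * time_deriv \<phi> z + f' (snd z) * \<phi> z"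
    and "space_grad (\<lambda>z. f (snd z) * \<phi> z) z = f (snd z) *\<^sub>R space_grad \<phi> z"
proof -
  have d: "((\<lambda>z. f (snd z)) has_derivative (\<lambda>h. f' (snd z) * snd h)) (at z)" for z :: "'a \<times> real"
    using has_derivative_compose[OF has_derivative_snd[OF has_derivative_ident], of f "\<lambda>h. f' (snd z) * h" z UNIV]
      f[of "snd z"] by (simp add: has_field_derivative_def)
  have c: "continuous_on UNIV (\<lambda>z. f' (snd z) * snd h)" for h :: "'a \<times> real"
    by (intro continuous_intros continuous_on_compose2[OF f']) auto
  show "(\<lambda>z. f (snd z) * \<phi> z) \<in> C1_compact U" by (rule C1_compact_mult(1)[OF \<phi> d c])
  show "time_deriv (\<lambda>z. f (snd z) * \<phi> z) z = f (snd z) * time_deriv \<phi> z + f' (snd z) * \<phi> z"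
    by (simp add: time_deriv_def C1_compact_mult(2)[OF \<phi> d c])
  show "space_grad (\<lambda>z. f (snd z) * \<phi> z) z = f (snd z) *\<^sub>R space_grad \<phi> z"
    by (simp add: space_grad_def C1_compact_mult(2)[OF \<phi> d c] scaleR_sum_right)
qed

lemma C1_compact_square:
  assumes "\<phi> \<in> C1_compact U"
  shows "(\<lambda>z. \<phi> z * \<phi> z) \<in> C1_compact U" "time_deriv (\<lambda>z. \<phi> z * \<phi> z) z = 2 * \<phi> z * time_deriv \<phi> z"
proof -
  note c = C1_compact_derivative_continuous[OF assms]
  show "(\<lambda>z. \<phi> z * \<phi> z) \<in> C1_compact U"
    by (rule C1_compact_mult(1)[OF assms C1_compact_has_derivative[OF assms] c])
  show "time_deriv (\<lambda>z. \<phi> z * \<phi> z) z = 2 * \<phi> z * time_deriv \<phi> z"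
    unfolding time_deriv_def
    by (subst C1_compact_mult(2)[OF assms C1_compact_has_derivative[OF assms] c]) (simp add: mult_ac)
qed

lemma L2_norm_Pair:
  assumes "f \<in> L2 A" "g \<in> L2 A"
  shows "(\<lambda>x. (f x, g x)) \<in> L2 A" "(L2_norm A (\<lambda>x. (f x, g x)))\<^sup>2 = (L2_norm A f)\<^sup>2 + (L2_norm A g)\<^sup>2"
proof -
  show "(\<lambda>x. (f x, g x)) \<in> L2 A"
    using assms by (auto simp: L2_def norm_Pair intro: borel_measurable_Pair)
  show "(L2_norm A (\<lambda>x. (f x, g x)))\<^sup>2 = (L2_norm A f)\<^sup>2 + (L2_norm A g)\<^sup>2"
    unfolding L2_power2_norm L2_inner_def inner_Pair
    by (intro Bochner_Integration.integral_add L2_inner_integrable assms)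
qed

lemma L2_fst_snd:
  assumes "(w :: _ \<Rightarrow> _ \<times> _) \<in> L2 A"
  shows "(\<lambda>x. fst (w x)) \<in> L2 A" "(\<lambda>x. snd (w x)) \<in> L2 A"
proof -
  have m: "(\<lambda>x. fst (w x)) \<in> borel_measurable (lebesgue_on A)" "(\<lambda>x. snd (w x)) \<in> borel_measurable (lebesgue_on A)"
    using L2_measurable[OF assms] by (auto intro!: borel_measurable_continuous_on[of fst] borel_measurable_continuous_on[of snd] continuous_intros)
  show "(\<lambda>x. fst (w x)) \<in> L2 A" by (rule L2_norm_AE_bound[OF m(1) _ assms]) (intro AE_I2, metis norm_fst_le prod.collapse)
  show "(\<lambda>x. snd (w x)) \<in> L2 A" by (rule L2_norm_AE_bound[OF m(2) _ assms]) (intro AE_I2, metis norm_snd_le prod.collapse)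
qed

section \<open>Weak solutions\<close>

text \<open>
  Both parabolic equations have the form \<open>\<langle>w, parabolic \<sigma> \<phi>\<rangle> = \<langle>(f, 0), jet \<phi>\<rangle>\<close>, where
  \<open>w = (u, \<nabla>u)\<close> and where \<open>\<sigma> = 1\<close> for the state equation (tests vanishing near \<open>t = 0\<close>) and
  \<open>\<sigma> = - 1\<close> for the adjoint equation (tests vanishing near \<open>t = T\<close>).
\<close>

locale parabolic_problem =
  fixes \<Omega> :: "'a::euclidean_space set" and T \<nu> :: real and a0 :: "'a \<times> real \<Rightarrow> real"
  assumes open_\<Omega>: "open \<Omega>" and T_pos: "0 < T" and \<nu>_pos: "0 < \<nu>"
    and a0_measurable: "a0 \<in> borel_measurable (lebesgue_on (cylinder \<Omega> T))"
    and a0_bounded: "\<exists>M. AE w in lebesgue_on (cylinder \<Omega> T). \<bar>a0 w\<bar> \<le> M"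
    and a0_nonneg: "AE w in lebesgue_on (cylinder \<Omega> T). 0 \<le> a0 w"
begin

abbreviation "Q \<equiv> cylinder \<Omega> T"

definition jet :: "('a \<times> real \<Rightarrow> real) \<Rightarrow> ('a \<times> real, real \<times> 'a) l2" where
  "jet \<phi> = cls Q (\<lambda>z. (\<phi> z, space_grad \<phi> z))"

definition src :: "('a \<times> real \<Rightarrow> real) \<Rightarrow> ('a \<times> real, real \<times> 'a) l2" where
  "src f = cls Q (\<lambda>z. (f z, 0))"

text \<open>The state identity is taken with the opposite sign, so that diffusion and zeroth-order
  term are nonnegative in both equations and only the sign \<sigma> of the time derivative tells
  them apart.\<close>

definition parabolic :: "real \<Rightarrow> ('a \<times> real \<Rightarrow> real) \<Rightarrow> ('a \<times> real, real \<times> 'a) l2" where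
  "parabolic \<sigma> \<phi> = cls Q (\<lambda>z. (\<sigma> * time_deriv \<phi> z + a0 z * \<phi> z, \<nu> *\<^sub>R space_grad \<phi> z))"

definition energy :: "('a \<times> real, real \<times> 'a) l2 set" where
  "energy = closure (jet ` C1_compact (\<Omega> \<times> UNIV))"

lemma open_Q: "open Q" using open_\<Omega> by (intro open_Times) auto

lemma Q_sets: "Q \<in> sets lebesgue" using open_Q by auto

lemma jet_compactly_supported:
  "\<phi> \<in> C1_compact U \<Longrightarrow> compactly_supported (\<lambda>z. (\<phi> z, space_grad \<phi> z))"
  by (intro compactly_supported_Pair C1_compact_compactly_supported compactly_supported_space_grad)

lemma jet_L2: "\<phi> \<in> C1_compact U \<Longrightarrow> (\<lambda>z. (\<phi> z, space_grad \<phi> z)) \<in> L2 Q"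
  by (intro compactly_supported_L2[OF jet_compactly_supported Q_sets])

lemma L2_a0_mult: "f \<in> L2 Q \<Longrightarrow> (\<lambda>z. a0 z * f z) \<in> L2 Q"
  using a0_bounded L2_bounded_scaleR[OF a0_measurable] by fastforce

lemma L2_C1_compact:
  assumes "\<phi> \<in> C1_compact U"
  shows "\<phi> \<in> L2 Q" "time_deriv \<phi> \<in> L2 Q" "space_grad \<phi> \<in> L2 Q"
  using assms by (auto intro!: compactly_supported_L2[OF _ Q_sets] C1_compact_compactly_supported
      compactly_supported_time_deriv compactly_supported_space_grad)

lemma L2_mult: "f \<in> L2 A \<Longrightarrow> (\<lambda>x. c * f x :: real) \<in> L2 A"
  using L2_scaleR[of f A c] by simp

lemma L2_src: "f \<in> L2 A \<Longrightarrow> (\<lambda>z. (f z, 0)) \<in> L2 A"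
  by (rule L2_norm_Pair(1)[OF _ L2_zero])

lemma parabolic_L2:
  assumes "\<phi> \<in> C1_compact U"
  shows "(\<lambda>z. (\<sigma> * time_deriv \<phi> z + a0 z * \<phi> z, \<nu> *\<^sub>R space_grad \<phi> z)) \<in> L2 Q"
  using assms by (intro L2_norm_Pair L2_add L2_mult L2_scaleR L2_a0_mult L2_C1_compact)

section \<open>Linearity of jets and of the parabolic operator\<close>

lemma jet_add:
  assumes "\<phi> \<in> C1_compact U" "\<psi> \<in> C1_compact U"
  shows "jet (\<lambda>z. \<phi> z + \<psi> z) = jet \<phi> + jet \<psi>"
  unfolding jet_def using cls_add[OF Q_sets jet_L2[OF assms(1)] jet_L2[OF assms(2)]]
  by (simp add: space_grad_add[OF assms])

lemma jet_diff:
  assumes "\<phi> \<in> C1_compact U" "\<psi> \<in> C1_compact U"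
  shows "jet (\<lambda>z. \<phi> z - \<psi> z) = jet \<phi> - jet \<psi>"
  unfolding jet_def using cls_diff[OF Q_sets jet_L2[OF assms(1)] jet_L2[OF assms(2)]]
  by (simp add: space_grad_diff[OF assms])

lemma jet_scale:
  assumes "\<phi> \<in> C1_compact U"
  shows "jet (\<lambda>z. c * \<phi> z) = c *\<^sub>R jet \<phi>"
  unfolding jet_def using cls_scaleR[OF Q_sets jet_L2[OF assms], of c]
  by (simp add: space_grad_scale[OF assms])

lemma parabolic_add:
  assumes "\<phi> \<in> C1_compact U" "\<psi> \<in> C1_compact U"
  shows "parabolic \<sigma> (\<lambda>z. \<phi> z + \<psi> z) = parabolic \<sigma> \<phi> + parabolic \<sigma> \<psi>"
  unfolding parabolic_def using cls_add[OF Q_sets parabolic_L2[OF assms(1)] parabolic_L2[OF assms(2)], of \<sigma> \<sigma>]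
  by (simp add: space_grad_add[OF assms] time_deriv_add[OF assms] scaleR_add_right distrib_left add_ac)

lemma parabolic_scale:
  assumes "\<phi> \<in> C1_compact U"
  shows "parabolic \<sigma> (\<lambda>z. c * \<phi> z) = c *\<^sub>R parabolic \<sigma> \<phi>"
  unfolding parabolic_def using cls_scaleR[OF Q_sets parabolic_L2[OF assms], of c \<sigma>]
  by (simp add: space_grad_scale[OF assms] time_deriv_scale[OF assms] distrib_left mult_ac)

lemma jet_zero: "jet (\<lambda>z. 0) = 0"
  using jet_scale[OF C1_compact_zero[of UNIV], of 0] by simp

lemma subspace_graph: "subspace ((\<lambda>\<phi>. (jet \<phi>, parabolic \<sigma> \<phi>)) ` C1_compact U)" (is "subspace ?G")
  unfolding subspace_def
proof (intro conjI ballI allI)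
  have "parabolic \<sigma> (\<lambda>z. 0) = 0" using parabolic_scale[OF C1_compact_zero[of UNIV], of \<sigma> 0] by simp
  then show "0 \<in> ?G" using C1_compact_zero by (intro image_eqI[of _ _ "\<lambda>z. 0"]) (auto simp: jet_zero zero_prod_def)
  show "x + y \<in> ?G" if xy: "x \<in> ?G" "y \<in> ?G" for x y
  proof -
    obtain \<phi> \<psi> where "\<phi> \<in> C1_compact U" "\<psi> \<in> C1_compact U" "x = (jet \<phi>, parabolic \<sigma> \<phi>)" "y = (jet \<psi>, parabolic \<sigma> \<psi>)"
      using xy by auto
    then show ?thesis
      by (intro image_eqI[of _ _ "\<lambda>z. \<phi> z + \<psi> z"]) (auto simp: jet_add parabolic_add C1_compact_add)
  qed
  show "c *\<^sub>R x \<in> ?G" if x: "x \<in> ?G" for c x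
  proof -
    obtain \<phi> where "\<phi> \<in> C1_compact U" "x = (jet \<phi>, parabolic \<sigma> \<phi>)" using x by auto
    then show ?thesis
      by (intro image_eqI[of _ _ "\<lambda>z. c * \<phi> z"]) (auto simp: jet_scale parabolic_scale C1_compact_scaleR)
  qed
qed

lemma subspace_jets: "subspace (jet ` C1_compact U)"
proof -
  have "linear (fst :: ('a \<times> real, real \<times> 'a) l2 \<times> ('a \<times> real, real \<times> 'a) l2 \<Rightarrow> _)"
    by (auto intro: linearI)
  from linear_subspace_image[OF this subspace_graph[of 0 U]] show ?thesis by (simp add: image_image)
qed

lemma subspace_energy: "subspace energy"
  unfolding energy_def by (intro subspace_closure subspace_jets)

lemma closed_energy: "closed energy"
  by (simp add: energy_def)

lemma jet_in_energy:
  assumes "\<phi> \<in> C1_compact (\<Omega> \<times> I)" shows "jet \<phi> \<in> energy"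
proof -
  have "C1_compact (\<Omega> \<times> I) \<subseteq> C1_compact (\<Omega> \<times> UNIV)" by (rule C1_compact_mono) auto
  then show ?thesis using assms closure_subset unfolding energy_def by blast
qed

text \<open>
  On an unbounded \<open>\<Omega>\<close> there is no Poincare inequality; testing with \<open>W \<phi>\<close> for a positive weight \<open>W\<close> with
  \<open>\<sigma> W' = - W\<close> yields control of \<open>\<phi>\<close> itself.
\<close>

lemma inf_sup:
  assumes \<phi>: "\<phi> \<in> C1_compact (\<Omega> \<times> I)" and \<sigma>: "\<sigma> = 1 \<and> I = {0<..} \<or> \<sigma> = - 1 \<and> I = {..<T}"
  shows "\<exists>v\<in>energy. norm v \<le> exp T * norm (jet \<phi>) \<and> min (1/2) \<nu> * (norm (jet \<phi>))\<^sup>2 \<le> v \<bullet> parabolic \<sigma> \<phi>"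
proof -
  \<comment> \<open>The exponentials are normalized to lie between 1 and \<open>exp T\<close> on the
    cylinder for either sign: the upper bound is the constant in the claim, the lower bound
    preserves the coercive terms.\<close>
  define W where "W = (\<lambda>t. if \<sigma> = 1 then exp (T - t) else exp t)"
  have W': "(W has_real_derivative - \<sigma> * W t) (at t)" for t
    using \<sigma> unfolding W_def by (cases "\<sigma> = 1") (auto intro!: derivative_eq_intros)
  have cW': "continuous_on UNIV (\<lambda>t. - \<sigma> * W t)"
    unfolding W_def by (cases "\<sigma> = 1") (auto intro!: continuous_intros)
  have W0: "0 \<le> W t" for t by (simp add: W_def)
  have W: "1 \<le> W (snd z)" "W (snd z) \<le> exp T" if "z \<in> Q" for z using that by (auto simp: W_def)
  note mult = time_multiplier[OF _ W' cW']
  let ?v = "\<lambda>z. W (snd z) * \<phi> z" and ?\<psi> = "\<lambda>z. W (snd z) * (\<phi> z * \<phi> z)"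
  let ?jet = "\<lambda>z. (\<phi> z, space_grad \<phi> z)" and ?B = "\<lambda>z. (\<sigma> * time_deriv \<phi> z + a0 z * \<phi> z, \<nu> *\<^sub>R space_grad \<phi> z)"
  have v: "?v \<in> C1_compact (\<Omega> \<times> I)" by (rule mult(1)[OF \<phi>])
  have jv: "jet ?v = cls Q (\<lambda>z. W (snd z) *\<^sub>R ?jet z)"
    unfolding jet_def by (simp add: mult(3)[OF \<phi>])
  have jvL2: "(\<lambda>z. W (snd z) *\<^sub>R ?jet z) \<in> L2 Q" using jet_L2[OF v] by (simp add: mult(3)[OF \<phi>])
  have "norm (jet ?v) \<le> norm (exp T *\<^sub>R jet \<phi>)"
  proof -
    have "L2_norm Q (\<lambda>z. W (snd z) *\<^sub>R ?jet z) \<le> L2_norm Q (\<lambda>z. exp T *\<^sub>R ?jet z)"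
    proof (rule L2_norm_mono[OF jvL2 L2_scaleR[OF jet_L2[OF \<phi>]]])
      show "AE z in lebesgue_on Q. norm (W (snd z) *\<^sub>R ?jet z) \<le> norm (exp T *\<^sub>R ?jet z)"
      proof (intro AE_I2)
        fix z assume "z \<in> space (lebesgue_on Q)"
        then have "z \<in> Q" by simp
        from W[OF this] show "norm (W (snd z) *\<^sub>R ?jet z) \<le> norm (exp T *\<^sub>R ?jet z)"
          unfolding norm_scaleR using T_pos by (intro mult_right_mono) auto
      qed
    qed
    then show ?thesis
      unfolding jv unfolding jet_def
      by (simp only: norm_cls[OF Q_sets jvL2] cls_scaleR[OF Q_sets jet_L2[OF \<phi>], symmetric]
          norm_cls[OF Q_sets L2_scaleR[OF jet_L2[OF \<phi>]]])
  qed
  then have 1: "norm (jet ?v) \<le> exp T * norm (jet \<phi>)" using T_pos by simp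
  have \<phi>2: "(\<lambda>z. \<phi> z * \<phi> z) \<in> C1_compact (\<Omega> \<times> I)" by (rule C1_compact_square(1)[OF \<phi>])
  have \<psi>: "?\<psi> \<in> C1_compact (\<Omega> \<times> I)" by (rule mult(1)[OF \<phi>2])
  \<comment> \<open>Formally this integral is the value of the weighted square at the end where
    tests are unrestricted, t = T for \<sigma> = 1 and t = 0 for \<sigma> = -1; at the other end
    they vanish.\<close>
  have sign: "0 \<le> (LINT z|lebesgue_on Q. \<sigma> * time_deriv ?\<psi> z)"
  proof -
    have "frechet_derivative ?\<psi> (at z) (0, \<sigma>) = \<sigma> * time_deriv ?\<psi> z" for z
      using linear_scale[OF C1_compact_linear[OF \<psi>], of z \<sigma> "(0, 1)"] by (simp add: time_deriv_def)
    moreover have "0 \<le> (LINT z|lebesgue_on Q. frechet_derivative ?\<psi> (at z) (0, \<sigma>))"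
      by (rule integral_derivative_nonneg[OF \<psi> _ open_Q]) (use \<sigma> W0 in auto)
    ultimately show ?thesis by simp
  qed
  have "min (1/2) \<nu> * (norm (jet \<phi>))\<^sup>2 = (LINT z|lebesgue_on Q. min (1/2) \<nu> * (?jet z \<bullet> ?jet z))"
    unfolding power2_norm_eq_inner jet_def inner_cls[OF Q_sets jet_L2[OF \<phi>] jet_L2[OF \<phi>]] L2_inner_def by simp
  also have "\<dots> \<le> (LINT z|lebesgue_on Q. min (1/2) \<nu> * (?jet z \<bullet> ?jet z) + 1/2 * (\<sigma> * time_deriv ?\<psi> z))"
    using sign L2_inner_integrable[OF jet_L2[OF \<phi>] jet_L2[OF \<phi>]]
      compactly_supported_integrable[OF compactly_supported_time_deriv[OF \<psi>] Q_sets]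
    by (subst Bochner_Integration.integral_add) auto
  also have "\<dots> \<le> (LINT z|lebesgue_on Q. (W (snd z) *\<^sub>R ?jet z) \<bullet> ?B z)"
  proof (rule integral_mono_AE)
    show "integrable (lebesgue_on Q) (\<lambda>z. min (1/2) \<nu> * (?jet z \<bullet> ?jet z) + 1/2 * (\<sigma> * time_deriv ?\<psi> z))"
      using L2_inner_integrable[OF jet_L2[OF \<phi>] jet_L2[OF \<phi>]]
        compactly_supported_integrable[OF compactly_supported_time_deriv[OF \<psi>] Q_sets] by auto
    show "integrable (lebesgue_on Q) (\<lambda>z. (W (snd z) *\<^sub>R ?jet z) \<bullet> ?B z)"
      by (rule L2_inner_integrable[OF jvL2 parabolic_L2[OF \<phi>]])
    have "AE z in lebesgue_on Q. z \<in> Q" by (intro AE_I2) simp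
    with a0_nonneg show "AE z in lebesgue_on Q. min (1/2) \<nu> * (?jet z \<bullet> ?jet z) + 1/2 * (\<sigma> * time_deriv ?\<psi> z)
        \<le> (W (snd z) *\<^sub>R ?jet z) \<bullet> ?B z"
    proof eventually_elim
      fix z assume "0 \<le> a0 z" "z \<in> Q"
      have s2: "\<sigma> * \<sigma> = 1" using \<sigma> by auto
      have "\<sigma> * time_deriv ?\<psi> z = 2 * \<sigma> * W (snd z) * \<phi> z * time_deriv \<phi> z - (\<sigma> * \<sigma>) * (W (snd z) * (\<phi> z * \<phi> z))"
        unfolding mult(2)[OF \<phi>2] C1_compact_square(2)[OF \<phi>] by (simp add: algebra_simps)
      \<comment> \<open>Half of the time derivative of the weighted square absorbs the indefinite
        product of \<phi> and its time derivative. What remains is half of the weighted square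
        itself, the origin of 1/2 in \<open>min (1/2) \<nu>\<close>.\<close>
      then have "(W (snd z) *\<^sub>R ?jet z) \<bullet> ?B z - 1/2 * (\<sigma> * time_deriv ?\<psi> z)
          = 1/2 * (W (snd z) * (\<phi> z * \<phi> z)) + W (snd z) * (a0 z * (\<phi> z * \<phi> z)) + W (snd z) * (\<nu> * (space_grad \<phi> z \<bullet> space_grad \<phi> z))"
        unfolding s2 by (simp add: algebra_simps)
      moreover have "0 \<le> W (snd z) * (a0 z * (\<phi> z * \<phi> z))"
        using W(1)[OF \<open>z \<in> Q\<close>] \<open>0 \<le> a0 z\<close> by (intro mult_nonneg_nonneg[OF _ mult_nonneg_nonneg]) auto
      moreover have "1 * (min (1/2) \<nu> * (space_grad \<phi> z \<bullet> space_grad \<phi> z)) \<le> W (snd z) * (\<nu> * (space_grad \<phi> z \<bullet> space_grad \<phi> z))"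
        using W(1)[OF \<open>z \<in> Q\<close>] \<nu>_pos by (intro mult_mono mult_right_mono mult_nonneg_nonneg) auto
      moreover have "min (1/2) \<nu> * (1 * (\<phi> z * \<phi> z)) \<le> 1/2 * (W (snd z) * (\<phi> z * \<phi> z))"
        using W(1)[OF \<open>z \<in> Q\<close>] by (intro mult_mono mult_right_mono) auto
      moreover have "min (1/2) \<nu> * (?jet z \<bullet> ?jet z)
          = min (1/2) \<nu> * (1 * (\<phi> z * \<phi> z)) + 1 * (min (1/2) \<nu> * (space_grad \<phi> z \<bullet> space_grad \<phi> z))"
        by (simp add: distrib_left)
      ultimately show "min (1/2) \<nu> * (?jet z \<bullet> ?jet z) + 1/2 * (\<sigma> * time_deriv ?\<psi> z) \<le> (W (snd z) *\<^sub>R ?jet z) \<bullet> ?B z"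
        by linarith
    qed
  qed
  also have "\<dots> = jet ?v \<bullet> parabolic \<sigma> \<phi>"
    unfolding jv parabolic_def inner_cls[OF Q_sets jvL2 parabolic_L2[OF \<phi>]] L2_inner_def ..
  finally show ?thesis using 1 jet_in_energy[OF v] by blast
qed

end

section \<open>A cutoff in time\<close>

text \<open>Squaring removes the kink of the positive part at 0, which makes the cutoff below
  continuously differentiable.\<close>

lemma max_zero_square_has_derivative:
  fixes y :: real
  shows "((\<lambda>y. (max 0 y)\<^sup>2) has_real_derivative 2 * max 0 y) (at y)"
proof -
  consider "y < 0" | "y = 0" | "0 < y" by linarith
  then show ?thesis
  proof cases
    case 1
    have "((\<lambda>y. 0) has_real_derivative 0) (at y)" by simp
    then have "((\<lambda>y. (max 0 y)\<^sup>2) has_real_derivative 0) (at y)"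
      by (rule has_field_derivative_transform_within_open[of _ _ _ "{..<0}"]) (use 1 in auto)
    then show ?thesis using 1 by simp
  next
    case 2
    have "((\<lambda>h. ((max 0 (0 + h))\<^sup>2 - (max 0 0)\<^sup>2) / h) \<longlongrightarrow> 0) (at (0::real))"
    proof (rule Lim_null_comparison)
      have "norm (((max 0 (0 + h))\<^sup>2 - (max 0 0)\<^sup>2) / h) \<le> \<bar>h\<bar>" for h :: real
        by (cases "0 < h") (auto simp: power2_eq_square max_def)
      then show "\<forall>\<^sub>F h in at (0::real). norm (((max 0 (0 + h))\<^sup>2 - (max 0 0)\<^sup>2) / h) \<le> \<bar>h\<bar>" by simp
      show "((\<lambda>h. \<bar>h\<bar>) \<longlongrightarrow> 0) (at (0::real))" by (auto intro!: tendsto_eq_intros)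
    qed
    then show ?thesis unfolding 2 DERIV_def by simp
  next
    case 3
    have "((\<lambda>y. y\<^sup>2) has_real_derivative 2 * y) (at y)" by (auto intro!: derivative_eq_intros)
    then have "((\<lambda>y. (max 0 y)\<^sup>2) has_real_derivative 2 * y) (at y)"
      by (rule has_field_derivative_transform_within_open[of _ _ _ "{0<..}"]) (use 3 in auto)
    then show ?thesis using 3 by simp
  qed
qed

text \<open>The map x to 1 - 1/(1 + x^2) takes values in [0, 1) and is applied to a positive part.
  Hence the cutoff vanishes where k t (T - t) is at most 1, in particular near both ends, and tends
  to 1 inside (0, T).\<close>

definition cutoff :: "real \<Rightarrow> nat \<Rightarrow> real \<Rightarrow> real" where
  "cutoff T k t = 1 - 1 / (1 + (max 0 (real k * (t * (T - t)) - 1))\<^sup>2)"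

lemma cutoff_denominator: "0 < 1 + (max 0 x)\<^sup>2" for x :: real
  using zero_le_power2[of "max 0 x"] by linarith

lemma cutoff_bounds: "0 \<le> cutoff T k t" "cutoff T k t \<le> 1"
  using cutoff_denominator[of "real k * (t * (T - t)) - 1"] by (auto simp: cutoff_def)

lemma cutoff_eq_0: "real k * (t * (T - t)) \<le> 1 \<Longrightarrow> cutoff T k t = 0"
  by (simp add: cutoff_def max_def)

lemma cutoff_tendsto:
  assumes "0 < t" "t < T" shows "(\<lambda>k. cutoff T k t) \<longlonglongrightarrow> 1"
proof -
  have c: "0 < t * (T - t)" using assms by simp
  have "filterlim (\<lambda>k. real k * (t * (T - t)) - 1) at_top sequentially"
    using filterlim_tendsto_add_at_top[OF tendsto_const[of "- 1"]
        filterlim_at_top_mult_tendsto_pos[OF tendsto_const c filterlim_real_sequentially]]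
    by simp
  then have "filterlim (\<lambda>k. 1 + (max 0 (real k * (t * (T - t)) - 1))\<^sup>2) at_top sequentially"
  proof (rule filterlim_at_top_mono)
    have "x \<le> 1 + (max 0 x)\<^sup>2" for x :: real
    proof (cases "x \<le> 0")
      case True
      then show ?thesis by simp
    next
      case False
      have "0 \<le> (x - 1/2)\<^sup>2" by simp
      then show ?thesis using False by (simp add: power2_diff max_def power_divide)
    qed
    then show "\<forall>\<^sub>F k in sequentially. real k * (t * (T - t)) - 1 \<le> 1 + (max 0 (real k * (t * (T - t)) - 1))\<^sup>2"
      by (intro always_eventually allI)
  qed
  then have "(\<lambda>k. inverse (1 + (max 0 (real k * (t * (T - t)) - 1))\<^sup>2)) \<longlonglongrightarrow> 0"
    by (rule tendsto_inverse_0_at_top)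
  then have "(\<lambda>k. 1 - inverse (1 + (max 0 (real k * (t * (T - t)) - 1))\<^sup>2)) \<longlonglongrightarrow> 1 - 0"
    by (intro tendsto_diff tendsto_const)
  then show ?thesis by (simp add: cutoff_def inverse_eq_divide)
qed

lemma DERIV_one_minus_inverse:
  fixes g :: "real \<Rightarrow> real"
  assumes "(g has_real_derivative g') (at t)" "1 + g t \<noteq> 0"
  shows "((\<lambda>t. 1 - inverse (1 + g t)) has_real_derivative g' / (1 + g t)\<^sup>2) (at t)"
  using assms by (auto intro!: derivative_eq_intros simp: power2_eq_square divide_inverse)

lemma cutoff_C1:
  obtains f' where "\<And>t. (cutoff T k has_real_derivative f' t) (at t)" "continuous_on UNIV f'"
proof
  let ?y = "\<lambda>t. real k * (t * (T - t)) - 1"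
  let ?f' = "\<lambda>t. (2 * max 0 (?y t) * (real k * (T - 2 * t))) / (1 + (max 0 (?y t))\<^sup>2)\<^sup>2"
  have nz: "1 + (max 0 x)\<^sup>2 \<noteq> 0" for x :: real using cutoff_denominator[of x] by linarith
  show "(cutoff T k has_real_derivative ?f' t) (at t)" for t
  proof -
    have y: "(?y has_real_derivative real k * (T - 2 * t)) (at t)"
      by (auto intro!: derivative_eq_intros simp: algebra_simps)
    have "((\<lambda>t. (max 0 (?y t))\<^sup>2) has_real_derivative 2 * max 0 (?y t) * (real k * (T - 2 * t))) (at t)"
      using DERIV_chain[OF max_zero_square_has_derivative y] by (simp add: o_def)
    then have "((\<lambda>t. 1 - inverse (1 + (max 0 (?y t))\<^sup>2)) has_real_derivative ?f' t) (at t)"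
      by (rule DERIV_one_minus_inverse) (rule nz)
    moreover have "cutoff T k = (\<lambda>t. 1 - inverse (1 + (max 0 (?y t))\<^sup>2))"
      by (simp add: cutoff_def fun_eq_iff inverse_eq_divide)
    ultimately show ?thesis by simp
  qed
  show "continuous_on UNIV ?f'"
    by (intro continuous_intros) (use nz in auto)
qed

section \<open>Weak solutions as elements of the Hilbert space\<close>

context parabolic_problem
begin

definition tests :: "real \<Rightarrow> ('a \<times> real \<Rightarrow> real) set" where
  "tests \<sigma> = (if \<sigma> = 1 then C1_compact (\<Omega> \<times> {0<..}) else C1_compact (\<Omega> \<times> {..<T}))"

text \<open>The solution is one Hilbert space element whose second component is the gradient, as
  Lions' lemma delivers it; representing functions are recovered by
  \<open>energy_cases\<close>.\<close>

definition weak :: "real \<Rightarrow> ('a \<times> real \<Rightarrow> real) \<Rightarrow> ('a \<times> real, real \<times> 'a) l2 \<Rightarrow> bool" where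
  "weak \<sigma> f w \<longleftrightarrow> w \<in> energy \<and> (\<forall>\<phi>\<in>tests \<sigma>. w \<bullet> parabolic \<sigma> \<phi> = src f \<bullet> jet \<phi>)"

text \<open>The ratio \<open>M / c\<close> of \<open>lions_projection\<close> for the constants
  found in \<open>inf_sup\<close>.\<close>

definition "stability_const = exp T / min (1/2) \<nu>"

lemma weak_exists:
  assumes \<sigma>: "\<sigma> = 1 \<or> \<sigma> = - 1"
  obtains w where "weak \<sigma> f w" "norm w \<le> stability_const * norm (src f)"
proof -
  obtain I where I: "tests \<sigma> = C1_compact (\<Omega> \<times> I)" "\<sigma> = 1 \<and> I = {0<..} \<or> \<sigma> = - 1 \<and> I = {..<T}"
    using \<sigma> by (auto simp: tests_def)
  define G where "G = (\<lambda>\<phi>. (jet \<phi>, parabolic \<sigma> \<phi>)) ` tests \<sigma>"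
  have inf_sup_G: "\<exists>v\<in>energy. norm v \<le> exp T * norm j \<and> min (1/2) \<nu> * (norm j)\<^sup>2 \<le> v \<bullet> b"
    if jb: "(j, b) \<in> G" for j b
  proof -
    obtain \<phi> where "\<phi> \<in> C1_compact (\<Omega> \<times> I)" "j = jet \<phi>" "b = parabolic \<sigma> \<phi>"
      using jb unfolding G_def I(1) by auto
    then show ?thesis using inf_sup[OF _ I(2)] by blast
  qed
  have G: "subspace G" unfolding G_def I(1) by (rule subspace_graph)
  have pos: "0 < min (1/2) \<nu>" "0 \<le> exp T" using \<nu>_pos by auto
  obtain u where u: "u \<in> energy" "norm u \<le> exp T / min (1/2) \<nu> * norm (src f)"
    "\<And>j b. (j, b) \<in> G \<Longrightarrow> u \<bullet> b = src f \<bullet> j"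
    using lions_projection[OF subspace_energy closed_energy G pos inf_sup_G, where f = "src f"] by blast
  have "weak \<sigma> f u" unfolding weak_def using u(1,3) by (auto simp: G_def)
  then show thesis using that u(2) by (simp add: stability_const_def)
qed

text \<open>An arbitrary class lives on the whole space, and it must be seen that \<open>w\<close>
  vanishes off \<open>Q\<close>. Restricting a representative to \<open>Q\<close> does not increase
  its distance to any jet, so the jets that converge to \<open>w\<close> also converge to the
  restricted class.\<close>

lemma energy_cases:
  assumes "w \<in> energy"
  obtains u g where "u \<in> L2 Q" "g \<in> L2 Q" "w = cls Q (\<lambda>z. (u z, g z))"
proof -
  obtain h where h: "h \<in> L2 UNIV" "w = cls UNIV h" by (rule ex_cls_UNIV)
  have hQ: "h \<in> L2 Q" using L2_subset[OF Q_sets _ _ h(1)] by simp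
  obtain x where x: "\<And>k. x k \<in> jet ` C1_compact (\<Omega> \<times> UNIV)" "x \<longlonglongrightarrow> w"
    using assms unfolding energy_def closure_sequential by blast
  have "norm (x k - cls Q h) \<le> norm (x k - w)" for k
  proof -
    obtain \<phi> where \<phi>: "\<phi> \<in> C1_compact (\<Omega> \<times> UNIV)" "x k = jet \<phi>" using x(1)[of k] by auto
    let ?j = "\<lambda>z. (\<phi> z, space_grad \<phi> z)" and ?j' = "\<lambda>z. indicator Q z *\<^sub>R (\<phi> z, space_grad \<phi> z)"
    have j': "?j' \<in> L2 UNIV" by (rule L2_indicator_iff[OF Q_sets, THEN iffD2, OF jet_L2[OF \<phi>(1)]])
    have U: "(UNIV :: ('a \<times> real) set) \<in> sets lebesgue" by simp
    have e: "x k = cls UNIV ?j'" unfolding \<phi>(2) jet_def cls_def indicator_UNIV scaleR_one ..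
    have "norm (x k - cls Q h) = L2_norm Q (\<lambda>z. ?j z - h z)"
      unfolding \<phi>(2) jet_def cls_diff[OF Q_sets jet_L2[OF \<phi>(1)] hQ, symmetric]
      by (rule norm_cls[OF Q_sets L2_diff[OF jet_L2[OF \<phi>(1)] hQ]])
    also have "\<dots> = L2_norm Q (\<lambda>z. ?j' z - h z)"
      unfolding L2_norm_def L2_inner_def
      by (intro arg_cong[of _ _ sqrt] Bochner_Integration.integral_cong) auto
    also have "\<dots> \<le> L2_norm UNIV (\<lambda>z. ?j' z - h z)"
      by (rule L2_norm_subset[OF Q_sets L2_diff[OF j' h(1)]])
    also have "\<dots> = norm (x k - w)"
      unfolding e h(2) cls_diff[OF U j' h(1), symmetric] by (rule norm_cls[OF U L2_diff[OF j' h(1)], symmetric])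
    finally show ?thesis .
  qed
  then have le: "\<forall>\<^sub>F k in sequentially. norm (x k - cls Q h) \<le> norm (x k - w)" by (intro always_eventually allI)
  have "(\<lambda>k. x k - w) \<longlonglongrightarrow> 0" using x(2) by (rule LIM_zero)
  then have "(\<lambda>k. x k - cls Q h) \<longlonglongrightarrow> 0"
    by (intro Lim_null_comparison[OF le] tendsto_norm_zero)
  then have "x \<longlonglongrightarrow> cls Q h" by (rule LIM_zero_cancel)
  then have "w = cls Q h" using x(2) LIMSEQ_unique by blast
  then show thesis by (intro that[OF L2_fst_snd[OF hQ]]) simp
qed

lemma norm_jet_diff_cls:
  assumes \<phi>: "\<phi> \<in> C1_compact U" and u: "u \<in> L2 Q" and g: "g \<in> L2 Q"
  shows "(norm (jet \<phi> - cls Q (\<lambda>z. (u z, g z))))\<^sup>2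
    = (L2_norm Q (\<lambda>z. \<phi> z - u z))\<^sup>2 + (L2_norm Q (\<lambda>z. space_grad \<phi> z - g z))\<^sup>2"
proof -
  have d: "(\<lambda>z. \<phi> z - u z) \<in> L2 Q" "(\<lambda>z. space_grad \<phi> z - g z) \<in> L2 Q"
    by (rule L2_diff[OF L2_C1_compact(1)[OF \<phi>] u], rule L2_diff[OF L2_C1_compact(3)[OF \<phi>] g])
  have "jet \<phi> - cls Q (\<lambda>z. (u z, g z)) = cls Q (\<lambda>z. (\<phi> z - u z, space_grad \<phi> z - g z))"
    unfolding jet_def cls_diff[OF Q_sets jet_L2[OF \<phi>] L2_norm_Pair(1)[OF u g], symmetric] by simp
  then show ?thesis
    by (simp only: norm_cls[OF Q_sets L2_norm_Pair(1)[OF d]] L2_norm_Pair(2)[OF d])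
qed

text \<open>The squared distance of a jet to the pair splits into the parts of value and gradient,
  so convergence of jets is simultaneous convergence of both.\<close>

lemma energy_space_iff:
  "(u, g) \<in> energy_space \<Omega> T \<longleftrightarrow> u \<in> L2 Q \<and> g \<in> L2 Q \<and> cls Q (\<lambda>z. (u z, g z)) \<in> energy"
proof (cases "u \<in> L2 Q \<and> g \<in> L2 Q")
  case True
  let ?w = "cls Q (\<lambda>z. (u z, g z))"
  have eq: "(norm (jet \<phi> - ?w))\<^sup>2 = (L2_norm Q (\<lambda>z. \<phi> z - u z))\<^sup>2 + (L2_norm Q (\<lambda>z. space_grad \<phi> z - g z))\<^sup>2"
    if "\<phi> \<in> C1_compact (\<Omega> \<times> UNIV)" for \<phi> using norm_jet_diff_cls[OF that] True by blast
  show ?thesis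
  proof
    assume "(u, g) \<in> energy_space \<Omega> T"
    then obtain \<phi> where \<phi>: "\<And>k. \<phi> k \<in> C1_compact (\<Omega> \<times> UNIV)"
      and 1: "(\<lambda>k. L2_norm Q (\<lambda>z. \<phi> k z - u z)) \<longlonglongrightarrow> 0"
      and 2: "(\<lambda>k. L2_norm Q (\<lambda>z. space_grad (\<phi> k) z - g z)) \<longlonglongrightarrow> 0"
      unfolding energy_space_def by blast
    have "(\<lambda>k. sqrt ((L2_norm Q (\<lambda>z. \<phi> k z - u z))\<^sup>2 + (L2_norm Q (\<lambda>z. space_grad (\<phi> k) z - g z))\<^sup>2)) \<longlonglongrightarrow> sqrt (0\<^sup>2 + 0\<^sup>2)"
      by (intro tendsto_intros 1 2)
    then have "(\<lambda>k. norm (jet (\<phi> k) - ?w)) \<longlonglongrightarrow> 0"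
      by (simp flip: eq[OF \<phi>])
    then have "(\<lambda>k. jet (\<phi> k)) \<longlonglongrightarrow> ?w" by (rule LIM_zero_cancel[OF tendsto_norm_zero_cancel])
    then have "?w \<in> energy"
      unfolding energy_def closure_sequential using \<phi> by (intro exI[of _ "\<lambda>k. jet (\<phi> k)"]) simp
    then show "u \<in> L2 Q \<and> g \<in> L2 Q \<and> ?w \<in> energy" using True by simp
  next
    assume "u \<in> L2 Q \<and> g \<in> L2 Q \<and> ?w \<in> energy"
    then obtain x where x: "\<And>k. x k \<in> jet ` C1_compact (\<Omega> \<times> UNIV)" "x \<longlonglongrightarrow> ?w"
      unfolding energy_def closure_sequential by blast
    then have "\<forall>k. \<exists>\<phi>. \<phi> \<in> C1_compact (\<Omega> \<times> UNIV) \<and> x k = jet \<phi>" by blast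
    then obtain \<phi> where \<phi>: "\<And>k. \<phi> k \<in> C1_compact (\<Omega> \<times> UNIV)" "\<And>k. x k = jet (\<phi> k)" by metis
    have lim: "(\<lambda>k. norm (jet (\<phi> k) - ?w)) \<longlonglongrightarrow> 0" using tendsto_norm_zero[OF LIM_zero[OF x(2)]] by (simp only: \<phi>(2))
    have "L2_norm Q (\<lambda>z. \<phi> k z - u z) \<le> norm (jet (\<phi> k) - ?w)"
      "L2_norm Q (\<lambda>z. space_grad (\<phi> k) z - g z) \<le> norm (jet (\<phi> k) - ?w)" for k
      by (rule power2_le_imp_le; simp add: eq[OF \<phi>(1)])+
    then have "(\<lambda>k. L2_norm Q (\<lambda>z. \<phi> k z - u z)) \<longlonglongrightarrow> 0" "(\<lambda>k. L2_norm Q (\<lambda>z. space_grad (\<phi> k) z - g z)) \<longlonglongrightarrow> 0"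
      by (auto intro!: tendsto_sandwich[OF _ _ tendsto_const lim] always_eventually L2_norm_nonneg)
    then show "(u, g) \<in> energy_space \<Omega> T" unfolding energy_space_def using True \<phi>(1) by blast
  qed
qed (auto simp: energy_space_def)

lemma weak_state_solution_iff:
  assumes q: "q \<in> L2 Q"
  shows "weak_state_solution \<Omega> T \<nu> a0 q p \<longleftrightarrow>
    p \<in> L2 Q \<and> (\<exists>g\<in>L2 Q. weak 1 q (cls Q (\<lambda>z. (p z, g z))))"
proof -
  have "((LINT z | lebesgue_on Q. - p z * time_deriv \<phi> z - \<nu> * (g z \<bullet> space_grad \<phi> z) - a0 z * p z * \<phi> z)
      = (LINT z | lebesgue_on Q. - q z * \<phi> z))
    \<longleftrightarrow> cls Q (\<lambda>z. (p z, g z)) \<bullet> parabolic 1 \<phi> = src q \<bullet> jet \<phi>"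
    if "\<phi> \<in> C1_compact U" "p \<in> L2 Q" "g \<in> L2 Q" for \<phi> g U
  proof -
    have "cls Q (\<lambda>z. (p z, g z)) \<bullet> parabolic 1 \<phi>
        = (LINT z | lebesgue_on Q. - (- p z * time_deriv \<phi> z - \<nu> * (g z \<bullet> space_grad \<phi> z) - a0 z * p z * \<phi> z))"
      unfolding parabolic_def inner_cls[OF Q_sets L2_norm_Pair(1)[OF that(2,3)] parabolic_L2[OF that(1)]] L2_inner_def
      by (intro Bochner_Integration.integral_cong) (auto simp: algebra_simps)
    moreover have "src q \<bullet> jet \<phi> = (LINT z | lebesgue_on Q. - (- q z * \<phi> z))"
      unfolding src_def jet_def inner_cls[OF Q_sets L2_src[OF q] jet_L2[OF that(1)]] L2_inner_def by simp
    ultimately show ?thesis by (simp only: integral_minus neg_equal_iff_equal)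
  qed
  then show ?thesis
    unfolding weak_state_solution_def energy_space_iff weak_def tests_def by auto
qed

lemma weak_adjoint_solution_iff:
  assumes f: "f \<in> L2 Q"
  shows "weak_adjoint_solution \<Omega> T \<nu> a0 f p \<longleftrightarrow>
    p \<in> L2 Q \<and> (\<exists>g\<in>L2 Q. weak (- 1) f (cls Q (\<lambda>z. (p z, g z))))"
proof -
  have "((LINT z | lebesgue_on Q. - p z * time_deriv \<phi> z + \<nu> * (g z \<bullet> space_grad \<phi> z) + a0 z * p z * \<phi> z)
      = (LINT z | lebesgue_on Q. f z * \<phi> z))
    \<longleftrightarrow> cls Q (\<lambda>z. (p z, g z)) \<bullet> parabolic (- 1) \<phi> = src f \<bullet> jet \<phi>"
    if "\<phi> \<in> C1_compact U" "p \<in> L2 Q" "g \<in> L2 Q" for \<phi> g U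
  proof -
    have "cls Q (\<lambda>z. (p z, g z)) \<bullet> parabolic (- 1) \<phi>
        = (LINT z | lebesgue_on Q. - p z * time_deriv \<phi> z + \<nu> * (g z \<bullet> space_grad \<phi> z) + a0 z * p z * \<phi> z)"
      unfolding parabolic_def inner_cls[OF Q_sets L2_norm_Pair(1)[OF that(2,3)] parabolic_L2[OF that(1)]] L2_inner_def
      by (intro Bochner_Integration.integral_cong) (auto simp: algebra_simps)
    moreover have "src f \<bullet> jet \<phi> = (LINT z | lebesgue_on Q. f z * \<phi> z)"
      unfolding src_def jet_def inner_cls[OF Q_sets L2_src[OF f] jet_L2[OF that(1)]] L2_inner_def by simp
    ultimately show ?thesis by (simp only:)
  qed
  then show ?thesis
    unfolding weak_adjoint_solution_def energy_space_iff weak_def tests_def by auto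
qed

text \<open>The norm of a jet sees no time derivative. The cutoff merely multiplies the jet by a
  factor in [0, 1] tending to 1, and its growing slope never enters.\<close>

lemma jet_in_closure_interior_jets:
  assumes \<phi>: "\<phi> \<in> C1_compact (\<Omega> \<times> UNIV)"
  shows "jet \<phi> \<in> closure (jet ` C1_compact Q)"
proof -
  let ?\<eta> = "\<lambda>k z. cutoff T k (snd z) * \<phi> z" and ?j = "\<lambda>z. (\<phi> z, space_grad \<phi> z)"
  have \<eta>: "?\<eta> k \<in> C1_compact (\<Omega> \<times> UNIV)" "space_grad (?\<eta> k) z = cutoff T k (snd z) *\<^sub>R space_grad \<phi> z" for k z
    using cutoff_C1[of T k] time_multiplier(1,3)[OF \<phi>] by metis+
  have "?\<eta> k \<in> C1_compact Q" for k
  proof -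
    obtain K where K: "compact K" "K \<subseteq> \<Omega> \<times> UNIV" "\<And>z. z \<notin> K \<Longrightarrow> \<phi> z = 0" using C1_compact_support[OF \<phi>] by metis
    \<comment> \<open>Off this set \<phi> or the cutoff vanishes. The second condition is closed,
      which preserves compactness, and it forces 0 < t < T.\<close>
    let ?L = "K \<inter> {z. 1 \<le> real k * (snd z * (T - snd z))}"
    have "closed {z :: 'a \<times> real. 1 \<le> real k * (snd z * (T - snd z))}"
      by (intro closed_Collect_le continuous_intros)
    with K have "compact ?L" by blast
    moreover have "?L \<subseteq> Q"
    proof
      fix z assume z: "z \<in> ?L"
      then have "0 < real k * (snd z * (T - snd z))" by auto
      then have "0 < snd z * (T - snd z)" by (simp add: zero_less_mult_iff)
      then have "0 < snd z \<and> snd z < T" using T_pos by (auto simp: zero_less_mult_iff)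
      then show "z \<in> Q" using z K(2) by (cases z) auto
    qed
    moreover have "?\<eta> k z = 0" if "z \<notin> ?L" for z
      using that K(3) cutoff_eq_0[of k "snd z" T] by (cases "z \<in> K") auto
    ultimately show ?thesis
      using \<eta>(1)[of k] unfolding C1_compact_def by blast
  qed
  moreover have "(\<lambda>k. jet (?\<eta> k)) \<longlonglongrightarrow> jet \<phi>"
  proof -
    have i: "integrable (lebesgue_on Q) (\<lambda>z. (norm (?j z))\<^sup>2)" using jet_L2[OF \<phi>] by (simp only: L2_def mem_Collect_eq)
    have n: "(norm (jet (?\<eta> k) - jet \<phi>))\<^sup>2 = (LINT z|lebesgue_on Q. (cutoff T k (snd z) - 1)\<^sup>2 * (norm (?j z))\<^sup>2)" for k
    proof -
      have e: "jet (?\<eta> k) - jet \<phi> = jet (\<lambda>z. ?\<eta> k z - \<phi> z)" by (rule jet_diff[OF \<eta>(1) \<phi>, symmetric])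
      have d: "(\<lambda>z. ?\<eta> k z - \<phi> z) \<in> C1_compact (\<Omega> \<times> UNIV)" by (rule C1_compact_diff(1)[OF \<eta>(1) \<phi>])
      have f: "(?\<eta> k z - \<phi> z, space_grad (\<lambda>z. ?\<eta> k z - \<phi> z) z) = (cutoff T k (snd z) - 1) *\<^sub>R ?j z" for z
        by (simp add: space_grad_diff[OF \<eta>(1) \<phi>] \<eta>(2) scaleR_diff_left left_diff_distrib)
      show ?thesis
        unfolding e unfolding jet_def norm_cls[OF Q_sets jet_L2[OF d]] L2_power2_norm
        unfolding f L2_inner_def power2_norm_eq_inner[symmetric] norm_scaleR power_mult_distrib power2_abs ..
    qed
    have "(\<lambda>k. LINT z|lebesgue_on Q. (cutoff T k (snd z) - 1)\<^sup>2 * (norm (?j z))\<^sup>2) \<longlonglongrightarrow> (LINT z|lebesgue_on Q. 0)"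
    proof (rule integral_dominated_convergence[OF _ _ i])
      have [measurable]: "(\<lambda>z. (norm (?j z))\<^sup>2) \<in> borel_measurable (lebesgue_on Q)" using i by (rule borel_measurable_integrable)
      have [measurable]: "(\<lambda>z. cutoff T k (snd z)) \<in> borel_measurable (lebesgue_on Q)" for k
      proof (intro continuous_measurable_lebesgue_on)
        have "continuous_on UNIV (cutoff T k)"
          by (rule cutoff_C1[of T k]) (meson DERIV_isCont continuous_at_imp_continuous_on)
        then show "continuous_on UNIV (\<lambda>z :: 'a \<times> real. cutoff T k (snd z))"
          by (rule continuous_on_compose2) (auto intro: continuous_intros)
      qed
      show "(\<lambda>z. (cutoff T k (snd z) - 1)\<^sup>2 * (norm (?j z))\<^sup>2) \<in> borel_measurable (lebesgue_on Q)" for k by measurable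
      show "AE z in lebesgue_on Q. norm ((cutoff T k (snd z) - 1)\<^sup>2 * (norm (?j z))\<^sup>2) \<le> (norm (?j z))\<^sup>2" for k
      proof (intro AE_I2)
        fix z :: "'a \<times> real"
        have "(cutoff T k (snd z) - 1)\<^sup>2 \<le> 1" using cutoff_bounds[of T k "snd z"] by (auto simp: abs_square_le_1)
        then have "(cutoff T k (snd z) - 1)\<^sup>2 * (norm (?j z))\<^sup>2 \<le> 1 * (norm (?j z))\<^sup>2" by (intro mult_right_mono) auto
        then show "norm ((cutoff T k (snd z) - 1)\<^sup>2 * (norm (?j z))\<^sup>2) \<le> (norm (?j z))\<^sup>2"
          by (simp only: real_norm_def abs_mult abs_power2 power2_abs abs_norm_cancel mult_1_left)
      qed
      show "AE z in lebesgue_on Q. (\<lambda>k. (cutoff T k (snd z) - 1)\<^sup>2 * (norm (?j z))\<^sup>2) \<longlonglongrightarrow> 0"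
      proof (intro AE_I2)
        fix z assume "z \<in> space (lebesgue_on Q)"
        then have z: "0 < snd z" "snd z < T" by auto
        have "(\<lambda>k. (cutoff T k (snd z) - 1)\<^sup>2 * (norm (?j z))\<^sup>2) \<longlonglongrightarrow> (1 - 1)\<^sup>2 * (norm (?j z))\<^sup>2"
          by (intro tendsto_intros cutoff_tendsto z)
        then show "(\<lambda>k. (cutoff T k (snd z) - 1)\<^sup>2 * (norm (?j z))\<^sup>2) \<longlonglongrightarrow> 0" by (simp only: diff_self power_zero_numeral mult_zero_left)
      qed
    qed simp
    then have "(\<lambda>k. (norm (jet (?\<eta> k) - jet \<phi>))\<^sup>2) \<longlonglongrightarrow> 0" by (simp add: n)
    then have "(\<lambda>k. sqrt ((norm (jet (?\<eta> k) - jet \<phi>))\<^sup>2)) \<longlonglongrightarrow> sqrt 0" by (rule tendsto_real_sqrt)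
    then have "(\<lambda>k. norm (jet (?\<eta> k) - jet \<phi>)) \<longlonglongrightarrow> 0" by simp
    then show ?thesis by (rule LIM_zero_cancel[OF tendsto_norm_zero_cancel])
  qed
  ultimately show ?thesis unfolding closure_sequential by (intro exI[of _ "\<lambda>k. jet (?\<eta> k)"]) auto
qed

text \<open>Approximants supported inside \<open>Q\<close> keep a distance from both ends of the
  time interval; this is what makes shifts in either direction admissible in the duality
  argument.\<close>

lemma energy_eq_closure_interior_jets: "energy = closure (jet ` C1_compact Q)"
proof
  have "jet ` C1_compact (\<Omega> \<times> UNIV) \<subseteq> closure (jet ` C1_compact Q)"
    using jet_in_closure_interior_jets by auto
  then show "energy \<subseteq> closure (jet ` C1_compact Q)" unfolding energy_def by (simp add: closure_minimal)
  show "closure (jet ` C1_compact Q) \<subseteq> energy"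
    using jet_in_energy closed_energy by (intro closure_minimal) auto
qed

end

section \<open>Duality of the state and the adjoint equation\<close>

context parabolic_problem
begin

section \<open>Translations in time\<close>

abbreviation shift :: "real \<Rightarrow> ('a \<times> real \<Rightarrow> real) \<Rightarrow> 'a \<times> real \<Rightarrow> real" where
  "shift s \<phi> \<equiv> (\<lambda>z. \<phi> (z + s *\<^sub>R (0, 1)))"

lemma shift_0: "shift 0 \<phi> = \<phi>"
  by (simp flip: zero_prod_def)

text \<open>For \<open>s \<ge> 0\<close> the support moves to earlier times and stays below T; for
  \<open>s \<le> 0\<close> it moves to later times and stays above 0. Each direction suits one of
  the two equations.\<close>

lemma C1_compact_shift:
  assumes "\<phi> \<in> C1_compact Q"
  shows "shift s \<phi> \<in> C1_compact (\<Omega> \<times> UNIV)"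
    and "0 \<le> s \<Longrightarrow> shift s \<phi> \<in> tests (- 1)" and "s \<le> 0 \<Longrightarrow> shift s \<phi> \<in> tests 1"
  unfolding tests_def by (auto intro!: C1_compact_translate_subset[OF assms])

lemma jet_shift:
  assumes "\<phi> \<in> C1_compact Q"
  shows "jet (shift s \<phi>) = cls Q (\<lambda>z. (\<phi> (z + s *\<^sub>R (0, 1)), space_grad \<phi> (z + s *\<^sub>R (0, 1))))"
  unfolding jet_def space_grad_translate[OF assms] ..

lemma jet_vanishing:
  assumes "\<phi> \<in> C1_compact Q" "z \<notin> Q"
  shows "(\<phi> z, space_grad \<phi> z) = 0"
proof -
  obtain K where "K \<subseteq> Q" "\<And>z. z \<notin> K \<Longrightarrow> \<phi> z = 0" "\<And>z h. z \<notin> K \<Longrightarrow> frechet_derivative \<phi> (at z) h = 0"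
    using C1_compact_support[OF assms(1)] by metis
  then have "\<phi> z = 0" "\<And>h. frechet_derivative \<phi> (at z) h = 0" using assms(2) by blast+
  then show ?thesis by (simp add: space_grad_def zero_prod_def)
qed

text \<open>Over the whole space the norm is translation invariant. Only an inequality remains
  because the shifted support may leave \<open>Q\<close>, while the original one lies
  inside.\<close>

lemma norm_jet_shift_le:
  assumes \<phi>: "\<phi> \<in> C1_compact Q"
  shows "norm (jet (shift s \<phi>)) \<le> norm (jet \<phi>)"
proof -
  let ?j = "\<lambda>z. (\<phi> z, space_grad \<phi> z)"
  have c: "compactly_supported ?j" by (rule jet_compactly_supported[OF \<phi>])
  have L: "(\<lambda>z. ?j (z + s *\<^sub>R (0, 1))) \<in> L2 A" if "A \<in> sets lebesgue" for A
    by (intro compactly_supported_L2 compactly_supported_translate[OF c] that)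
  have "norm (jet (shift s \<phi>)) = L2_norm Q (\<lambda>z. ?j (z + s *\<^sub>R (0, 1)))"
    unfolding jet_shift[OF \<phi>] by (rule norm_cls[OF Q_sets L[OF Q_sets]])
  also have "\<dots> \<le> L2_norm UNIV (\<lambda>z. ?j (z + s *\<^sub>R (0, 1)))"
    by (rule L2_norm_subset[OF Q_sets L]) simp
  also have "\<dots> = L2_norm UNIV ?j" using c by (intro L2_norm_translate) (simp add: compactly_supported_def)
  also have "\<dots> = L2_norm Q ?j"
  proof -
    have "L2_inner Q ?j ?j = L2_inner UNIV ?j ?j"
      by (rule L2_inner_vanishing[OF Q_sets]) (rule jet_vanishing[OF \<phi>])
    then show ?thesis by (simp only: L2_norm_def)
  qed
  also have "\<dots> = norm (jet \<phi>)" unfolding jet_def by (rule norm_cls[OF Q_sets jet_L2[OF \<phi>], symmetric])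
  finally show ?thesis .
qed

lemma norm_src: "f \<in> L2 Q \<Longrightarrow> norm (src f) = L2_norm Q f"
  unfolding src_def norm_cls[OF Q_sets L2_src] by (simp add: L2_norm_def L2_inner_def)

lemma norm_src_le_jet:
  assumes "\<phi> \<in> C1_compact U" shows "norm (src \<phi>) \<le> norm (jet \<phi>)"
proof -
  have \<phi>: "\<phi> \<in> L2 Q" by (rule L2_C1_compact(1)[OF assms])
  show ?thesis
    unfolding src_def jet_def norm_cls[OF Q_sets L2_src[OF \<phi>]] norm_cls[OF Q_sets jet_L2[OF assms]]
    by (intro L2_norm_mono L2_src \<phi> jet_L2[OF assms] AE_I2) (simp add: norm_Pair)
qed

lemma norm_src_shift_diff_le:
  assumes "\<phi> \<in> C1_compact Q" shows "norm (src (shift s \<phi>) - src \<phi>) \<le> 2 * norm (jet \<phi>)"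
  using norm_triangle_ineq4[of "src (shift s \<phi>)" "src \<phi>"] norm_src_le_jet[OF C1_compact_shift(1)[OF assms, of s]]
    norm_src_le_jet[OF assms] norm_jet_shift_le[OF assms, of s] by linarith

lemma jet_shift_tendsto:
  assumes \<phi>: "\<phi> \<in> C1_compact Q"
  shows "((\<lambda>s. norm (jet (shift s \<phi>) - jet \<phi>)) \<longlongrightarrow> 0) (at 0)"
proof -
  let ?j = "\<lambda>z. (\<phi> z, space_grad \<phi> z)"
  have c: "compactly_supported ?j" by (rule jet_compactly_supported[OF \<phi>])
  have L: "(\<lambda>z. ?j (z + s *\<^sub>R (0, 1))) \<in> L2 Q" for s
    by (intro compactly_supported_L2 compactly_supported_translate[OF c] Q_sets)
  have "norm (jet (shift s \<phi>) - jet \<phi>) = L2_norm Q (\<lambda>z. ?j (z + s *\<^sub>R (0, 1)) - ?j z)" for s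
    unfolding jet_shift[OF \<phi>] unfolding jet_def cls_diff[OF Q_sets L jet_L2[OF \<phi>], symmetric]
    by (rule norm_cls[OF Q_sets L2_diff[OF L jet_L2[OF \<phi>]]])
  then show ?thesis using L2_norm_translate_diff_tendsto[OF c Q_sets, of "(0, 1)"] by simp
qed

lemma energy_approx:
  assumes "w \<in> energy" "0 < \<delta>"
  obtains \<phi> where "\<phi> \<in> C1_compact Q" "norm (jet \<phi> - w) < \<delta>"
proof -
  have "\<forall>e>0. \<exists>x\<in>jet ` C1_compact Q. dist x w < e"
    using assms(1) unfolding energy_eq_closure_interior_jets closure_approachable .
  then obtain x where "x \<in> jet ` C1_compact Q" "dist x w < \<delta>" using assms(2) by blast
  then show thesis using that by (auto simp: dist_norm)
qed

text \<open>The radius depends on \<open>w\<close> and \<epsilon> but not on \<phi>, which matters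
  because later \<phi> is chosen after the size of the shift. Uniformity comes from comparison with
  one fixed test, since shifting does not increase norms.\<close>

lemma jet_shift_uniform:
  assumes w: "w \<in> energy" and "0 < \<epsilon>"
  obtains r where "0 < r" "\<And>\<phi> s. \<phi> \<in> C1_compact Q \<Longrightarrow> norm (jet \<phi> - w) \<le> r \<Longrightarrow> \<bar>s\<bar> \<le> r \<Longrightarrow> norm (jet (shift s \<phi>) - w) \<le> \<epsilon>"
proof -
  have "0 < \<epsilon> / 4" using \<open>0 < \<epsilon>\<close> by simp
  then obtain \<phi>0 where \<phi>0: "\<phi>0 \<in> C1_compact Q" "norm (jet \<phi>0 - w) < \<epsilon> / 4"
    by (rule energy_approx[OF w])
  have "\<forall>\<^sub>F s in at 0. norm (jet (shift s \<phi>0) - jet \<phi>0) < \<epsilon> / 4"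
    using jet_shift_tendsto[OF \<phi>0(1)] \<open>0 < \<epsilon>\<close> by (intro order_tendstoD) auto
  then obtain d where d: "0 < d" "\<And>s. s \<noteq> 0 \<Longrightarrow> \<bar>s\<bar> < d \<Longrightarrow> norm (jet (shift s \<phi>0) - jet \<phi>0) < \<epsilon> / 4"
    unfolding eventually_at by (auto simp: dist_real_def)
  show thesis
  proof (rule that[of "min (d / 2) (\<epsilon> / 4)"])
    show "0 < min (d / 2) (\<epsilon> / 4)" using d \<open>0 < \<epsilon>\<close> by simp
    fix \<phi> s assume \<phi>: "\<phi> \<in> C1_compact Q" and le: "norm (jet \<phi> - w) \<le> min (d / 2) (\<epsilon> / 4)" and s: "\<bar>s\<bar> \<le> min (d / 2) (\<epsilon> / 4)"
    have "norm (jet (shift s \<phi>0) - jet \<phi>0) \<le> \<epsilon> / 4"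
    proof (cases "s = 0")
      case True
      then show ?thesis using \<open>0 < \<epsilon>\<close> by (simp only: shift_0) simp
    next
      case False
      then show ?thesis using d(2)[OF False] d(1) s by linarith
    qed
    moreover have "norm (jet (shift s \<phi>) - jet (shift s \<phi>0)) \<le> norm (jet \<phi> - jet \<phi>0)"
      using norm_jet_shift_le[OF C1_compact_diff(1)[OF \<phi> \<phi>0(1)], of s]
      unfolding jet_diff[OF \<phi> \<phi>0(1)] jet_diff[OF C1_compact_shift(1)[OF \<phi>] C1_compact_shift(1)[OF \<phi>0(1)]] .
    moreover have "norm (jet \<phi> - jet \<phi>0) \<le> norm (jet \<phi> - w) + norm (jet \<phi>0 - w)"
      using norm_triangle_ineq4[of "jet \<phi> - w" "jet \<phi>0 - w"] by simp
    moreover have "norm (jet (shift s \<phi>) - w) \<le> norm (jet (shift s \<phi>) - jet (shift s \<phi>0))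
        + norm (jet (shift s \<phi>0) - jet \<phi>0) + norm (jet \<phi>0 - w)"
      using norm_triangle_ineq[of "jet (shift s \<phi>) - jet (shift s \<phi>0)" "(jet (shift s \<phi>0) - jet \<phi>0) + (jet \<phi>0 - w)"]
        norm_triangle_ineq[of "jet (shift s \<phi>0) - jet \<phi>0" "jet \<phi>0 - w"] by simp
    ultimately show "norm (jet (shift s \<phi>) - w) \<le> \<epsilon>" using le \<phi>0(2) by linarith
  qed
qed

lemma inner_src:
  assumes "u \<in> L2 Q" "g \<in> L2 Q" "f \<in> L2 Q"
  shows "cls Q (\<lambda>z. (u z, g z)) \<bullet> src f = L2_inner Q u f"
  unfolding src_def inner_cls[OF Q_sets L2_norm_Pair(1)[OF assms(1,2)] L2_src[OF assms(3)]]
  by (simp add: L2_inner_def)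

lemma inner_src_shift_has_derivative:
  assumes w: "w \<in> energy" and \<phi>: "\<phi> \<in> C1_compact Q"
  shows "((\<lambda>s. w \<bullet> src (shift s \<phi>)) has_real_derivative w \<bullet> src (time_deriv (shift s \<phi>))) (at s)"
proof -
  obtain u g where ug: "u \<in> L2 Q" "g \<in> L2 Q" "w = cls Q (\<lambda>z. (u z, g z))" by (rule energy_cases[OF w])
  have t: "time_deriv (shift s \<phi>) = (\<lambda>z. frechet_derivative \<phi> (at (z + s *\<^sub>R (0, 1))) (0, 1))"
    unfolding time_deriv_def C1_compact_translate(2)[OF \<phi>] ..
  have "w \<bullet> src (shift s \<phi>) = L2_inner Q u (shift s \<phi>)" for s
    unfolding ug(3) by (rule inner_src[OF ug(1,2) L2_C1_compact(1)[OF C1_compact_shift(1)[OF \<phi>]]])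
  moreover have "w \<bullet> src (time_deriv (shift s \<phi>)) = L2_inner Q u (time_deriv (shift s \<phi>))"
    unfolding ug(3) by (rule inner_src[OF ug(1,2) L2_C1_compact(2)[OF C1_compact_shift(1)[OF \<phi>]]])
  ultimately show ?thesis
    using L2_inner_translate_has_derivative[OF ug(1) \<phi> Q_sets, of "(0, 1)" s] by (simp only: t)
qed

text \<open>Both tests vanish off \<open>Q\<close>, so the integrals extend to the whole space,
  where shifting one factor forward amounts to shifting the other backward.\<close>

lemma inner_jet_src_shift:
  assumes \<phi>: "\<phi> \<in> C1_compact Q" and \<psi>: "\<psi> \<in> C1_compact Q"
  shows "jet \<psi> \<bullet> src (shift s \<phi>) = jet \<phi> \<bullet> src (shift (- s) \<psi>)"
proof -
  have c: "continuous_on UNIV \<phi>" "continuous_on UNIV \<psi>" "continuous_on UNIV (shift (- s) \<psi>)"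
    using C1_compact_continuous \<phi> \<psi> C1_compact_shift(1)[OF \<psi>] by blast+
  have v: "\<phi> z = 0" "\<psi> z = 0" if "z \<notin> Q" for z
    using jet_vanishing[OF \<phi> that] jet_vanishing[OF \<psi> that] by (auto simp: zero_prod_def)
  have "jet \<psi> \<bullet> src (shift s \<phi>) = L2_inner Q \<psi> (shift s \<phi>)"
    unfolding jet_def by (rule inner_src; rule L2_C1_compact[OF \<psi>] L2_C1_compact[OF C1_compact_shift(1)[OF \<phi>]])
  also have "\<dots> = L2_inner UNIV \<psi> (shift s \<phi>)" by (rule L2_inner_vanishing[OF Q_sets v(2)])
  also have "\<dots> = L2_inner UNIV (\<lambda>z. shift (- s) \<psi> (z + s *\<^sub>R (0, 1))) (\<lambda>z. \<phi> (z + s *\<^sub>R (0, 1)))"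
    by (simp add: add.assoc flip: zero_prod_def)
  also have "\<dots> = L2_inner UNIV (shift (- s) \<psi>) \<phi>" by (rule L2_inner_translate[OF c(3,1)])
  also have "\<dots> = L2_inner UNIV \<phi> (shift (- s) \<psi>)" by (rule L2_inner_commute)
  also have "\<dots> = L2_inner Q \<phi> (shift (- s) \<psi>)" by (rule L2_inner_vanishing[OF Q_sets v(1), symmetric])
  also have "\<dots> = jet \<phi> \<bullet> src (shift (- s) \<psi>)"
    unfolding jet_def by (rule inner_src[symmetric]; rule L2_C1_compact[OF \<phi>] L2_C1_compact[OF C1_compact_shift(1)[OF \<psi>]])
  finally show ?thesis .
qed

text \<open>
  Formally \<open>y\<^sub>t = F\<close> and \<open>- w\<^sub>t = G\<close> with \<open>y(0) = 0\<close> and \<open>w(T) = 0\<close>, so the claim is the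
  integral of \<open>(y w)\<^sub>t\<close>. Neither function can be inserted as a test into the equation of the
  other; instead, tests \<open>\<phi> \<approx> w\<close> and \<open>\<psi> \<approx> y\<close> are translated in time, which turns the
  equations into difference quotients, and the two quotients agree by translation invariance.
\<close>

lemma integration_by_parts:
  assumes y: "y \<in> energy" and w: "w \<in> energy"
    and yF: "\<And>\<phi>. \<phi> \<in> tests (- 1) \<Longrightarrow> y \<bullet> src (time_deriv \<phi>) = - (F \<bullet> jet \<phi>)"
    and wG: "\<And>\<phi>. \<phi> \<in> tests 1 \<Longrightarrow> w \<bullet> src (time_deriv \<phi>) = G \<bullet> jet \<phi>"
  shows "F \<bullet> w = G \<bullet> y"
proof -
  have "\<bar>F \<bullet> w - G \<bullet> y\<bar> \<le> (norm F + norm G + 1) * \<epsilon>" if \<epsilon>: "0 < \<epsilon>" for \<epsilon>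
  proof -
    obtain r1 where r1: "0 < r1" "\<And>\<phi> s. \<phi> \<in> C1_compact Q \<Longrightarrow> norm (jet \<phi> - w) \<le> r1 \<Longrightarrow> \<bar>s\<bar> \<le> r1 \<Longrightarrow> norm (jet (shift s \<phi>) - w) \<le> \<epsilon>"
      using jet_shift_uniform[OF w \<epsilon>] by metis
    obtain r2 where r2: "0 < r2" "\<And>\<phi> s. \<phi> \<in> C1_compact Q \<Longrightarrow> norm (jet \<phi> - y) \<le> r2 \<Longrightarrow> \<bar>s\<bar> \<le> r2 \<Longrightarrow> norm (jet (shift s \<phi>) - y) \<le> \<epsilon>"
      using jet_shift_uniform[OF y \<epsilon>] by metis
    define s where "s = min r1 r2"
    define N where "N = norm w + norm y + 2"
    \<comment> \<open>The tests are taken \<delta>-close only after \<open>s\<close> is fixed.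
      \<open>N\<close> bounds the sum of their norms, so replacing \<open>w\<close> and
      \<open>y\<close> by tests changes the increments by at most \<open>2 * N * \<delta>\<close>;
      these are finally divided by \<open>s\<close>, hence the demand
      \<open>2 * N * \<delta> \<le> s * \<epsilon>\<close>.\<close>
    define \<delta> where "\<delta> = min (min s 1) (s * \<epsilon> / (2 * N))"
    have s: "0 < s" "s \<le> r1" "s \<le> r2" using r1 r2 by (auto simp: s_def)
    have N: "0 < N" by (simp add: N_def add_nonneg_pos)
    have \<delta>: "0 < \<delta>" "\<delta> \<le> s" "\<delta> \<le> 1" "2 * N * \<delta> \<le> s * \<epsilon>"
    proof -
      show "0 < \<delta>" "\<delta> \<le> s" "\<delta> \<le> 1" using s N \<epsilon> by (auto simp: \<delta>_def)
      have "\<delta> \<le> s * \<epsilon> / (2 * N)" by (simp add: \<delta>_def)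
      then show "2 * N * \<delta> \<le> s * \<epsilon>" using N by (simp add: field_simps)
    qed
    obtain \<phi> where \<phi>: "\<phi> \<in> C1_compact Q" "norm (jet \<phi> - w) < \<delta>"
      by (rule energy_approx[OF w \<delta>(1)])
    obtain \<psi> where \<psi>: "\<psi> \<in> C1_compact Q" "norm (jet \<psi> - y) < \<delta>"
      by (rule energy_approx[OF y \<delta>(1)])
    let ?m = "\<lambda>s. y \<bullet> src (shift s \<phi>)" and ?n = "\<lambda>s. w \<bullet> src (shift s \<psi>)"
    \<comment> \<open>The mean value theorem reduces the increment to a single shift, at which the
      weak equation of \<open>y\<close> is applied; positivity of \<xi> makes the shifted \<phi> an
      admissible test for it.\<close>
    obtain \<xi> where \<xi>: "0 < \<xi>" "\<xi> < s" "?m s - ?m 0 = (s - 0) * (y \<bullet> src (time_deriv (shift \<xi> \<phi>)))"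
      using MVT2[OF s(1), of ?m "\<lambda>s. y \<bullet> src (time_deriv (shift s \<phi>))"] inner_src_shift_has_derivative[OF y \<phi>(1)] by blast
    have m: "\<bar>?m s - ?m 0 + s * (F \<bullet> w)\<bar> \<le> s * (norm F * \<epsilon>)"
    proof -
      have "?m s - ?m 0 + s * (F \<bullet> w) = - s * (F \<bullet> (jet (shift \<xi> \<phi>) - w))"
        using \<xi> yF[OF C1_compact_shift(2)[OF \<phi>(1)], of \<xi>] by (simp add: inner_diff_right algebra_simps)
      moreover have "\<bar>F \<bullet> (jet (shift \<xi> \<phi>) - w)\<bar> \<le> norm F * \<epsilon>"
      proof (rule order_trans[OF Cauchy_Schwarz_ineq2])
        have "norm (jet (shift \<xi> \<phi>) - w) \<le> \<epsilon>"
          using \<xi>(1,2) s \<phi>(2) \<delta>(2) by (intro r1(2)[OF \<phi>(1)]) auto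
        then show "norm F * norm (jet (shift \<xi> \<phi>) - w) \<le> norm F * \<epsilon>" by (intro mult_left_mono) auto
      qed
      ultimately show ?thesis using s(1) by (simp add: abs_mult)
    qed
    \<comment> \<open>The equation of \<open>w\<close> admits backward shifts, so the second
      increment runs over [-s, 0].\<close>
    have "- s < 0" using s by simp
    then obtain \<zeta> where \<zeta>: "- s < \<zeta>" "\<zeta> < 0" "?n 0 - ?n (- s) = (0 - (- s)) * (w \<bullet> src (time_deriv (shift \<zeta> \<psi>)))"
      using MVT2[of "- s" 0 ?n "\<lambda>s. w \<bullet> src (time_deriv (shift s \<psi>))"] inner_src_shift_has_derivative[OF w \<psi>(1)] by blast
    have n: "\<bar>?n (- s) - ?n 0 + s * (G \<bullet> y)\<bar> \<le> s * (norm G * \<epsilon>)"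
    proof -
      have "?n (- s) - ?n 0 + s * (G \<bullet> y) = - s * (G \<bullet> (jet (shift \<zeta> \<psi>) - y))"
        using \<zeta> wG[OF C1_compact_shift(3)[OF \<psi>(1)], of \<zeta>] by (simp add: inner_diff_right algebra_simps)
      moreover have "\<bar>G \<bullet> (jet (shift \<zeta> \<psi>) - y)\<bar> \<le> norm G * \<epsilon>"
      proof (rule order_trans[OF Cauchy_Schwarz_ineq2])
        have "norm (jet (shift \<zeta> \<psi>) - y) \<le> \<epsilon>"
          using \<zeta>(1,2) s \<psi>(2) \<delta>(2) by (intro r2(2)[OF \<psi>(1)]) auto
        then show "norm G * norm (jet (shift \<zeta> \<psi>) - y) \<le> norm G * \<epsilon>" by (intro mult_left_mono) auto
      qed
      ultimately show ?thesis using s(1) by (simp add: abs_mult)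
    qed
    have "\<bar>(?m s - ?m 0) - (?n (- s) - ?n 0)\<bar> \<le> 2 * N * \<delta>"
    proof -
      let ?d = "src (shift s \<phi>) - src (shift 0 \<phi>)" and ?e = "src (shift (- s) \<psi>) - src (shift 0 \<psi>)"
      \<comment> \<open>Between the tests themselves the two increments agree exactly, so only the
        errors of approximating \<open>w\<close> and \<open>y\<close> survive.\<close>
      have "jet \<psi> \<bullet> ?d = jet \<phi> \<bullet> ?e"
        using inner_jet_src_shift[OF \<phi>(1) \<psi>(1), of s] inner_jet_src_shift[OF \<phi>(1) \<psi>(1), of 0]
        by (simp add: inner_diff_right)
      then have eq: "(?m s - ?m 0) - (?n (- s) - ?n 0) = (jet \<phi> - w) \<bullet> ?e - (jet \<psi> - y) \<bullet> ?d"
        by (simp only: inner_diff_left inner_diff_right)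
      have de: "norm ?d \<le> 2 * norm (jet \<phi>)" "norm ?e \<le> 2 * norm (jet \<psi>)"
        unfolding shift_0 by (rule norm_src_shift_diff_le[OF \<phi>(1)], rule norm_src_shift_diff_le[OF \<psi>(1)])
      have j: "norm (jet \<phi>) \<le> norm w + 1" "norm (jet \<psi>) \<le> norm y + 1"
        using \<phi>(2) \<psi>(2) \<delta>(3) norm_triangle_sub[of "jet \<phi>" w] norm_triangle_sub[of "jet \<psi>" y] by linarith+
      have de': "norm ?d \<le> 2 * (norm w + 1)" "norm ?e \<le> 2 * (norm y + 1)"
        by (rule order_trans[OF de(1)], use j in simp, rule order_trans[OF de(2)], use j in simp)
      have "\<bar>(jet \<phi> - w) \<bullet> ?e\<bar> \<le> norm (jet \<phi> - w) * norm ?e" by (rule Cauchy_Schwarz_ineq2)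
      also have "\<dots> \<le> \<delta> * (2 * (norm y + 1))"
        using \<phi>(2) \<delta>(1) by (intro mult_mono de') simp_all
      finally have 1: "\<bar>(jet \<phi> - w) \<bullet> ?e\<bar> \<le> \<delta> * (2 * (norm y + 1))" .
      have "\<bar>(jet \<psi> - y) \<bullet> ?d\<bar> \<le> norm (jet \<psi> - y) * norm ?d" by (rule Cauchy_Schwarz_ineq2)
      also have "\<dots> \<le> \<delta> * (2 * (norm w + 1))"
        using \<psi>(2) \<delta>(1) by (intro mult_mono de') simp_all
      finally have 2: "\<bar>(jet \<psi> - y) \<bullet> ?d\<bar> \<le> \<delta> * (2 * (norm w + 1))" .
      have "2 * N * \<delta> = \<delta> * (2 * (norm y + 1)) + \<delta> * (2 * (norm w + 1))" by (simp add: N_def algebra_simps)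
      with 1 2 show ?thesis unfolding eq by linarith
    qed
    with m n \<delta>(4) have "\<bar>s * (F \<bullet> w) - s * (G \<bullet> y)\<bar> \<le> s * (norm F * \<epsilon>) + s * (norm G * \<epsilon>) + s * \<epsilon>" by linarith
    moreover have "\<bar>s * (F \<bullet> w) - s * (G \<bullet> y)\<bar> = s * \<bar>F \<bullet> w - G \<bullet> y\<bar>"
      unfolding right_diff_distrib[symmetric] abs_mult using s(1) by simp
    moreover have "s * (norm F * \<epsilon>) + s * (norm G * \<epsilon>) + s * \<epsilon> = s * ((norm F + norm G + 1) * \<epsilon>)"
      by (simp add: distrib_left distrib_right)
    ultimately have "s * \<bar>F \<bullet> w - G \<bullet> y\<bar> \<le> s * ((norm F + norm G + 1) * \<epsilon>)" by linarith
    then show ?thesis using s(1) by (rule mult_left_le_imp_le)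
  qed
  note bound = this
  have C: "0 < norm F + norm G + 1" by (simp add: add_nonneg_pos)
  have "\<bar>F \<bullet> w - G \<bullet> y\<bar> \<le> 0"
  proof (rule field_le_epsilon)
    fix e :: real assume "0 < e"
    then show "\<bar>F \<bullet> w - G \<bullet> y\<bar> \<le> 0 + e" using bound[of "e / (norm F + norm G + 1)"] C by simp
  qed
  then show ?thesis by simp
qed

text \<open>Diffusion and zeroth-order term form a symmetric operator \<open>K\<close>. Moved to the
  right-hand sides, they leave two equations with a time derivative only, to which
  \<open>integration_by_parts\<close> applies; by symmetry the contributions of \<open>K\<close>
  then cancel.\<close>

lemma duality:
  assumes p: "p \<in> L2 Q" "g \<in> L2 Q" "weak 1 q (cls Q (\<lambda>z. (p z, g z)))"
    and u: "u \<in> L2 Q" "h \<in> L2 Q" "weak (- 1) f (cls Q (\<lambda>z. (u z, h z)))"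
    and q: "q \<in> L2 Q" and f: "f \<in> L2 Q"
  shows "L2_inner Q p f = L2_inner Q u q"
proof -
  let ?w = "cls Q (\<lambda>z. (p z, g z))" and ?y = "cls Q (\<lambda>z. (u z, h z))"
  define K where "K = (\<lambda>u (h :: 'a \<times> real \<Rightarrow> 'a). cls Q (\<lambda>z. (a0 z * u z, \<nu> *\<^sub>R h z)))"
  have K: "(\<lambda>z. (a0 z * u z, \<nu> *\<^sub>R h z)) \<in> L2 Q" if "u \<in> L2 Q" "h \<in> L2 Q" for u h
    by (intro L2_norm_Pair(1) L2_a0_mult L2_scaleR that)
  have split: "cls Q (\<lambda>z. (u z, h z)) \<bullet> parabolic \<sigma> \<phi> = \<sigma> * (cls Q (\<lambda>z. (u z, h z)) \<bullet> src (time_deriv \<phi>)) + K u h \<bullet> jet \<phi>"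
    if "u \<in> L2 Q" "h \<in> L2 Q" "\<phi> \<in> C1_compact U" for u h \<phi> \<sigma> U
  proof -
    note t = L2_C1_compact(2)[OF that(3)]
    have "K u h \<bullet> jet \<phi> = L2_inner Q (\<lambda>z. (a0 z * u z, \<nu> *\<^sub>R h z)) (\<lambda>z. (\<phi> z, space_grad \<phi> z))"
      unfolding K_def jet_def by (rule inner_cls[OF Q_sets K[OF that(1,2)] jet_L2[OF that(3)]])
    moreover have "cls Q (\<lambda>z. (u z, h z)) \<bullet> parabolic \<sigma> \<phi>
        = L2_inner Q (\<lambda>z. (u z, h z)) (\<lambda>z. (\<sigma> * time_deriv \<phi> z + a0 z * \<phi> z, \<nu> *\<^sub>R space_grad \<phi> z))"
      unfolding parabolic_def by (rule inner_cls[OF Q_sets L2_norm_Pair(1)[OF that(1,2)] parabolic_L2[OF that(3)]])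
    moreover have "\<dots> = (LINT z|lebesgue_on Q. \<sigma> * (u z \<bullet> time_deriv \<phi> z) + (a0 z * u z, \<nu> *\<^sub>R h z) \<bullet> (\<phi> z, space_grad \<phi> z))"
      unfolding L2_inner_def by (intro Bochner_Integration.integral_cong) (auto simp: algebra_simps)
    moreover have "\<dots> = \<sigma> * L2_inner Q u (time_deriv \<phi>) + L2_inner Q (\<lambda>z. (a0 z * u z, \<nu> *\<^sub>R h z)) (\<lambda>z. (\<phi> z, space_grad \<phi> z))"
      unfolding L2_inner_def
      using L2_inner_integrable[OF that(1) t] L2_inner_integrable[OF K[OF that(1,2)] jet_L2[OF that(3)]]
      by (subst Bochner_Integration.integral_add) auto
    ultimately show ?thesis unfolding inner_src[OF that(1,2) t] by simp
  qed
  have C1: "\<phi> \<in> C1_compact UNIV" if "\<phi> \<in> tests \<sigma>" for \<phi> \<sigma>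
    using that C1_compact_mono[of _ UNIV] by (auto simp: tests_def split: if_splits)
  have "(src f - K u h) \<bullet> ?w = (src q - K p g) \<bullet> ?y"
  proof (rule integration_by_parts)
    show "?y \<in> energy" "?w \<in> energy" using p(3) u(3) by (auto simp: weak_def)
    show "?y \<bullet> src (time_deriv \<phi>) = - ((src f - K u h) \<bullet> jet \<phi>)" if "\<phi> \<in> tests (- 1)" for \<phi>
    proof -
      have "?y \<bullet> parabolic (- 1) \<phi> = src f \<bullet> jet \<phi>" using u(3) that by (auto simp: weak_def)
      then show ?thesis using split[OF u(1,2) C1[OF that], of "- 1"] by (simp add: inner_diff_left)
    qed
    show "?w \<bullet> src (time_deriv \<phi>) = (src q - K p g) \<bullet> jet \<phi>" if "\<phi> \<in> tests 1" for \<phi>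
    proof -
      have "?w \<bullet> parabolic 1 \<phi> = src q \<bullet> jet \<phi>" using p(3) that by (auto simp: weak_def)
      then show ?thesis using split[OF p(1,2) C1[OF that], of 1] by (simp add: inner_diff_left)
    qed
  qed
  moreover have "K u h \<bullet> ?w = K p g \<bullet> ?y"
    unfolding K_def inner_cls[OF Q_sets K[OF p(1,2)] L2_norm_Pair(1)[OF u(1,2)]]
      inner_cls[OF Q_sets K[OF u(1,2)] L2_norm_Pair(1)[OF p(1,2)]] L2_inner_def
    by (intro Bochner_Integration.integral_cong) (auto simp: inner_commute algebra_simps)
  moreover have "src f \<bullet> ?w = L2_inner Q p f" "src q \<bullet> ?y = L2_inner Q u q"
    using inner_src[OF p(1,2) f] inner_src[OF u(1,2) q] by (simp_all add: inner_commute)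
  ultimately show ?thesis by (simp add: inner_diff_left)
qed

end

section \<open>Quadratic expansions and minimisers\<close>

lemma L2_norm_eq_0_iff:
  assumes "A \<in> sets lebesgue" "f \<in> L2 A"
  shows "L2_norm A f = 0 \<longleftrightarrow> (AE x in lebesgue_on A. f x = 0)"
  unfolding norm_cls[OF assms, symmetric] norm_eq_zero
  using cls_eq_iff[OF assms L2_zero] by (simp add: cls_zero)

lemma L2_inner_add_left:
  assumes "f \<in> L2 A" "g \<in> L2 A" "h \<in> L2 A"
  shows "L2_inner A (\<lambda>x. f x + g x) h = L2_inner A f h + L2_inner A g h"
  unfolding L2_inner_def inner_add_left
  by (intro Bochner_Integration.integral_add L2_inner_integrable assms)

lemma L2_inner_add_right:
  assumes "f \<in> L2 A" "g \<in> L2 A" "h \<in> L2 A"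
  shows "L2_inner A h (\<lambda>x. f x + g x) = L2_inner A h f + L2_inner A h g"
  unfolding L2_inner_def inner_add_right
  by (intro Bochner_Integration.integral_add L2_inner_integrable assms)

lemma L2_inner_diff_left:
  assumes "f \<in> L2 A" "g \<in> L2 A" "h \<in> L2 A"
  shows "L2_inner A (\<lambda>x. f x - g x) h = L2_inner A f h - L2_inner A g h"
  unfolding L2_inner_def inner_diff_left
  by (intro Bochner_Integration.integral_diff L2_inner_integrable assms)

lemma L2_inner_scaleR_right: "L2_inner A f (\<lambda>x. c *\<^sub>R g x) = c * L2_inner A f g"
  by (simp add: L2_inner_def)

text \<open>Both bounds together make the remainder quadratic, which gives the gradient. The upper
  bound along multiples of \<open>g\<close> shows that a minimizer has \<open>g = 0\<close>; the
  lower bound at \<open>g = 0\<close> is quadratic growth, hence minimality and uniqueness.\<close>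

lemma gradient_and_minimizer_of_expansion:
  fixes F :: "('c::euclidean_space \<Rightarrow> real) \<Rightarrow> real"
  assumes A: "A \<in> sets lebesgue" and q: "q \<in> L2 A" and g: "g \<in> L2 A"
    and lower: "\<And>h. h \<in> L2 A \<Longrightarrow> 1/2 * (L2_norm A h)\<^sup>2 \<le> F (\<lambda>x. q x + h x) - F q - L2_inner A g h"
    and upper: "\<And>h. h \<in> L2 A \<Longrightarrow> F (\<lambda>x. q x + h x) - F q - L2_inner A g h \<le> K * (L2_norm A h)\<^sup>2"
  shows "has_L2_gradient A F q g"
    and "unique_L2_minimizer A F q \<longleftrightarrow> (AE x in lebesgue_on A. g x = 0)"
proof -
  show "has_L2_gradient A F q g"
    unfolding has_L2_gradient_def
  proof (intro conjI g allI impI)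
    fix \<epsilon> :: real assume \<epsilon>: "0 < \<epsilon>"
    show "\<exists>\<delta>>0. \<forall>h\<in>L2 A. L2_norm A h \<le> \<delta> \<longrightarrow> \<bar>F (\<lambda>x. q x + h x) - F q - L2_inner A g h\<bar> \<le> \<epsilon> * L2_norm A h"
    \<comment> \<open>The added 1 keeps the denominator positive for every value of
      \<open>K\<close>.\<close>
    proof (intro exI[of _ "\<epsilon> / (\<bar>K\<bar> + 1)"] conjI ballI impI)
      show "0 < \<epsilon> / (\<bar>K\<bar> + 1)" using \<epsilon> by simp
      fix h :: "'c \<Rightarrow> real" assume h: "h \<in> L2 A" and le: "L2_norm A h \<le> \<epsilon> / (\<bar>K\<bar> + 1)"
      have n: "0 \<le> L2_norm A h" by (rule L2_norm_nonneg)
      have "(\<bar>K\<bar> + 1) * L2_norm A h \<le> \<epsilon>" using le by (simp add: field_simps)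
      then have "((\<bar>K\<bar> + 1) * L2_norm A h) * L2_norm A h \<le> \<epsilon> * L2_norm A h" using n by (rule mult_right_mono)
      moreover have "K * (L2_norm A h)\<^sup>2 \<le> (\<bar>K\<bar> + 1) * (L2_norm A h)\<^sup>2" by (intro mult_right_mono) auto
      ultimately have "K * (L2_norm A h)\<^sup>2 \<le> \<epsilon> * L2_norm A h" by (simp add: power2_eq_square mult.assoc)
      moreover have "0 \<le> 1/2 * (L2_norm A h)\<^sup>2" by simp
      ultimately show "\<bar>F (\<lambda>x. q x + h x) - F q - L2_inner A g h\<bar> \<le> \<epsilon> * L2_norm A h"
        using lower[OF h] upper[OF h] by linarith
    qed
  qed
  show "unique_L2_minimizer A F q \<longleftrightarrow> (AE x in lebesgue_on A. g x = 0)"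
  proof
    assume "unique_L2_minimizer A F q"
    then have min: "F q \<le> F r" if "r \<in> L2 A" for r
      using that by (simp add: unique_L2_minimizer_def L2_minimizer_def)
    have "0 \<le> t * L2_inner A g g + t\<^sup>2 * (K * L2_inner A g g)" for t
    proof -
      have h: "(\<lambda>x. t *\<^sub>R g x) \<in> L2 A" by (rule L2_scaleR[OF g])
      have "(L2_norm A (\<lambda>x. t *\<^sub>R g x))\<^sup>2 = t\<^sup>2 * L2_inner A g g"
        unfolding L2_power2_norm by (simp add: L2_inner_def power2_eq_square mult_ac)
      then show ?thesis
        using upper[OF h] min[OF L2_add[OF q h]] unfolding L2_inner_scaleR_right by (simp add: mult_ac)
    qed
    then have "L2_inner A g g = 0" by (rule quadratic_nonneg_imp_linear_zero)
    then show "AE x in lebesgue_on A. g x = 0"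
      using L2_norm_eq_0_iff[OF A g] by (simp add: L2_norm_def)
  next
    assume "AE x in lebesgue_on A. g x = 0"
    then have "L2_inner A g h = L2_inner A (\<lambda>x. 0) h" if "h \<in> L2 A" for h
      using that g by (intro L2_inner_cong_AE) (auto simp: L2_zero)
    then have grow: "1/2 * (L2_norm A (\<lambda>x. r x - q x))\<^sup>2 \<le> F r - F q" if "r \<in> L2 A" for r
      using lower[OF L2_diff[OF that q]] L2_diff[OF that q] by (simp add: L2_inner_def)
    have "F q \<le> F r" if "r \<in> L2 A" for r
      using grow[OF that] zero_le_power2[of "L2_norm A (\<lambda>x. r x - q x)"] by linarith
    moreover have "AE x in lebesgue_on A. r x = q x" if "L2_minimizer A F r" for r
    proof -
      have r: "r \<in> L2 A" "F r \<le> F q" using that q by (auto simp: L2_minimizer_def)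
      then have "(L2_norm A (\<lambda>x. r x - q x))\<^sup>2 \<le> 0" using grow[of r] by linarith
      then have "L2_norm A (\<lambda>x. r x - q x) = 0" by simp
      then show ?thesis using L2_norm_eq_0_iff[OF A L2_diff[OF r(1) q]] by simp
    qed
    ultimately show "unique_L2_minimizer A F q" using q by (auto simp: unique_L2_minimizer_def L2_minimizer_def)
  qed
qed

section \<open>The pointwise dual cost\<close>

definition clip :: "real \<Rightarrow> real \<Rightarrow> real \<Rightarrow> real \<Rightarrow> real" where
  "clip \<gamma> a b s = min b (max a (s / \<gamma>))"

text \<open>The Fenchel conjugate of v to \<gamma>/2 v^2 restricted to [a, b], written through its
  maximizer \<open>clip\<close>.\<close>

definition dual_cost :: "real \<Rightarrow> real \<Rightarrow> real \<Rightarrow> real \<Rightarrow> real" where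
  "dual_cost \<gamma> a b s = s * clip \<gamma> a b s - \<gamma> / 2 * (clip \<gamma> a b s)\<^sup>2"

text \<open>The gap factors as \<gamma> (c - v)(x - (c + v)/2) with c the clipped value of x =
  s/\<gamma>. If x lies outside [a, b], both factors have the same sign; if it lies inside, c = x
  and the product is half a square.\<close>

lemma dual_cost_ge:
  assumes "0 < \<gamma>" "a \<le> v" "v \<le> b"
  shows "s * v - \<gamma> / 2 * v\<^sup>2 \<le> dual_cost \<gamma> a b s"
proof -
  let ?c = "clip \<gamma> a b s"
  define x where "x = s / \<gamma>"
  have c: "?c = min b (max a x)" by (simp add: clip_def x_def)
  consider "x \<le> a" | "b \<le> x" | "a \<le> x" "x \<le> b" by linarith
  then have "0 \<le> (?c - v) * (x - (?c + v) / 2)"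
  proof cases
    case 1
    then have "?c = a" using assms c by simp
    then show ?thesis using 1 assms by (intro mult_nonpos_nonpos) simp_all
  next
    case 2
    then have "?c = b" using assms c by simp
    then show ?thesis using 2 assms by (intro mult_nonneg_nonneg) simp_all
  next
    case 3
    then have "?c = x" using c by simp
    then have "(?c - v) * (x - (?c + v) / 2) = (x - v)\<^sup>2 / 2" by (simp add: power2_eq_square field_simps)
    moreover have "0 \<le> (x - v)\<^sup>2 / 2" by simp
    ultimately show ?thesis by (simp only:)
  qed
  then have "0 \<le> \<gamma> * ((?c - v) * (s / \<gamma> - (?c + v) / 2))" using assms(1) by (simp add: x_def)
  also have "\<dots> = dual_cost \<gamma> a b s - (s * v - \<gamma> / 2 * v\<^sup>2)"
    using assms(1) by (simp add: dual_cost_def power2_eq_square field_simps)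
  finally show ?thesis by simp
qed

lemma clip_bounds: "a \<le> b \<Longrightarrow> a \<le> clip \<gamma> a b s \<and> clip \<gamma> a b s \<le> b"
  by (simp add: clip_def)

lemma clip_lipschitz:
  assumes "0 < \<gamma>" shows "\<bar>clip \<gamma> a b s - clip \<gamma> a b r\<bar> \<le> \<bar>s - r\<bar> / \<gamma>"
proof -
  have "\<bar>clip \<gamma> a b s - clip \<gamma> a b r\<bar> \<le> \<bar>s / \<gamma> - r / \<gamma>\<bar>" by (auto simp: clip_def min_def max_def)
  also have "\<dots> = \<bar>s - r\<bar> / \<gamma>" using assms by (simp add: diff_divide_distrib[symmetric])
  finally show ?thesis .
qed

text \<open>Both bounds hold because the dual cost is the supremum of \<open>s * v - \<gamma> / 2 * v\<^sup>2\<close> over \<open>v \<in> [a, b]\<close>.\<close>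

lemma dual_cost_expansion:
  assumes "0 < \<gamma>" "a \<le> b"
  shows "0 \<le> dual_cost \<gamma> a b (s + r) - dual_cost \<gamma> a b s - clip \<gamma> a b s * r"
    and "dual_cost \<gamma> a b (s + r) - dual_cost \<gamma> a b s - clip \<gamma> a b s * r \<le> r\<^sup>2 / \<gamma>"
proof -
  have "(s + r) * clip \<gamma> a b s - \<gamma> / 2 * (clip \<gamma> a b s)\<^sup>2 \<le> dual_cost \<gamma> a b (s + r)"
    using clip_bounds[OF assms(2)] by (intro dual_cost_ge assms) auto
  then show "0 \<le> dual_cost \<gamma> a b (s + r) - dual_cost \<gamma> a b s - clip \<gamma> a b s * r"
    by (simp add: dual_cost_def[of \<gamma> a b s] algebra_simps)
  \<comment> \<open>For the upper bound the roles are exchanged: the maximizer at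
    \<open>s + r\<close> competes at \<open>s\<close>, and the error is \<open>r\<close> times the
    change of the maximizer.\<close>
  have "s * clip \<gamma> a b (s + r) - \<gamma> / 2 * (clip \<gamma> a b (s + r))\<^sup>2 \<le> dual_cost \<gamma> a b s"
    using clip_bounds[OF assms(2)] by (intro dual_cost_ge assms) auto
  then have "dual_cost \<gamma> a b (s + r) - dual_cost \<gamma> a b s - clip \<gamma> a b s * r \<le> r * (clip \<gamma> a b (s + r) - clip \<gamma> a b s)"
    unfolding dual_cost_def[of \<gamma> a b "s + r"] by (simp add: algebra_simps)
  also have "\<dots> \<le> \<bar>r\<bar> * \<bar>clip \<gamma> a b (s + r) - clip \<gamma> a b s\<bar>" by (metis abs_ge_self abs_mult)
  also have "\<dots> \<le> \<bar>r\<bar> * (\<bar>(s + r) - s\<bar> / \<gamma>)" by (intro mult_left_mono clip_lipschitz assms) auto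
  also have "\<dots> = r\<^sup>2 / \<gamma>" by (simp add: power2_eq_square)
  finally show "dual_cost \<gamma> a b (s + r) - dual_cost \<gamma> a b s - clip \<gamma> a b s * r \<le> r\<^sup>2 / \<gamma>" .
qed

text \<open>Since 0 lies in [a, b], clipping never moves a value away from 0. This keeps the control
  square-integrable even on sets of infinite measure.\<close>

lemma abs_clip_le:
  assumes "a \<le> 0" "0 \<le> b" shows "\<bar>clip \<gamma> a b s\<bar> \<le> \<bar>s / \<gamma>\<bar>"
proof -
  have "\<bar>min b (max a x)\<bar> \<le> \<bar>x\<bar>" for x using assms by (auto simp: min_def max_def)
  then show ?thesis unfolding clip_def .
qed

lemma clip_L2:
  fixes p :: "'c::euclidean_space \<Rightarrow> real"
  assumes "0 < \<gamma>" "a \<le> 0" "0 \<le> b" "p \<in> L2 A" shows "(\<lambda>z. clip \<gamma> a b (p z)) \<in> L2 A"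
proof (rule L2_norm_AE_bound)
  show "(\<lambda>z. (1 / \<gamma>) *\<^sub>R p z) \<in> L2 A" by (rule L2_scaleR[OF assms(4)])
  show "(\<lambda>z. clip \<gamma> a b (p z)) \<in> borel_measurable (lebesgue_on A)"
    using L2_measurable[OF assms(4)] unfolding clip_def by measurable
  show "AE z in lebesgue_on A. norm (clip \<gamma> a b (p z)) \<le> norm ((1 / \<gamma>) *\<^sub>R p z)"
    using abs_clip_le[OF assms(2,3)] by (intro AE_I2) simp
qed

lemma dual_cost_integrable:
  fixes p :: "'c::euclidean_space \<Rightarrow> real"
  assumes "0 < \<gamma>" "a \<le> 0" "0 \<le> b" "p \<in> L2 A"
  shows "integrable (lebesgue_on A) (\<lambda>z. dual_cost \<gamma> a b (p z))"
    and "(LINT z|lebesgue_on A. dual_cost \<gamma> a b (p z))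
      = L2_inner A p (\<lambda>z. clip \<gamma> a b (p z)) - \<gamma> / 2 * (L2_norm A (\<lambda>z. clip \<gamma> a b (p z)))\<^sup>2"
proof -
  note c = clip_L2[OF assms]
  have e: "dual_cost \<gamma> a b (p z) = p z \<bullet> clip \<gamma> a b (p z) - \<gamma> / 2 * (clip \<gamma> a b (p z) \<bullet> clip \<gamma> a b (p z))" for z
    by (simp add: dual_cost_def power2_eq_square)
  have i: "integrable (lebesgue_on A) (\<lambda>z. p z \<bullet> clip \<gamma> a b (p z))"
    "integrable (lebesgue_on A) (\<lambda>z. \<gamma> / 2 * (clip \<gamma> a b (p z) \<bullet> clip \<gamma> a b (p z)))"
    by (rule L2_inner_integrable[OF assms(4) c], rule integrable_mult_right[OF L2_inner_integrable[OF c c]])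
  show "integrable (lebesgue_on A) (\<lambda>z. dual_cost \<gamma> a b (p z))"
    unfolding e by (rule Bochner_Integration.integrable_diff[OF i])
  show "(LINT z|lebesgue_on A. dual_cost \<gamma> a b (p z))
      = L2_inner A p (\<lambda>z. clip \<gamma> a b (p z)) - \<gamma> / 2 * (L2_norm A (\<lambda>z. clip \<gamma> a b (p z)))\<^sup>2"
    unfolding e L2_power2_norm L2_inner_def Bochner_Integration.integral_diff[OF i] by simp
qed

section \<open>Well-posedness of the state equation\<close>

context parabolic_problem
begin

lemma weak_add:
  assumes "weak \<sigma> q w" "weak \<sigma> r v" "q \<in> L2 Q" "r \<in> L2 Q"
  shows "weak \<sigma> (\<lambda>z. q z + r z) (w + v)"
proof -
  have "src (\<lambda>z. q z + r z) = src q + src r"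
    unfolding src_def cls_add[OF Q_sets L2_src[OF assms(3)] L2_src[OF assms(4)], symmetric] by simp
  then show ?thesis
    using assms subspace_energy by (auto simp: weak_def inner_add_left subspace_add)
qed

lemma weak_diff:
  assumes "weak \<sigma> q w" "weak \<sigma> q v"
  shows "weak \<sigma> (\<lambda>z. 0) (w - v)"
proof -
  have "src (\<lambda>z. 0) = 0"
    unfolding src_def zero_prod_def[symmetric] by (rule cls_zero)
  then show ?thesis
    using assms subspace_energy by (auto simp: weak_def inner_diff_left subspace_diff)
qed

text \<open>The adjoint equation is solved with the difference of the two states as right-hand side.
  The difference solves the state equation with source 0, so duality makes its squared norm
  vanish.\<close>

lemma weak_state_unique:
  assumes p: "p \<in> L2 Q" "g \<in> L2 Q" "weak 1 q (cls Q (\<lambda>z. (p z, g z)))"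
    and p': "p' \<in> L2 Q" "g' \<in> L2 Q" "weak 1 q (cls Q (\<lambda>z. (p' z, g' z)))"
  shows "AE z in lebesgue_on Q. p z = p' z"
proof -
  let ?d = "\<lambda>z. p z - p' z" and ?e = "\<lambda>z. g z - g' z"
  have d: "?d \<in> L2 Q" by (rule L2_diff[OF p(1) p'(1)])
  have e: "?e \<in> L2 Q" by (rule L2_diff[OF p(2) p'(2)])
  have "cls Q (\<lambda>z. (?d z, ?e z)) = cls Q (\<lambda>z. (p z, g z)) - cls Q (\<lambda>z. (p' z, g' z))"
    unfolding cls_diff[OF Q_sets L2_norm_Pair(1)[OF p(1,2)] L2_norm_Pair(1)[OF p'(1,2)], symmetric] by simp
  then have w: "weak 1 (\<lambda>z. 0) (cls Q (\<lambda>z. (?d z, ?e z)))" using weak_diff[OF p(3) p'(3)] by simp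
  obtain y where y: "weak (- 1) ?d y" using weak_exists[of "- 1" ?d] by auto
  then have "y \<in> energy" by (simp add: weak_def)
  then obtain u h where u: "u \<in> L2 Q" "h \<in> L2 Q" "y = cls Q (\<lambda>z. (u z, h z))" by (rule energy_cases)
  have "L2_inner Q ?d ?d = L2_inner Q u (\<lambda>z. 0)"
    using y unfolding u(3) by (rule duality[OF d e w u(1,2) _ L2_zero d])
  then have "L2_norm Q ?d = 0" by (simp add: L2_norm_def) (simp add: L2_inner_def)
  then show ?thesis using L2_norm_eq_0_iff[OF Q_sets d] by simp
qed

lemma weak_state_solution_unique:
  assumes "q \<in> L2 Q" "weak_state_solution \<Omega> T \<nu> a0 q p" "weak_state_solution \<Omega> T \<nu> a0 q p'"
  shows "AE z in lebesgue_on Q. p z = p' z"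
  using assms weak_state_unique unfolding weak_state_solution_iff[OF assms(1)] by blast

lemma weak_state_solution_exists:
  assumes q: "q \<in> L2 Q"
  obtains p where "weak_state_solution \<Omega> T \<nu> a0 q p" "L2_norm Q p \<le> stability_const * L2_norm Q q"
proof -
  obtain w where w: "weak 1 q w" "norm w \<le> stability_const * norm (src q)" using weak_exists[of 1 q] by auto
  then have "w \<in> energy" by (simp add: weak_def)
  then obtain p g where p: "p \<in> L2 Q" "g \<in> L2 Q" "w = cls Q (\<lambda>z. (p z, g z))" by (rule energy_cases)
  have "(L2_norm Q p)\<^sup>2 \<le> (norm w)\<^sup>2"
    unfolding p(3) norm_cls[OF Q_sets L2_norm_Pair(1)[OF p(1,2)]] L2_norm_Pair(2)[OF p(1,2)] by simp
  then have "L2_norm Q p \<le> norm w" by (rule power2_le_imp_le) simp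
  with w(2) have "L2_norm Q p \<le> stability_const * L2_norm Q q" by (simp add: norm_src[OF q])
  then show thesis using that w(1) p weak_state_solution_iff[OF q] by blast
qed

lemma weak_state_solution_state:
  assumes "q \<in> L2 Q" shows "weak_state_solution \<Omega> T \<nu> a0 q (state \<Omega> T \<nu> a0 q)"
  using weak_state_solution_exists[OF assms] unfolding state_def by (metis someI)

lemma weak_state_solution_add:
  assumes q: "q \<in> L2 Q" "weak_state_solution \<Omega> T \<nu> a0 q p" and r: "r \<in> L2 Q" "weak_state_solution \<Omega> T \<nu> a0 r p'"
  shows "weak_state_solution \<Omega> T \<nu> a0 (\<lambda>z. q z + r z) (\<lambda>z. p z + p' z)"
proof -
  obtain g where g: "p \<in> L2 Q" "g \<in> L2 Q" "weak 1 q (cls Q (\<lambda>z. (p z, g z)))"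
    using q weak_state_solution_iff by blast
  obtain g' where g': "p' \<in> L2 Q" "g' \<in> L2 Q" "weak 1 r (cls Q (\<lambda>z. (p' z, g' z)))"
    using r weak_state_solution_iff by blast
  have "cls Q (\<lambda>z. (p z + p' z, g z + g' z)) = cls Q (\<lambda>z. (p z, g z)) + cls Q (\<lambda>z. (p' z, g' z))"
    unfolding cls_add[OF Q_sets L2_norm_Pair(1)[OF g(1,2)] L2_norm_Pair(1)[OF g'(1,2)], symmetric] by simp
  then have "weak 1 (\<lambda>z. q z + r z) (cls Q (\<lambda>z. (p z + p' z, g z + g' z)))"
    using weak_add[OF g(3) g'(3) q(1) r(1)] by simp
  then show ?thesis
    unfolding weak_state_solution_iff[OF L2_add[OF q(1) r(1)]]
    using L2_add[OF g(1) g'(1)] L2_add[OF g(2) g'(2)] by (intro conjI bexI[where x = "\<lambda>z. g z + g' z"])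
qed

text \<open>The choice made in \<open>state\<close> disappears here: any weak solution may be
  inserted, so the sum of two states can be used for a sum of sources.\<close>

lemma J_eq:
  assumes O': "open O'" "O' \<subseteq> \<Omega>" and \<gamma>: "0 < \<gamma>" and ab: "a \<le> 0" "0 \<le> b"
    and q: "q \<in> L2 Q" "weak_state_solution \<Omega> T \<nu> a0 q p"
  shows "J \<Omega> O' T \<nu> \<gamma> a b a0 yd q = (LINT z|lebesgue_on (cylinder O' T). dual_cost \<gamma> a b (p z))
    - L2_inner Q q yd + 1/2 * (L2_norm Q q)\<^sup>2"
proof -
  let ?Qo = "cylinder O' T" and ?s = "state \<Omega> T \<nu> a0 q"
  have Qo: "?Qo \<in> sets lebesgue" "?Qo \<subseteq> Q"
  proof -
    have "open ?Qo" using O'(1) by (intro open_Times) auto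
    then show "?Qo \<in> sets lebesgue" by auto
  qed (use O'(2) in auto)
  have s: "weak_state_solution \<Omega> T \<nu> a0 q ?s" by (rule weak_state_solution_state[OF q(1)])
  have L: "?s \<in> L2 ?Qo" "p \<in> L2 ?Qo"
    using s q(2) L2_subset[OF Qo(1) Q_sets Qo(2)] unfolding weak_state_solution_iff[OF q(1)] by blast+
  have "AE z in lebesgue_on Q. ?s z = p z" by (rule weak_state_solution_unique[OF q(1) s q(2)])
  then have "AE z in lebesgue. z \<in> Q \<longrightarrow> ?s z = p z" using Q_sets by (simp add: AE_restrict_space_iff)
  then have "AE z in lebesgue. z \<in> ?Qo \<longrightarrow> ?s z = p z" by eventually_elim (use Qo(2) in auto)
  then have ae: "AE z in lebesgue_on ?Qo. ?s z = p z" using Qo(1) by (simp add: AE_restrict_space_iff)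
  have "(LINT z|lebesgue_on ?Qo. dual_cost \<gamma> a b (?s z)) = (LINT z|lebesgue_on ?Qo. dual_cost \<gamma> a b (p z))"
  proof (rule integral_cong_AE)
    show "AE z in lebesgue_on ?Qo. dual_cost \<gamma> a b (?s z) = dual_cost \<gamma> a b (p z)"
      using ae by eventually_elim simp
  qed (rule borel_measurable_integrable[OF dual_cost_integrable(1)[OF \<gamma> ab L(1)]],
      rule borel_measurable_integrable[OF dual_cost_integrable(1)[OF \<gamma> ab L(2)]])
  then show ?thesis
    unfolding dual_cost_integrable(2)[OF \<gamma> ab L(1)] J_def Let_def Pr_def clip_def by simp
qed

text \<open>\<open>R\<close> is the integral of the pointwise remainder of \<open>dual_cost\<close>
  plus half the squared norm of \<open>h\<close>. Convexity makes the integral nonnegative; from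
  above it is at most 1/\<gamma> times the squared norm of the state of \<open>h\<close>, which
  \<open>stability_const\<close> bounds in terms of \<open>h\<close>.\<close>

lemma J_expansion:
  assumes O': "open O'" "O' \<subseteq> \<Omega>" and \<gamma>: "0 < \<gamma>" and ab: "a \<le> 0" "0 \<le> b"
    and yd: "yd \<in> L2 Q" and q: "q \<in> L2 Q" "weak_state_solution \<Omega> T \<nu> a0 q p"
    and y: "weak_adjoint_solution \<Omega> T \<nu> a0 (\<lambda>z. clip \<gamma> a b (p z) * indicator (cylinder O' T) z) y"
    and h: "h \<in> L2 Q"
  defines "R \<equiv> J \<Omega> O' T \<nu> \<gamma> a b a0 yd (\<lambda>z. q z + h z) - J \<Omega> O' T \<nu> \<gamma> a b a0 yd q - L2_inner Q (\<lambda>z. y z - yd z + q z) h"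
  shows "1/2 * (L2_norm Q h)\<^sup>2 \<le> R"
    and "R \<le> (stability_const\<^sup>2 / \<gamma> + 1/2) * (L2_norm Q h)\<^sup>2"
    and "y \<in> L2 Q"
proof -
  let ?Qo = "cylinder O' T" and ?c = "\<lambda>z. clip \<gamma> a b (p z)" and ?D = "dual_cost \<gamma> a b"
  let ?f = "\<lambda>z. ?c z * indicator ?Qo z"
  have Qo: "?Qo \<in> sets lebesgue" "?Qo \<subseteq> Q"
  proof -
    have "open ?Qo" using O'(1) by (intro open_Times) auto
    then show "?Qo \<in> sets lebesgue" by auto
  qed (use O'(2) in auto)
  obtain g where p: "p \<in> L2 Q" "g \<in> L2 Q" "weak 1 q (cls Q (\<lambda>z. (p z, g z)))"
    using q weak_state_solution_iff by blast
  have cQ: "?c \<in> L2 Q" by (rule clip_L2[OF \<gamma> ab p(1)])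
  have f: "?f \<in> L2 Q"
  proof -
    have m: "(\<lambda>z. indicator ?Qo z :: real) \<in> borel_measurable (lebesgue_on Q)"
      using Qo(1) by (intro measurable_restrict_space1) auto
    have "(\<lambda>z. indicator ?Qo z *\<^sub>R ?c z) \<in> L2 Q"
      by (rule L2_bounded_scaleR[OF m _ cQ, of 1]) (auto simp: indicator_def)
    then show ?thesis by (simp add: mult.commute)
  qed
  obtain k where yk: "y \<in> L2 Q" "k \<in> L2 Q" "weak (- 1) ?f (cls Q (\<lambda>z. (y z, k z)))"
    using y weak_adjoint_solution_iff[OF f] by blast
  then show "y \<in> L2 Q" by blast
  obtain d where d: "weak_state_solution \<Omega> T \<nu> a0 h d" "L2_norm Q d \<le> stability_const * L2_norm Q h"
    by (rule weak_state_solution_exists[OF h])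
  obtain e where de: "d \<in> L2 Q" "e \<in> L2 Q" "weak 1 h (cls Q (\<lambda>z. (d z, e z)))"
    using d(1) h weak_state_solution_iff by blast
  have o: "p \<in> L2 ?Qo" "d \<in> L2 ?Qo" "?c \<in> L2 ?Qo"
    using L2_subset[OF Qo(1) Q_sets Qo(2)] p(1) de(1) cQ by blast+
  \<comment> \<open>The linear term of the expansion is the clipped state paired with the increment
    of the state. Duality rewrites it in terms of \<open>h\<close> itself, and this is where the
    adjoint solution enters the gradient.\<close>
  have dual: "L2_inner ?Qo ?c d = L2_inner Q y h"
  proof -
    have "L2_inner ?Qo ?c d = (LINT z|lebesgue. indicator ?Qo z *\<^sub>R (?c z \<bullet> d z))"
      by (rule L2_inner_indicator[OF Qo(1)])
    also have "\<dots> = (LINT z|lebesgue. indicator Q z *\<^sub>R (?f z \<bullet> d z))"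
      using Qo(2) by (intro Bochner_Integration.integral_cong) (auto simp: indicator_def)
    also have "\<dots> = L2_inner Q d ?f" unfolding L2_inner_indicator[OF Q_sets, symmetric] by (rule L2_inner_commute)
    also have "\<dots> = L2_inner Q y h" by (rule duality[OF de yk h f])
    finally show ?thesis .
  qed
  have i: "integrable (lebesgue_on ?Qo) (\<lambda>z. ?D (p z + d z))" "integrable (lebesgue_on ?Qo) (\<lambda>z. ?D (p z))"
    "integrable (lebesgue_on ?Qo) (\<lambda>z. ?c z \<bullet> d z)"
    by (rule dual_cost_integrable(1)[OF \<gamma> ab L2_add[OF o(1,2)]], rule dual_cost_integrable(1)[OF \<gamma> ab o(1)],
        rule L2_inner_integrable[OF o(3,2)])
  define I where "I = (LINT z|lebesgue_on ?Qo. ?D (p z + d z) - ?D (p z) - ?c z \<bullet> d z)"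
  have "I = (LINT z|lebesgue_on ?Qo. ?D (p z + d z)) - (LINT z|lebesgue_on ?Qo. ?D (p z)) - L2_inner Q y h"
    unfolding I_def dual[symmetric] using i by (simp add: L2_inner_def)
  moreover have "J \<Omega> O' T \<nu> \<gamma> a b a0 yd (\<lambda>z. q z + h z) = (LINT z|lebesgue_on ?Qo. ?D (p z + d z))
      - (L2_inner Q q yd + L2_inner Q h yd) + 1/2 * ((L2_norm Q q)\<^sup>2 + 2 * L2_inner Q q h + (L2_norm Q h)\<^sup>2)"
  proof -
    have qh: "(\<lambda>z. q z + h z) \<in> L2 Q" by (rule L2_add[OF q(1) h])
    have "(L2_norm Q (\<lambda>z. q z + h z))\<^sup>2 = (L2_norm Q q)\<^sup>2 + 2 * L2_inner Q q h + (L2_norm Q h)\<^sup>2"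
      unfolding L2_power2_norm L2_inner_add_left[OF q(1) h qh] L2_inner_add_right[OF q(1) h q(1)]
        L2_inner_add_right[OF q(1) h h] L2_inner_commute[of Q h q] by simp
    then show ?thesis
      unfolding J_eq[OF O' \<gamma> ab qh weak_state_solution_add[OF q h d(1)]] L2_inner_add_left[OF q(1) h yd] by simp
  qed
  moreover have "J \<Omega> O' T \<nu> \<gamma> a b a0 yd q = (LINT z|lebesgue_on ?Qo. ?D (p z)) - L2_inner Q q yd + 1/2 * (L2_norm Q q)\<^sup>2"
    by (rule J_eq[OF O' \<gamma> ab q])
  moreover have "L2_inner Q (\<lambda>z. y z - yd z + q z) h = L2_inner Q y h - L2_inner Q h yd + L2_inner Q q h"
    unfolding L2_inner_add_left[OF L2_diff[OF yk(1) yd] q(1) h] L2_inner_diff_left[OF yk(1) yd h] L2_inner_commute[of Q yd h] ..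
  ultimately have R: "R = I + 1/2 * (L2_norm Q h)\<^sup>2" unfolding R_def by (simp add: add_divide_distrib)
  have ab': "a \<le> b" using ab by linarith
  have "0 \<le> I"
    unfolding I_def using dual_cost_expansion(1)[OF \<gamma> ab'] by (intro Bochner_Integration.integral_nonneg) simp
  then show "1/2 * (L2_norm Q h)\<^sup>2 \<le> R" unfolding R by simp
  have "I \<le> (LINT z|lebesgue_on ?Qo. (1 / \<gamma>) * (d z \<bullet> d z))"
    unfolding I_def
  proof (rule integral_mono)
    show "integrable (lebesgue_on ?Qo) (\<lambda>z. ?D (p z + d z) - ?D (p z) - ?c z \<bullet> d z)"
      by (intro Bochner_Integration.integrable_diff i)
    show "integrable (lebesgue_on ?Qo) (\<lambda>z. (1 / \<gamma>) * (d z \<bullet> d z))"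
      by (rule integrable_mult_right[OF L2_inner_integrable[OF o(2,2)]])
    show "?D (p z + d z) - ?D (p z) - ?c z \<bullet> d z \<le> (1 / \<gamma>) * (d z \<bullet> d z)" for z
      using dual_cost_expansion(2)[OF \<gamma> ab', of "p z" "d z"] by (simp add: power2_eq_square)
  qed
  also have "\<dots> = (1 / \<gamma>) * (L2_norm ?Qo d)\<^sup>2" by (simp add: L2_power2_norm L2_inner_def)
  also have "\<dots> \<le> (1 / \<gamma>) * (stability_const * L2_norm Q h)\<^sup>2"
  proof (intro mult_left_mono power_mono)
    have "(L2_norm ?Qo d)\<^sup>2 \<le> (L2_norm Q d)\<^sup>2"
      unfolding L2_power2_norm L2_inner_indicator[OF Qo(1)] L2_inner_indicator[OF Q_sets]
    proof (rule integral_mono)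
      have *: "integrable lebesgue (\<lambda>z. indicator A z *\<^sub>R (d z \<bullet> d z))" if "A \<in> sets lebesgue" "d \<in> L2 A" for A
        using L2_inner_integrable[OF that(2,2)] that(1) by (simp add: integrable_restrict_space)
      show "integrable lebesgue (\<lambda>z. indicator ?Qo z *\<^sub>R (d z \<bullet> d z))" by (rule *[OF Qo(1) o(2)])
      show "integrable lebesgue (\<lambda>z. indicator Q z *\<^sub>R (d z \<bullet> d z))" by (rule *[OF Q_sets de(1)])
      show "indicator ?Qo z *\<^sub>R (d z \<bullet> d z) \<le> indicator Q z *\<^sub>R (d z \<bullet> d z)" for z
        using Qo(2) by (auto simp: indicator_def)
    qed
    then have "L2_norm ?Qo d \<le> L2_norm Q d" by (rule power2_le_imp_le) (rule L2_norm_nonneg)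
    then show "L2_norm ?Qo d \<le> stability_const * L2_norm Q h" using d(2) by linarith
  qed (use \<gamma> L2_norm_nonneg in auto)
  finally show "R \<le> (stability_const\<^sup>2 / \<gamma> + 1/2) * (L2_norm Q h)\<^sup>2"
    unfolding R by (simp add: power_mult_distrib distrib_right)
qed

end

theorem theorem2p4:
  fixes \<Omega> O' :: "'a::euclidean_space set"
    and T \<nu> \<gamma> a b :: real
    and a0 yd qbar pbar zbar :: "'a \<times> real \<Rightarrow> real"
  assumes "open \<Omega>" and "connected \<Omega>" and "\<Omega> \<noteq> {}"
    and "piecewise_continuous_boundary \<Omega>"
    and "open O'" and "O' \<subseteq> \<Omega>"
    and "T > 0" and "\<nu> > 0" and "\<gamma> > 0"
    and "a \<le> 0" and "0 \<le> b"
    and "a0 \<in> borel_measurable (lebesgue_on (cylinder \<Omega> T))"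
    and "\<exists>M. AE w in lebesgue_on (cylinder \<Omega> T). \<bar>a0 w\<bar> \<le> M"
    and "AE w in lebesgue_on (cylinder \<Omega> T). 0 \<le> a0 w"
    and "yd \<in> L2 (cylinder \<Omega> T)"
    and "qbar \<in> L2 (cylinder \<Omega> T)"
    and "weak_state_solution \<Omega> T \<nu> a0 qbar pbar"
    and "weak_adjoint_solution \<Omega> T \<nu> a0
           (\<lambda>w. Pr a b (\<lambda>y. pbar y / \<gamma>) w * indicator (cylinder O' T) w) zbar"
  shows "has_L2_gradient (cylinder \<Omega> T) (J \<Omega> O' T \<nu> \<gamma> a b a0 yd) qbar
           (\<lambda>w. zbar w - yd w + qbar w)
       \<and> (unique_L2_minimizer (cylinder \<Omega> T) (J \<Omega> O' T \<nu> \<gamma> a b a0 yd) qbar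
           \<longleftrightarrow> (AE w in lebesgue_on (cylinder \<Omega> T). zbar w - yd w + qbar w = 0))"
proof -
  interpret parabolic_problem \<Omega> T \<nu> a0
    using assms by unfold_locales auto
  have adj: "weak_adjoint_solution \<Omega> T \<nu> a0 (\<lambda>w. clip \<gamma> a b (pbar w) * indicator (cylinder O' T) w) zbar"
    using assms(18) unfolding Pr_def clip_def .
  note expansion = J_expansion[OF assms(5,6,9,10,11,15,16,17) adj]
  \<comment> \<open>This conclusion of the expansion does not involve the increment, so the zero
    increment is inserted to extract it.\<close>
  have "zbar \<in> L2 Q" by (rule expansion(3)[OF L2_zero])
  then have g: "(\<lambda>w. zbar w - yd w + qbar w) \<in> L2 Q"
    by (rule L2_add[OF L2_diff[OF _ assms(15)] assms(16)])
  show ?thesis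
    using gradient_and_minimizer_of_expansion[OF Q_sets assms(16) g expansion(1,2)] by blast
qed

end
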